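(* All cofibrations in the category of simplicial sets $\Delta^{op}\mathrm{Sets}$ are symmetrizable cofibrations and all trivial cofibrations in it are symmetrizable trivial cofibrations; and the same holds for all cofibrations and all trivial cofibrations in the category $\Delta^{op}\mathrm{Sets}_*$ of pointed simplicial sets.
   Context: Simplicial sets carry the standard (Kan–Quillen) model structure and the Cartesian product as monoidal product; pointed simplicial sets carry the induced model structure and the smash product. For a morphism $f:X\to Y$ in a closed symmetric monoidal model category $(\mathcal C,\wedge)$ and $n\geq 1$, let $f^{\Box n}:\Box^n_{n-1}(f)\to Y^{\wedge n}$ be the $n$-fold push-out product of $f$ with itself (the push-out product of $f:X\to Y$ and $f':X'\to Y'$ is the canonical morphism $f\Box f':(X\wedge Y')\vee_{X\wedge X'}(Y\wedge X')\to Y\wedge Y'$). The symmetric group $\Sigma_n$ acts on source and target by permuting factors, and $f^{\tilde\Box n}:\Box^n_{n-1}(f)/\Sigma_n\to\mathrm{Sym}^n(Y)=Y^{\wedge n}/\Sigma_n$ is the induced morphism on colimits of the actions. $f$ is a symmetrizable (trivial) cofibration if $f^{\tilde\Box n}$ is a (trivial) cofibration for all $n\geq 1$. *)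

theory Defs
  imports "HOL-Homology.Homology" "HOL-Combinatorics.Permutations"
begin

section \<open>Simplicial sets\<close>

text \<open>
  The morphisms \<open>[m] \<rightarrow> [n]\<close> of the simplex category; they are extensional functions, so that
  equality of morphisms is equality of functions.
\<close>

definition simplex_maps :: "nat \<Rightarrow> nat \<Rightarrow> (nat \<Rightarrow> nat) set" where
  "simplex_maps m n = {\<theta> \<in> {..m} \<rightarrow>\<^sub>E {..n}. mono_on {..m} \<theta>}"

text \<open>
  For \<open>\<theta> \<in> simplex_maps m n\<close>, the function \<open>act X m n \<theta>\<close> is the contravariant action
  \<open>X(\<theta>) : X\<^sub>n \<rightarrow> X\<^sub>m\<close>. Cells of different dimensions may overlap as elements of the type, which is why
  \<open>act\<close> and all maps of simplicial sets carry the dimensions as arguments.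
\<close>

record 'a sset =
  cells :: "nat \<Rightarrow> 'a set"
  act :: "nat \<Rightarrow> nat \<Rightarrow> (nat \<Rightarrow> nat) \<Rightarrow> 'a \<Rightarrow> 'a"

locale simplicial_set =
  fixes X :: "'a sset"
  assumes act_closed:
      "\<lbrakk>\<theta> \<in> simplex_maps m n; x \<in> cells X n\<rbrakk> \<Longrightarrow> act X m n \<theta> x \<in> cells X m"
    and act_id: "x \<in> cells X n \<Longrightarrow> act X n n (restrict id {..n}) x = x"
    and act_compose:
      "\<lbrakk>\<theta> \<in> simplex_maps l m; \<phi> \<in> simplex_maps m n; x \<in> cells X n\<rbrakk>
        \<Longrightarrow> act X l n (compose {..l} \<phi> \<theta>) x = act X l m \<theta> (act X m n \<phi> x)"

locale simplicial_map = source: simplicial_set X + target: simplicial_set Y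
  for X :: "'a sset" and Y :: "'b sset" +
  fixes f :: "nat \<Rightarrow> 'a \<Rightarrow> 'b"
  assumes map_closed: "x \<in> cells X n \<Longrightarrow> f n x \<in> cells Y n"
    and map_natural:
      "\<lbrakk>\<theta> \<in> simplex_maps m n; x \<in> cells X n\<rbrakk> \<Longrightarrow> f m (act X m n \<theta> x) = act Y m n \<theta> (f n x)"

section \<open>Quotients\<close>

definition generated_equiv :: "'a set \<Rightarrow> ('a \<Rightarrow> 'a \<Rightarrow> bool) \<Rightarrow> ('a \<times> 'a) set" where
  "generated_equiv A r =
     {(x, y). x \<in> A \<and> y \<in> A \<and> equivclp (\<lambda>u v. u \<in> A \<and> v \<in> A \<and> r u v) x y}"

lemma equiv_generated_equiv: "equiv A (generated_equiv A r)"
proof (rule equivI)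
  show "generated_equiv A r \<subseteq> A \<times> A"
    by (auto simp: generated_equiv_def)
  show "refl_on A (generated_equiv A r)"
    by (auto simp: refl_on_def generated_equiv_def)
  show "sym (generated_equiv A r)"
    by (auto simp: sym_def generated_equiv_def intro: equivclp_sym)
  show "trans (generated_equiv A r)"
    by (auto simp: trans_def generated_equiv_def intro: equivclp_trans)
qed

text \<open>
  Quotient by the equivalence relation generated in each dimension by \<open>R\<close>. This is the quotient
  simplicial set whenever the relations \<open>R k\<close> are compatible with the simplicial operators; the
  operators then act on classes through representatives.
\<close>

definition quot_sset :: "'a sset \<Rightarrow> (nat \<Rightarrow> 'a \<Rightarrow> 'a \<Rightarrow> bool) \<Rightarrow> 'a set sset" where
  "quot_sset X R =
    \<lparr>cells = (\<lambda>k. cells X k // generated_equiv (cells X k) (R k)),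
     act = (\<lambda>m n \<theta> C. generated_equiv (cells X m) (R m) `` (act X m n \<theta> ` C))\<rparr>"

definition quot_map ::
    "'b sset \<Rightarrow> (nat \<Rightarrow> 'b \<Rightarrow> 'b \<Rightarrow> bool) \<Rightarrow> (nat \<Rightarrow> 'a \<Rightarrow> 'b) \<Rightarrow> nat \<Rightarrow> 'a set \<Rightarrow> 'b set" where
  "quot_map Y R g k C = generated_equiv (cells Y k) (R k) `` (g k ` C)"

text \<open>The quotient topology on the set of classes: \<open>\<Union>\<U>\<close> is the preimage of \<open>\<U>\<close>.\<close>

definition quotient_space :: "'a topology \<Rightarrow> ('a \<Rightarrow> 'a \<Rightarrow> bool) \<Rightarrow> 'a set topology" where
  "quotient_space T r =
     topology (\<lambda>\<U>. \<U> \<subseteq> topspace T // generated_equiv (topspace T) r \<and> openin T (\<Union>\<U>))"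

lemma openin_quotient_space:
  "openin (quotient_space T r) \<U> \<longleftrightarrow>
     \<U> \<subseteq> topspace T // generated_equiv (topspace T) r \<and> openin T (\<Union>\<U>)"
proof -
  let ?E = "generated_equiv (topspace T) r"
  have "istopology (\<lambda>\<U>. \<U> \<subseteq> topspace T // ?E \<and> openin T (\<Union>\<U>))"
    unfolding istopology_def
  proof (intro conjI allI impI)
    fix S U assume S: "S \<subseteq> topspace T // ?E \<and> openin T (\<Union>S)"
      and U: "U \<subseteq> topspace T // ?E \<and> openin T (\<Union>U)"
    have "\<Union>(S \<inter> U) = \<Union>S \<inter> \<Union>U"
      using S U quotient_disj[OF equiv_generated_equiv[of "topspace T" r]] by blast
    with S U show "S \<inter> U \<subseteq> topspace T // ?E" "openin T (\<Union>(S \<inter> U))"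
      by auto
  next
    fix \<K> assume "\<forall>K\<in>\<K>. K \<subseteq> topspace T // ?E \<and> openin T (\<Union>K)"
    moreover have "\<Union>(\<Union>\<K>) = \<Union>(Union ` \<K>)"
      by auto
    ultimately show "\<Union>\<K> \<subseteq> topspace T // ?E" "openin T (\<Union>(\<Union>\<K>))"
      by auto
  qed
  then show ?thesis
    by (simp add: quotient_space_def topology_inverse')
qed

section \<open>Geometric realization and the Kan--Quillen model structure\<close>

text \<open>
  The affine map \<open>\<Delta>\<^sup>m \<rightarrow> \<Delta>\<^sup>n\<close> induced by \<open>\<theta> : [m] \<rightarrow> [n]\<close> in barycentric coordinates.
\<close>

definition simplex_push :: "nat \<Rightarrow> (nat \<Rightarrow> nat) \<Rightarrow> (nat \<Rightarrow> real) \<Rightarrow> nat \<Rightarrow> real" where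
  "simplex_push m \<theta> t = (\<lambda>j. \<Sum>i | i \<le> m \<and> \<theta> i = j. t i)"

definition simplex_coproduct :: "'a sset \<Rightarrow> ((nat \<times> 'a) \<times> (nat \<Rightarrow> real)) topology" where
  "simplex_coproduct X =
     sum_topology (\<lambda>(k, x). subtopology (powertop_real UNIV) (standard_simplex k))
       (SIGMA k : UNIV. cells X k)"

definition simplex_gluing ::
    "'a sset \<Rightarrow> (nat \<times> 'a) \<times> (nat \<Rightarrow> real) \<Rightarrow> (nat \<times> 'a) \<times> (nat \<Rightarrow> real) \<Rightarrow> bool" where
  "simplex_gluing X p q \<longleftrightarrow>
     (\<exists>m n \<theta> x t. \<theta> \<in> simplex_maps m n \<and> x \<in> cells X n \<and> t \<in> standard_simplex m \<and>
        p = ((m, act X m n \<theta> x), t) \<and> q = ((n, x), simplex_push m \<theta> t))"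

definition realization :: "'a sset \<Rightarrow> ((nat \<times> 'a) \<times> (nat \<Rightarrow> real)) set topology" where
  "realization X = quotient_space (simplex_coproduct X) (simplex_gluing X)"

definition realization_map ::
    "'b sset \<Rightarrow> (nat \<Rightarrow> 'a \<Rightarrow> 'b) \<Rightarrow> ((nat \<times> 'a) \<times> (nat \<Rightarrow> real)) set
       \<Rightarrow> ((nat \<times> 'b) \<times> (nat \<Rightarrow> real)) set" where
  "realization_map Y f C =
     generated_equiv (topspace (simplex_coproduct Y)) (simplex_gluing Y) ``
       ((\<lambda>((k, x), t). ((k, f k x), t)) ` C)"

definition homotopy_equivalence_map :: "'a topology \<Rightarrow> 'b topology \<Rightarrow> ('a \<Rightarrow> 'b) \<Rightarrow> bool" where
  "homotopy_equivalence_map T U h \<longleftrightarrow>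
     continuous_map T U h \<and>
     (\<exists>g. continuous_map U T g \<and>
        homotopic_with (\<lambda>_. True) T T (g \<circ> h) id \<and>
        homotopic_with (\<lambda>_. True) U U (h \<circ> g) id)"

text \<open>
  Quillen's description of the model structure (\<^emph>\<open>Homotopical Algebra\<close>, II.3): the cofibrations are
  the injective maps, and the weak equivalences are the maps whose geometric realization is a
  homotopy equivalence. Since realizations are CW complexes, the latter are also the maps whose
  realization is a weak homotopy equivalence.
\<close>

definition weak_equivalence :: "'a sset \<Rightarrow> 'b sset \<Rightarrow> (nat \<Rightarrow> 'a \<Rightarrow> 'b) \<Rightarrow> bool" where
  "weak_equivalence X Y f \<longleftrightarrow>
     simplicial_map X Y f \<and>
     homotopy_equivalence_map (realization X) (realization Y) (realization_map Y f)"

definition cofibration :: "'a sset \<Rightarrow> 'b sset \<Rightarrow> (nat \<Rightarrow> 'a \<Rightarrow> 'b) \<Rightarrow> bool" where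
  "cofibration X Y f \<longleftrightarrow> simplicial_map X Y f \<and> (\<forall>n. inj_on (f n) (cells X n))"

definition trivial_cofibration :: "'a sset \<Rightarrow> 'b sset \<Rightarrow> (nat \<Rightarrow> 'a \<Rightarrow> 'b) \<Rightarrow> bool" where
  "trivial_cofibration X Y f \<longleftrightarrow> cofibration X Y f \<and> weak_equivalence X Y f"

section \<open>Orbits of the symmetric group\<close>

text \<open>
  \<open>\<alpha>\<close> is the action of \<open>\<Sigma>\<^sub>n\<close>, the permutations of \<open>{..<n}\<close>; \<open>orbits\<close> is the colimit of the action.
\<close>

definition orbit_rel :: "nat \<Rightarrow> ((nat \<Rightarrow> nat) \<Rightarrow> 'a \<Rightarrow> 'a) \<Rightarrow> nat \<Rightarrow> 'a \<Rightarrow> 'a \<Rightarrow> bool" where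
  "orbit_rel n \<alpha> k u v \<longleftrightarrow> (\<exists>\<sigma>. \<sigma> permutes {..<n} \<and> v = \<alpha> \<sigma> u)"

definition orbits :: "nat \<Rightarrow> ((nat \<Rightarrow> nat) \<Rightarrow> 'a \<Rightarrow> 'a) \<Rightarrow> 'a sset \<Rightarrow> 'a set sset" where
  "orbits n \<alpha> Z = quot_sset Z (orbit_rel n \<alpha>)"

section \<open>Iterated push-out products of simplicial sets\<close>

definition power_sset :: "'a sset \<Rightarrow> nat \<Rightarrow> 'a list sset" where
  "power_sset Y n =
    \<lparr>cells = (\<lambda>k. {w. length w = n \<and> set w \<subseteq> cells Y k}),
     act = (\<lambda>m k \<theta>. map (act Y m k \<theta>))\<rparr>"

text \<open>
  A map \<open>f : X \<rightarrow> Y\<close> spans the cube \<open>{0 < 1}\<^sup>n \<rightarrow> sSet\<close> whose value at a vertex \<open>\<epsilon>\<close> is the product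
  \<open>Z\<^sub>1 \<times> \<dots> \<times> Z\<^sub>n\<close> with \<open>Z\<^sub>i = X\<close> if \<open>\<epsilon>\<^sub>i = 0\<close> and \<open>Z\<^sub>i = Y\<close> if \<open>\<epsilon>\<^sub>i = 1\<close>. The source \<open>\<box>\<^sup>n\<^sub>n\<^sub>-\<^sub>1(f)\<close> of
  the \<open>n\<close>-fold push-out product is the colimit of this cube with its terminal vertex removed.
  For \<open>n = 2\<close> this is the push-out \<open>(X \<times> Y) \<union>\<^bsub>X\<times>X\<^esub> (Y \<times> X)\<close>.
  A cell of the product at \<open>\<epsilon>\<close> is a list of length \<open>n\<close> with entries \<open>Inl x\<close> (where \<open>\<epsilon>\<^sub>i = 0\<close>) or
  \<open>Inr y\<close> (where \<open>\<epsilon>\<^sub>i = 1\<close>), so that \<open>punctured_cube\<close> is the coproduct of the products over all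
  non-terminal vertices, and \<open>cube_step\<close> relates a cell to its images along the edges and
  higher-dimensional diagonals of the cube.
\<close>

definition punctured_cube :: "'a sset \<Rightarrow> 'b sset \<Rightarrow> nat \<Rightarrow> ('a + 'b) list sset" where
  "punctured_cube X Y n =
    \<lparr>cells = (\<lambda>k. {w. length w = n \<and> set w \<subseteq> cells X k <+> cells Y k \<and> (\<exists>z\<in>set w. isl z)}),
     act = (\<lambda>m k \<theta>. map (map_sum (act X m k \<theta>) (act Y m k \<theta>)))\<rparr>"

definition cube_step ::
    "(nat \<Rightarrow> 'a \<Rightarrow> 'b) \<Rightarrow> nat \<Rightarrow> ('a + 'b) list \<Rightarrow> ('a + 'b) list \<Rightarrow> bool" where
  "cube_step f k = list_all2 (\<lambda>u v. v = u \<or> (\<exists>x. u = Inl x \<and> v = Inr (f k x)))"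

definition box_source ::
    "'a sset \<Rightarrow> 'b sset \<Rightarrow> (nat \<Rightarrow> 'a \<Rightarrow> 'b) \<Rightarrow> nat \<Rightarrow> ('a + 'b) list set sset" where
  "box_source X Y f n = quot_sset (punctured_cube X Y n) (cube_step f)"

text \<open>The map \<open>f\<^sup>\<box>\<^sup>n\<close> from the colimit to the value \<open>Y\<^sup>n\<close> of the cube at the terminal vertex.\<close>

definition terminal_vertex_map ::
    "(nat \<Rightarrow> 'a \<Rightarrow> 'b) \<Rightarrow> nat \<Rightarrow> ('a + 'b) list \<Rightarrow> 'b list" where
  "terminal_vertex_map f k = map (case_sum (f k) id)"

definition box_map :: "(nat \<Rightarrow> 'a \<Rightarrow> 'b) \<Rightarrow> nat \<Rightarrow> ('a + 'b) list set \<Rightarrow> 'b list" where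
  "box_map f k C = the_elem (terminal_vertex_map f k ` C)"

text \<open>
  \<open>\<Sigma>\<^sub>n\<close> permutes the factors of \<open>Y\<^sup>n\<close>, and it permutes the vertices of the cube together with the
  factors of their values; on the colimit this is \<open>C \<mapsto> permute_list \<sigma> ` C\<close>.
\<close>

definition sym_power :: "'a sset \<Rightarrow> nat \<Rightarrow> 'a list set sset" where
  "sym_power Y n = orbits n permute_list (power_sset Y n)"

definition sym_box_source ::
    "'a sset \<Rightarrow> 'b sset \<Rightarrow> (nat \<Rightarrow> 'a \<Rightarrow> 'b) \<Rightarrow> nat \<Rightarrow> ('a + 'b) list set set sset" where
  "sym_box_source X Y f n = orbits n (\<lambda>\<sigma>. image (permute_list \<sigma>)) (box_source X Y f n)"

definition sym_box_map ::
    "'b sset \<Rightarrow> (nat \<Rightarrow> 'a \<Rightarrow> 'b) \<Rightarrow> nat \<Rightarrow> nat \<Rightarrow> ('a + 'b) list set set \<Rightarrow> 'b list set" where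
  "sym_box_map Y f n = quot_map (power_sset Y n) (orbit_rel n permute_list) (box_map f)"

definition symmetrizable_cofibration ::
    "'a sset \<Rightarrow> 'b sset \<Rightarrow> (nat \<Rightarrow> 'a \<Rightarrow> 'b) \<Rightarrow> bool" where
  "symmetrizable_cofibration X Y f \<longleftrightarrow>
     simplicial_map X Y f \<and>
     (\<forall>n\<ge>1. cofibration (sym_box_source X Y f n) (sym_power Y n) (sym_box_map Y f n))"

definition symmetrizable_trivial_cofibration ::
    "'a sset \<Rightarrow> 'b sset \<Rightarrow> (nat \<Rightarrow> 'a \<Rightarrow> 'b) \<Rightarrow> bool" where
  "symmetrizable_trivial_cofibration X Y f \<longleftrightarrow>
     simplicial_map X Y f \<and>
     (\<forall>n\<ge>1. trivial_cofibration (sym_box_source X Y f n) (sym_power Y n) (sym_box_map Y f n))"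

section \<open>Pointed simplicial sets\<close>

text \<open>
  A pointed simplicial set is a simplicial set \<open>X\<close> with a vertex \<open>x0 \<in> X\<^sub>0\<close>; \<open>base_cell X x0 k\<close> is
  its degeneracy in dimension \<open>k\<close>.
\<close>

definition base_cell :: "'a sset \<Rightarrow> 'a \<Rightarrow> nat \<Rightarrow> 'a" where
  "base_cell X x0 k = act X k 0 (restrict (\<lambda>_. 0) {..k}) x0"

definition pointed_map ::
    "'a sset \<Rightarrow> 'a \<Rightarrow> 'b sset \<Rightarrow> 'b \<Rightarrow> (nat \<Rightarrow> 'a \<Rightarrow> 'b) \<Rightarrow> bool" where
  "pointed_map X x0 Y y0 f \<longleftrightarrow>
     simplicial_map X Y f \<and> x0 \<in> cells X 0 \<and> y0 \<in> cells Y 0 \<and> f 0 x0 = y0"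

definition pointed_cofibration ::
    "'a sset \<Rightarrow> 'a \<Rightarrow> 'b sset \<Rightarrow> 'b \<Rightarrow> (nat \<Rightarrow> 'a \<Rightarrow> 'b) \<Rightarrow> bool" where
  "pointed_cofibration X x0 Y y0 f \<longleftrightarrow> pointed_map X x0 Y y0 f \<and> cofibration X Y f"

definition pointed_trivial_cofibration ::
    "'a sset \<Rightarrow> 'a \<Rightarrow> 'b sset \<Rightarrow> 'b \<Rightarrow> (nat \<Rightarrow> 'a \<Rightarrow> 'b) \<Rightarrow> bool" where
  "pointed_trivial_cofibration X x0 Y y0 f \<longleftrightarrow>
     pointed_map X x0 Y y0 f \<and> trivial_cofibration X Y f"

definition quot_point :: "'a sset \<Rightarrow> (nat \<Rightarrow> 'a \<Rightarrow> 'a \<Rightarrow> bool) \<Rightarrow> 'a \<Rightarrow> 'a set" where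
  "quot_point X R x0 = generated_equiv (cells X 0) (R 0) `` {x0}"

text \<open>
  The smash power \<open>Y\<^sup>\<and>\<^sup>n\<close> collapses the cells of \<open>Y\<^sup>n\<close> with some factor at the base point.
\<close>

definition smash_rel :: "'a sset \<Rightarrow> 'a \<Rightarrow> nat \<Rightarrow> 'a list \<Rightarrow> 'a list \<Rightarrow> bool" where
  "smash_rel Y y0 k u v \<longleftrightarrow> base_cell Y y0 k \<in> set u \<and> base_cell Y y0 k \<in> set v"

definition smash_power :: "'a sset \<Rightarrow> 'a \<Rightarrow> nat \<Rightarrow> 'a list set sset" where
  "smash_power Y y0 n = quot_sset (power_sset Y n) (smash_rel Y y0)"

definition smash_power_point :: "'a sset \<Rightarrow> 'a \<Rightarrow> nat \<Rightarrow> 'a list set" where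
  "smash_power_point Y y0 n = quot_point (power_sset Y n) (smash_rel Y y0) (replicate n y0)"

text \<open>
  In the pointed case the values of the cube are the smash products
  \<open>Z\<^sub>1 \<and> \<dots> \<and> Z\<^sub>n\<close> and the coproduct is the wedge, so that on top of \<open>cube_step\<close> all cells having some
  factor at the base point are identified, both within each vertex of the cube (smash product) and
  across the vertices (wedge).
\<close>

definition at_base :: "'a sset \<Rightarrow> 'a \<Rightarrow> 'b sset \<Rightarrow> 'b \<Rightarrow> nat \<Rightarrow> ('a + 'b) list \<Rightarrow> bool" where
  "at_base X x0 Y y0 k w \<longleftrightarrow> Inl (base_cell X x0 k) \<in> set w \<or> Inr (base_cell Y y0 k) \<in> set w"

definition smash_cube_rel ::
    "'a sset \<Rightarrow> 'a \<Rightarrow> 'b sset \<Rightarrow> 'b \<Rightarrow> (nat \<Rightarrow> 'a \<Rightarrow> 'b) \<Rightarrow> nat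
       \<Rightarrow> ('a + 'b) list \<Rightarrow> ('a + 'b) list \<Rightarrow> bool" where
  "smash_cube_rel X x0 Y y0 f k u v \<longleftrightarrow>
     cube_step f k u v \<or> (at_base X x0 Y y0 k u \<and> at_base X x0 Y y0 k v)"

definition smash_box_source ::
    "'a sset \<Rightarrow> 'a \<Rightarrow> 'b sset \<Rightarrow> 'b \<Rightarrow> (nat \<Rightarrow> 'a \<Rightarrow> 'b) \<Rightarrow> nat \<Rightarrow> ('a + 'b) list set sset" where
  "smash_box_source X x0 Y y0 f n =
     quot_sset (punctured_cube X Y n) (smash_cube_rel X x0 Y y0 f)"

definition smash_box_point ::
    "'a sset \<Rightarrow> 'a \<Rightarrow> 'b sset \<Rightarrow> 'b \<Rightarrow> (nat \<Rightarrow> 'a \<Rightarrow> 'b) \<Rightarrow> nat \<Rightarrow> ('a + 'b) list set" where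
  "smash_box_point X x0 Y y0 f n =
     quot_point (punctured_cube X Y n) (smash_cube_rel X x0 Y y0 f) (replicate n (Inl x0))"

definition smash_box_map ::
    "'b sset \<Rightarrow> 'b \<Rightarrow> (nat \<Rightarrow> 'a \<Rightarrow> 'b) \<Rightarrow> nat \<Rightarrow> nat \<Rightarrow> ('a + 'b) list set \<Rightarrow> 'b list set" where
  "smash_box_map Y y0 f n = quot_map (power_sset Y n) (smash_rel Y y0) (terminal_vertex_map f)"

definition sym_smash_power :: "'a sset \<Rightarrow> 'a \<Rightarrow> nat \<Rightarrow> 'a list set set sset" where
  "sym_smash_power Y y0 n = orbits n (\<lambda>\<sigma>. image (permute_list \<sigma>)) (smash_power Y y0 n)"

definition sym_smash_power_point :: "'a sset \<Rightarrow> 'a \<Rightarrow> nat \<Rightarrow> 'a list set set" where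
  "sym_smash_power_point Y y0 n =
     quot_point (smash_power Y y0 n) (orbit_rel n (\<lambda>\<sigma>. image (permute_list \<sigma>)))
       (smash_power_point Y y0 n)"

definition sym_smash_box_source ::
    "'a sset \<Rightarrow> 'a \<Rightarrow> 'b sset \<Rightarrow> 'b \<Rightarrow> (nat \<Rightarrow> 'a \<Rightarrow> 'b) \<Rightarrow> nat
       \<Rightarrow> ('a + 'b) list set set sset" where
  "sym_smash_box_source X x0 Y y0 f n =
     orbits n (\<lambda>\<sigma>. image (permute_list \<sigma>)) (smash_box_source X x0 Y y0 f n)"

definition sym_smash_box_point ::
    "'a sset \<Rightarrow> 'a \<Rightarrow> 'b sset \<Rightarrow> 'b \<Rightarrow> (nat \<Rightarrow> 'a \<Rightarrow> 'b) \<Rightarrow> nat \<Rightarrow> ('a + 'b) list set set" where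
  "sym_smash_box_point X x0 Y y0 f n =
     quot_point (smash_box_source X x0 Y y0 f n) (orbit_rel n (\<lambda>\<sigma>. image (permute_list \<sigma>)))
       (smash_box_point X x0 Y y0 f n)"

definition sym_smash_box_map ::
    "'b sset \<Rightarrow> 'b \<Rightarrow> (nat \<Rightarrow> 'a \<Rightarrow> 'b) \<Rightarrow> nat \<Rightarrow> nat
       \<Rightarrow> ('a + 'b) list set set \<Rightarrow> 'b list set set" where
  "sym_smash_box_map Y y0 f n =
     quot_map (smash_power Y y0 n) (orbit_rel n (\<lambda>\<sigma>. image (permute_list \<sigma>)))
       (smash_box_map Y y0 f n)"

definition symmetrizable_pointed_cofibration ::
    "'a sset \<Rightarrow> 'a \<Rightarrow> 'b sset \<Rightarrow> 'b \<Rightarrow> (nat \<Rightarrow> 'a \<Rightarrow> 'b) \<Rightarrow> bool" where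
  "symmetrizable_pointed_cofibration X x0 Y y0 f \<longleftrightarrow>
     pointed_map X x0 Y y0 f \<and>
     (\<forall>n\<ge>1. pointed_cofibration
        (sym_smash_box_source X x0 Y y0 f n) (sym_smash_box_point X x0 Y y0 f n)
        (sym_smash_power Y y0 n) (sym_smash_power_point Y y0 n)
        (sym_smash_box_map Y y0 f n))"

definition symmetrizable_pointed_trivial_cofibration ::
    "'a sset \<Rightarrow> 'a \<Rightarrow> 'b sset \<Rightarrow> 'b \<Rightarrow> (nat \<Rightarrow> 'a \<Rightarrow> 'b) \<Rightarrow> bool" where
  "symmetrizable_pointed_trivial_cofibration X x0 Y y0 f \<longleftrightarrow>
     pointed_map X x0 Y y0 f \<and>
     (\<forall>n\<ge>1. pointed_trivial_cofibration
        (sym_smash_box_source X x0 Y y0 f n) (sym_smash_box_point X x0 Y y0 f n)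
        (sym_smash_power Y y0 n) (sym_smash_power_point Y y0 n)
        (sym_smash_box_map Y y0 f n))"

end

theory Submission
  imports Defs "HOL-Analysis.Analysis"
begin

text \<open>
  If \<open>f : X \<rightarrow> Y\<close> is injective, then \<open>f\<^sup>\<box>\<^sup>n\<close> modulo \<open>\<Sigma>\<^sub>n\<close> is the inclusion into \<open>Sym\<^sup>n Y\<close> of the classes of
  those \<open>n\<close>-tuples which have some entry in \<open>X\<close>, and similarly in the pointed case, where all tuples with
  some entry at the base point are identified. If moreover \<open>|f|\<close> is a homotopy equivalence, the
  homotopy extension property makes \<open>|X|\<close> a strong deformation retract of \<open>|Y|\<close>. Applying the
  deformation to every entry of a tuple gives a homotopy of \<open>|Sym\<^sup>n Y|\<close>, which preserves the tuples with
  some entry in \<open>|X|\<close>, and at the end of which all entries lie in \<open>|X|\<close>. It is compatible with the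
  collapse of the base point because the deformation is constant on \<open>|X|\<close>. Its continuity is not immediate,
  since the topology of \<open>|Y\<^sup>n|\<close> may be finer than the product topology of \<open>|Y|\<^sup>n\<close>; it
  holds because a compact subset of \<open>|Y|\<close> meets only finitely many cells.
\<close>

section \<open>Simplicial operators on the standard simplices\<close>

text \<open>The push-out product of trivial cofibrations is again one, but this does not pass
  formally to orbits: the symmetric group acts with fixed points, and orbits of such an action need
  not preserve weak equivalences. Hence an explicit homotopy that commutes with permutations. Points
  are reduced to cells by one device: finitely many points of a realization can be written with
  cells of one common dimension at one common interior point of a simplex
  (\<open>simplex_refinement\<close>, \<open>common_refinement\<close>), which is the triangulation
  of a product of simplices read pointwise. At an interior point equal points mean equal cells, so
  injectivity, membership in a subcomplex and the kernel of the quotient become statements on cells.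
  The CW arguments rest on a single extension principle over the skeleta,
  \<open>realization_extend\<close>, with a constraint relation \<open>R\<close> as parameter. One
  choice of \<open>R\<close> gives homotopy extension; another gives real functions with prescribed
  values, from which the Hausdorff property and the finiteness for compact sets follow.\<close>

lemma simplex_maps_le: "\<theta> \<in> simplex_maps m n \<Longrightarrow> i \<le> m \<Longrightarrow> \<theta> i \<le> n"
  by (auto simp: simplex_maps_def)

lemma simplex_maps_mono: "\<theta> \<in> simplex_maps m n \<Longrightarrow> i \<le> j \<Longrightarrow> j \<le> m \<Longrightarrow> \<theta> i \<le> \<theta> j"
  by (auto simp: simplex_maps_def mono_on_def)

lemma simplex_maps_eqI:
  assumes "\<theta> \<in> simplex_maps m n" "\<phi> \<in> simplex_maps m n'" "\<And>i. i \<le> m \<Longrightarrow> \<theta> i = \<phi> i"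
  shows "\<theta> = \<phi>"
proof
  fix i show "\<theta> i = \<phi> i"
    using assms by (cases "i \<le> m") (auto simp: simplex_maps_def PiE_def extensional_def)
qed

lemma restrict_simplex_maps:
  "(\<And>i. i \<le> m \<Longrightarrow> \<theta> i \<le> n) \<Longrightarrow> (\<And>i j. i \<le> j \<Longrightarrow> j \<le> m \<Longrightarrow> \<theta> i \<le> \<theta> j)
    \<Longrightarrow> restrict \<theta> {..m} \<in> simplex_maps m n"
  by (auto simp: simplex_maps_def mono_on_def)

lemma compose_simplex_maps:
  "\<theta> \<in> simplex_maps l m \<Longrightarrow> \<phi> \<in> simplex_maps m n \<Longrightarrow> compose {..l} \<phi> \<theta> \<in> simplex_maps l n"
  unfolding compose_def by (rule restrict_simplex_maps)
    (auto intro: simplex_maps_le simplex_maps_mono)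

lemma id_simplex_maps: "restrict id {..n} \<in> simplex_maps n n"
  by (rule restrict_simplex_maps) auto

lemma finite_simplex_maps: "finite (simplex_maps m n)"
  unfolding simplex_maps_def by (rule finite_subset[of _ "{..m} \<rightarrow>\<^sub>E {..n}"]) (auto intro: finite_PiE)

text \<open>A surjective self-map of a finite set is injective, so \<open>\<theta>\<close> is
  strictly increasing; this bounds \<open>\<theta> a\<close> from below by induction upwards from 0
  and from above by induction downwards from \<open>n\<close>.\<close>

lemma simplex_maps_surj_endo:
  assumes "\<theta> \<in> simplex_maps n n" "\<theta> ` {..n} = {..n}"
  shows "\<theta> = restrict id {..n}"
proof -
  have inj: "inj_on \<theta> {..n}"
    by (simp add: assms(2) eq_card_imp_inj_on)
  have "\<theta> i = i" if "i \<le> n" for i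
  proof -
    have lt: "\<theta> a < \<theta> b" if "a < b" "b \<le> n" for a b
      using simplex_maps_mono[OF assms(1), of a b] inj that
      by (metis atMost_iff inj_on_eq_iff le_neq_implies_less less_imp_le order_less_irrefl order_trans)
    have up: "a \<le> \<theta> a" if "a \<le> n" for a
      using that
    proof (induction a)
      case (Suc a)
      then show ?case using lt[of a "Suc a"] by force
    qed auto
    have "\<theta> (n - b) \<le> n - b" if "b \<le> n" for b
      using that
    proof (induction b)
      case 0 then show ?case using simplex_maps_le[OF assms(1)] by auto
    next
      case (Suc b)
      then show ?case using lt[of "n - Suc b" "n - b"] by force
    qed
    from this[of "n - i"] up[OF that] that show ?thesis by auto
  qed
  then show ?thesis
    by (intro simplex_maps_eqI[OF assms(1) id_simplex_maps]) auto
qed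

text \<open>Any choice of preimages under a monotone surjection is monotone. The freedom to send
  \<open>\<alpha> j\<close> back to a given \<open>j\<close> is what later tells two operators apart
  in \<open>nondegenerate_unique\<close>.\<close>

lemma simplex_maps_section:
  assumes "\<alpha> \<in> simplex_maps m k" "\<alpha> ` {..m} = {..k}" "j \<le> m"
  obtains d where "d \<in> simplex_maps k m" "compose {..k} \<alpha> d = restrict id {..k}" "d (\<alpha> j) = j"
proof -
  define d0 where "d0 = (\<lambda>i. if i = \<alpha> j then j else (SOME a. a \<le> m \<and> \<alpha> a = i))"
  have d0: "d0 i \<le> m \<and> \<alpha> (d0 i) = i" if "i \<le> k" for i
  proof -
    have "\<exists>a. a \<le> m \<and> \<alpha> a = i" using assms(2) that by (metis atMost_iff imageE)
    from someI_ex[OF this] show ?thesis using assms(3) by (auto simp: d0_def)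
  qed
  have mono: "d0 i \<le> d0 i'" if "i \<le> i'" "i' \<le> k" for i i'
  proof (rule ccontr)
    assume "\<not> d0 i \<le> d0 i'"
    then have lt: "d0 i' < d0 i" by simp
    then have "\<alpha> (d0 i') \<le> \<alpha> (d0 i)"
      using simplex_maps_mono[OF assms(1), of "d0 i'" "d0 i"] d0[of i] that by auto
    then show False using d0[of i] d0[of i'] that lt by auto
  qed
  show ?thesis
  proof
    show d: "restrict d0 {..k} \<in> simplex_maps k m"
      by (rule restrict_simplex_maps) (use d0 mono in auto)
    show "compose {..k} \<alpha> (restrict d0 {..k}) = restrict id {..k}"
      by (rule simplex_maps_eqI[OF compose_simplex_maps[OF d assms(1)] id_simplex_maps])
        (use d0 in \<open>auto simp: compose_def\<close>)
    show "restrict d0 {..k} (\<alpha> j) = j"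
      using simplex_maps_le[OF assms(1,3)] by (simp add: d0_def)
  qed
qed

definition coface :: "nat \<Rightarrow> nat \<Rightarrow> nat \<Rightarrow> nat" where
  "coface n i = restrict (\<lambda>j. if j < i then j else Suc j) {..n}"

lemma coface_simplex_maps: "coface n i \<in> simplex_maps n (Suc n)"
  unfolding coface_def by (rule restrict_simplex_maps) auto

text \<open>A missed value \<open>i\<close> can be skipped: \<open>\<rho>0\<close> closes the gap at
  \<open>i\<close> and the coface reopens it.\<close>

lemma simplex_maps_factor:
  assumes \<theta>: "\<theta> \<in> simplex_maps m k" and ns: "\<theta> ` {..m} \<noteq> {..k}"
  obtains r \<iota> \<rho> where "r < k" "\<iota> \<in> simplex_maps r k" "\<rho> \<in> simplex_maps m r"
    "\<theta> = compose {..m} \<iota> \<rho>"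
proof -
  obtain i where i: "i \<le> k" "i \<notin> \<theta> ` {..m}"
    using ns simplex_maps_le[OF \<theta>] by blast
  have "k \<noteq> 0"
    using i simplex_maps_le[OF \<theta>, of 0] by force
  then obtain r where r: "k = Suc r" by (cases k) auto
  define \<rho>0 where "\<rho>0 = (\<lambda>j. if \<theta> j < i then \<theta> j else \<theta> j - 1)"
  have ne: "\<theta> j \<noteq> i" if "j \<le> m" for j using i that by auto
  have \<rho>: "restrict \<rho>0 {..m} \<in> simplex_maps m r"
  proof (rule restrict_simplex_maps)
    fix j assume "j \<le> m" then show "\<rho>0 j \<le> r"
      using simplex_maps_le[OF \<theta>, of j] i r by (auto simp: \<rho>0_def)
  next
    fix j j' assume "j \<le> j'" "j' \<le> m" then show "\<rho>0 j \<le> \<rho>0 j'"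
      using simplex_maps_mono[OF \<theta>, of j j'] ne[of j] ne[of j'] by (auto simp: \<rho>0_def)
  qed
  have "\<theta> = compose {..m} (coface r i) (restrict \<rho>0 {..m})"
  proof (rule simplex_maps_eqI[OF \<theta> compose_simplex_maps[OF \<rho> coface_simplex_maps]])
    fix j assume j: "j \<le> m"
    have "\<rho>0 j \<le> r" using simplex_maps_le[OF \<rho> j] j by simp
    then show "\<theta> j = compose {..m} (coface r i) (restrict \<rho>0 {..m}) j"
      using j ne[OF j] by (auto simp: compose_def coface_def \<rho>0_def)
  qed
  with that[of r "coface r i"] \<rho> coface_simplex_maps r show ?thesis by auto
qed

section \<open>Barycentric coordinates and their push-forward\<close>

lemma standard_simplex_nonneg: "t \<in> standard_simplex k \<Longrightarrow> 0 \<le> t i"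
  by (simp add: standard_simplex_def)

lemma standard_simplex_sum: "t \<in> standard_simplex k \<Longrightarrow> (\<Sum>i\<le>k. t i) = 1"
  by (simp add: standard_simplex_def)

lemma standard_simplex_out: "t \<in> standard_simplex k \<Longrightarrow> k < i \<Longrightarrow> t i = 0"
  by (simp add: standard_simplex_def)

lemma standard_simplexI:
  assumes "\<And>i. i \<le> k \<Longrightarrow> 0 \<le> t i" "\<And>i. k < i \<Longrightarrow> t i = 0" "(\<Sum>i\<le>k. t i) = 1"
  shows "t \<in> standard_simplex k"
proof -
  have "0 \<le> t i" for i using assms(1,2) by (metis linorder_not_le order_refl)
  moreover have "t i \<le> 1" for i
  proof (cases "i \<le> k")
    case True
    have "t i \<le> (\<Sum>i\<le>k. t i)"
      using assms(1) True by (intro member_le_sum) auto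
    then show ?thesis using assms(3) by simp
  qed (simp add: assms(2))
  ultimately show ?thesis using assms by (simp add: standard_simplex_def)
qed

text \<open>With \<open>t\<close> read as a mass distribution on the vertices,
  \<open>simplex_push\<close> is its push-forward. The case of initial segments \<open>J\<close> is
  what \<open>simplex_push_inj\<close> compares.\<close>

lemma sum_simplex_push:
  assumes "finite J"
  shows "(\<Sum>j\<in>J. simplex_push m \<theta> t j) = (\<Sum>i | i \<le> m \<and> \<theta> i \<in> J. t i)"
proof -
  have "(\<Sum>j\<in>J. \<Sum>i\<in>{i \<in> {i. i \<le> m \<and> \<theta> i \<in> J}. \<theta> i = j}. t i) = (\<Sum>i | i \<le> m \<and> \<theta> i \<in> J. t i)"
    by (rule sum.group) (use assms in auto)
  moreover have "{i \<in> {i. i \<le> m \<and> \<theta> i \<in> J}. \<theta> i = j} = {i. i \<le> m \<and> \<theta> i = j}" if "j \<in> J" for j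
    using that by auto
  ultimately show ?thesis by (simp add: simplex_push_def cong: sum.cong)
qed

lemma simplex_push_restrict: "simplex_push m (restrict \<theta> {..m}) t = simplex_push m \<theta> t"
  by (auto simp: simplex_push_def fun_eq_iff intro!: sum.cong)

lemma simplex_push_in:
  assumes "\<theta> \<in> simplex_maps m n" "t \<in> standard_simplex m"
  shows "simplex_push m \<theta> t \<in> standard_simplex n"
proof (rule standard_simplexI)
  show "0 \<le> simplex_push m \<theta> t i" for i
    unfolding simplex_push_def by (intro sum_nonneg standard_simplex_nonneg[OF assms(2)])
  show "simplex_push m \<theta> t i = 0" if "n < i" for i
  proof -
    have "{i'. i' \<le> m \<and> \<theta> i' = i} = {}" using simplex_maps_le[OF assms(1)] that by force
    then show ?thesis by (simp only: simplex_push_def sum.empty)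
  qed
  have "{i. i \<le> m \<and> \<theta> i \<in> {..n}} = {..m}" using simplex_maps_le[OF assms(1)] by auto
  then show "sum (simplex_push m \<theta> t) {..n} = 1"
    using standard_simplex_sum[OF assms(2)] by (simp add: sum_simplex_push)
qed

lemma simplex_push_compose:
  assumes "\<theta> \<in> simplex_maps l m"
  shows "simplex_push l (compose {..l} \<phi> \<theta>) t = simplex_push m \<phi> (simplex_push l \<theta> t)"
proof
  fix j
  have "simplex_push m \<phi> (simplex_push l \<theta> t) j = (\<Sum>i | i \<le> l \<and> \<theta> i \<in> {i. i \<le> m \<and> \<phi> i = j}. t i)"
    by (subst simplex_push_def) (rule sum_simplex_push, simp)
  also have "{i. i \<le> l \<and> \<theta> i \<in> {i. i \<le> m \<and> \<phi> i = j}} = {i. i \<le> l \<and> compose {..l} \<phi> \<theta> i = j}"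
    using simplex_maps_le[OF assms] by (auto simp: compose_def)
  finally show "simplex_push l (compose {..l} \<phi> \<theta>) t j = simplex_push m \<phi> (simplex_push l \<theta> t) j"
    by (simp add: simplex_push_def)
qed

lemma simplex_push_id:
  assumes "t \<in> standard_simplex n"
  shows "simplex_push n (restrict id {..n}) t = t"
proof
  fix j
  have "{i. i \<le> n \<and> restrict id {..n} i = j} = (if j \<le> n then {j} else {})" by auto
  then show "simplex_push n (restrict id {..n}) t j = t j"
    using standard_simplex_out[OF assms] by (simp add: simplex_push_def)
qed

text \<open>In dimension 0 this is the whole simplex. At such points an operator is determined by
  its effect (\<open>simplex_push_inj\<close>) and a cell by the point it yields
  (\<open>realization_point_open_inj\<close>).\<close>

definition open_simplex :: "nat \<Rightarrow> (nat \<Rightarrow> real) set" where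
  "open_simplex k = {t \<in> standard_simplex k. \<forall>i\<le>k. 0 < t i}"

lemma open_simplex_standard: "t \<in> open_simplex k \<Longrightarrow> t \<in> standard_simplex k"
  by (simp add: open_simplex_def)

text \<open>
  Both maps group the intervals of lengths \<open>v 0, v 1, \<dots>\<close> into the same consecutive blocks, and
  positivity of the lengths makes the block of each interval unique.
\<close>

lemma simplex_push_inj:
  assumes v: "v \<in> open_simplex q" and \<alpha>: "\<alpha> \<in> simplex_maps q m" and \<beta>: "\<beta> \<in> simplex_maps q m"
    and eq: "simplex_push q \<alpha> v = simplex_push q \<beta> v"
  shows "\<alpha> = \<beta>"
proof -
  have sub: "{i. i \<le> q \<and> \<gamma> i \<le> c} \<subseteq> {i. i \<le> q \<and> \<gamma>' i \<le> c}"
    if \<gamma>: "\<gamma> \<in> simplex_maps q m" "\<gamma>' \<in> simplex_maps q m"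
      and e: "simplex_push q \<gamma> v = simplex_push q \<gamma>' v" for \<gamma> \<gamma>' c
  proof (rule ccontr)
    let ?A = "{i. i \<le> q \<and> \<gamma> i \<le> c}" and ?B = "{i. i \<le> q \<and> \<gamma>' i \<le> c}"
    assume "\<not> ?A \<subseteq> ?B"
    then obtain i where i: "i \<in> ?A" "i \<notin> ?B" by blast
    \<comment> \<open>By monotonicity both sets are initial segments, hence comparable. A failing
      inclusion makes the other one strict at \<open>i\<close>, and positive weights then contradict
      the equality of partial sums.\<close>
    have "?B \<subseteq> ?A"
    proof
      fix a assume a: "a \<in> ?B"
      have "a \<le> i"
      proof (rule ccontr)
        assume "\<not> a \<le> i"
        then have "\<gamma>' i \<le> \<gamma>' a" using simplex_maps_mono[OF \<gamma>(2), of i a] a by auto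
        then show False using a i by auto
      qed
      then show "a \<in> ?A" using simplex_maps_mono[OF \<gamma>(1), of a i] i a by auto
    qed
    then have "sum v ?B < sum v ?A"
      using i v by (intro sum_strict_mono2[of _ _ i]) (auto simp: open_simplex_def less_imp_le)
    moreover have "sum v {i. i \<le> q \<and> \<gamma> i \<in> {..c}} = sum v {i. i \<le> q \<and> \<gamma>' i \<in> {..c}}"
      by (metis e sum_simplex_push finite_atMost)
    ultimately show False by simp
  qed
  have "{i. i \<le> q \<and> \<alpha> i \<le> c} = {i. i \<le> q \<and> \<beta> i \<le> c}" for c
    using sub[OF \<alpha> \<beta> eq] sub[OF \<beta> \<alpha> eq[symmetric]] by blast
  then have "\<alpha> i \<le> c \<longleftrightarrow> \<beta> i \<le> c" if "i \<le> q" for i c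
    using that by blast
  then have "\<alpha> i = \<beta> i" if "i \<le> q" for i
    by (meson that dual_order.antisym order_refl)
  then show ?thesis by (rule simplex_maps_eqI[OF \<alpha> \<beta>])
qed

lemma simplex_push_open_surj:
  assumes "t \<in> open_simplex k" "\<alpha> \<in> simplex_maps m k" "simplex_push m \<alpha> w = t"
  shows "\<alpha> ` {..m} = {..k}"
proof -
  have "j \<in> \<alpha> ` {..m}" if "j \<le> k" for j
  proof (rule ccontr)
    assume "j \<notin> \<alpha> ` {..m}"
    then have "{i. i \<le> m \<and> \<alpha> i = j} = {}" by auto
    then have "t j = 0" using assms(3) by (auto simp only: simplex_push_def sum.empty)
    then show False using assms(1) that by (auto simp: open_simplex_def)
  qed
  then show ?thesis using simplex_maps_le[OF assms(2)] by auto
qed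

lemma simplex_push_nonsurj_zero:
  assumes "\<theta> \<in> simplex_maps m k" "\<theta> ` {..m} \<noteq> {..k}"
  shows "\<exists>i\<le>k. simplex_push m \<theta> t i = 0"
proof -
  obtain i where i: "i \<le> k" "i \<notin> \<theta> ` {..m}"
    using assms simplex_maps_le[OF assms(1)] by blast
  then have "{i'. i' \<le> m \<and> \<theta> i' = i} = {}" by auto
  then have "simplex_push m \<theta> t i = 0" by (simp only: simplex_push_def sum.empty)
  with i show ?thesis by blast
qed

text \<open>A zero coordinate puts the point on the facet opposite to vertex \<open>i\<close>;
  deleting that coordinate inverts the inclusion of the facet.\<close>

lemma simplex_push_coface:
  assumes t: "t \<in> standard_simplex (Suc n)" and i: "i \<le> Suc n" "t i = 0"
  shows "(\<lambda>j. if j < i then t j else t (Suc j)) \<in> standard_simplex n"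
    and "simplex_push n (coface n i) (\<lambda>j. if j < i then t j else t (Suc j)) = t"
proof -
  let ?t = "\<lambda>j. if j < i then t j else t (Suc j)"
  show push: "simplex_push n (coface n i) ?t = t"
  proof
    fix j
    consider "j < i" | "j = i" | "j > i" "j \<le> Suc n" | "j > i" "j > Suc n" by linarith
    then show "simplex_push n (coface n i) ?t j = t j"
    proof cases
      case 1
      then have "{i'. i' \<le> n \<and> coface n i i' = j} = {j}" using i by (auto simp: coface_def)
      then show ?thesis using 1 by (simp add: simplex_push_def)
    next
      case 2
      then have "{i'. i' \<le> n \<and> coface n i i' = j} = {}" by (auto simp: coface_def)
      then show ?thesis using i(2) 2 by (simp only: simplex_push_def sum.empty)
    next
      case 3
      then have "{i'. i' \<le> n \<and> coface n i i' = j} = {j - 1}" by (auto simp: coface_def)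
      then have "simplex_push n (coface n i) ?t j = sum ?t {j - 1}" by (simp only: simplex_push_def)
      then show ?thesis using 3 by auto
    next
      case 4
      then have "{i'. i' \<le> n \<and> coface n i i' = j} = {}" by (auto simp: coface_def)
      then have "simplex_push n (coface n i) ?t j = 0" by (simp only: simplex_push_def sum.empty)
      then show ?thesis using standard_simplex_out[OF t 4(2)] by simp
    qed
  qed
  show "?t \<in> standard_simplex n"
  proof (rule standard_simplexI)
    show "0 \<le> ?t j" for j using standard_simplex_nonneg[OF t] by simp
    show "?t j = 0" if "n < j" for j
      using that i standard_simplex_out[OF t, of "Suc j"] by (cases "j < i") auto
    have "(\<Sum>j\<le>n. ?t j) = (\<Sum>j | j \<le> n \<and> coface n i j \<in> {..Suc n}. ?t j)"
      by (rule sum.cong) (auto simp: coface_def)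
    also have "\<dots> = (\<Sum>j\<le>Suc n. simplex_push n (coface n i) ?t j)"
      by (rule sum_simplex_push[symmetric]) simp
    also have "\<dots> = 1" unfolding push by (rule standard_simplex_sum[OF t])
    finally show "(\<Sum>j\<le>n. ?t j) = 1" .
  qed
qed

text \<open>Zero coordinates are deleted one at a time; this stops at the latest in dimension 0,
  where the only weight is 1.\<close>

lemma open_simplex_support:
  assumes "t \<in> standard_simplex k"
  obtains m w \<iota> where "m \<le> k" "w \<in> open_simplex m" "\<iota> \<in> simplex_maps m k" "simplex_push m \<iota> w = t"
  using assms
proof (induction k arbitrary: t thesis)
  case 0
  then have "t \<in> open_simplex 0" by (auto simp: open_simplex_def standard_simplex_0)
  then show ?case
    by (rule "0.prems"(1)[OF order_refl _ id_simplex_maps simplex_push_id[OF "0.prems"(2)]])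
next
  case (Suc k)
  show ?case
  proof (cases "\<exists>i\<le>Suc k. t i = 0")
    case True
    then obtain i where i: "i \<le> Suc k" "t i = 0" by blast
    note c = simplex_push_coface[OF Suc.prems(2) i]
    obtain m w \<iota> where *: "m \<le> k" "w \<in> open_simplex m" "\<iota> \<in> simplex_maps m k"
      "simplex_push m \<iota> w = (\<lambda>j. if j < i then t j else t (Suc j))"
      using Suc.IH[OF _ c(1)] by blast
    show ?thesis
      using * c(2) simplex_push_compose[OF *(3), of "coface k i" w]
      by (intro Suc.prems(1)[OF _ *(2) compose_simplex_maps[OF *(3) coface_simplex_maps[of k i]]]) auto
  next
    case False
    then have "t \<in> open_simplex (Suc k)"
      using Suc.prems(2) standard_simplex_nonneg[OF Suc.prems(2)]
      by (auto simp: open_simplex_def less_le)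
    then show ?thesis
      using Suc.prems(1)[OF order_refl _ id_simplex_maps] simplex_push_id[OF Suc.prems(2)] by blast
  qed
qed

section \<open>Common refinement of two points\<close>

text \<open>Two subdivisions of one interval, into blocks of lengths \<open>t\<close> and
  \<open>s\<close>, have a common refinement with lengths \<open>w\<close>; \<open>\<alpha>\<close>
  and \<open>\<beta>\<close> tell in which block a piece lies. The total length is left free so that
  an induction can cut pieces off, and the bound on \<open>m\<close> later makes sets of refining
  cells finite.\<close>

definition mass_refinement ::
    "nat \<Rightarrow> (nat \<Rightarrow> real) \<Rightarrow> nat \<Rightarrow> (nat \<Rightarrow> real) \<Rightarrow> bool" where
  "mass_refinement k t l s \<longleftrightarrow>
    (\<exists>m w \<alpha> \<beta>. m \<le> k + l \<and> (\<forall>i\<le>m. 0 \<le> w i) \<and> \<alpha> \<in> simplex_maps m k \<and> \<beta> \<in> simplex_maps m l \<and>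
       (\<forall>j\<le>k. simplex_push m \<alpha> w j = t j) \<and> (\<forall>j\<le>l. simplex_push m \<beta> w j = s j))"

lemma mass_refinement_sym: "mass_refinement k t l s \<Longrightarrow> mass_refinement l s k t"
  unfolding mass_refinement_def by (metis add.commute)

lemma mass_refinement_0:
  assumes "\<And>i. i \<le> l \<Longrightarrow> 0 \<le> s i" "(\<Sum>i\<le>l. s i) = t 0"
  shows "mass_refinement 0 t l s"
proof -
  have z: "restrict (\<lambda>_. 0) {..l} \<in> simplex_maps l 0" by (rule restrict_simplex_maps) auto
  have "simplex_push l (restrict (\<lambda>_. 0) {..l}) s 0 = t 0"
    unfolding simplex_push_restrict using assms(2) by (simp add: simplex_push_def atMost_def)
  moreover have "simplex_push l (restrict id {..l}) s j = s j" if "j \<le> l" for j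
  proof -
    have "{i. i \<le> l \<and> id i = j} = {j}" using that by auto
    then show ?thesis unfolding simplex_push_restrict by (simp add: simplex_push_def)
  qed
  ultimately show ?thesis
    unfolding mass_refinement_def using assms(1) z id_simplex_maps
    by (intro exI[of _ l] exI[of _ s] exI[of _ "restrict (\<lambda>_. 0) {..l}"] exI[of _ "restrict id {..l}"])
      auto
qed

lemma simplex_push_append:
  assumes "\<alpha> \<in> simplex_maps m k"
  shows "simplex_push (Suc m) (restrict (\<alpha>(Suc m := c)) {..Suc m}) (w(Suc m := x)) j
    = simplex_push m \<alpha> w j + (if j = c then x else 0)"
proof -
  have set: "{i. i \<le> Suc m \<and> (\<alpha>(Suc m := c)) i = j} =
      {i. i \<le> m \<and> \<alpha> i = j} \<union> (if j = c then {Suc m} else {})"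
    by (auto simp: le_Suc_eq)
  have "simplex_push (Suc m) (\<alpha>(Suc m := c)) (w(Suc m := x)) j
      = sum (w(Suc m := x)) {i. i \<le> m \<and> \<alpha> i = j} + (if j = c then x else 0)"
    unfolding simplex_push_def by (subst set, subst sum.union_disjoint) auto
  also have "sum (w(Suc m := x)) {i. i \<le> m \<and> \<alpha> i = j} = simplex_push m \<alpha> w j"
    unfolding simplex_push_def by (rule sum.cong) auto
  finally show ?thesis unfolding simplex_push_restrict .
qed

text \<open>The last block of \<open>t\<close> is cut off the end of both subdivisions. Putting it
  back adds one piece, labelled \<open>Suc k\<close> on one side and \<open>Suc l\<close> on the
  other.\<close>

lemma mass_refinement_step:
  assumes "mass_refinement k t (Suc l) (s(Suc l := s (Suc l) - t (Suc k)))" "0 \<le> t (Suc k)"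
  shows "mass_refinement (Suc k) t (Suc l) s"
proof -
  obtain m w \<alpha> \<beta> where *: "m \<le> k + Suc l" "\<forall>i\<le>m. 0 \<le> w i"
    "\<alpha> \<in> simplex_maps m k" "\<beta> \<in> simplex_maps m (Suc l)"
    "\<forall>j\<le>k. simplex_push m \<alpha> w j = t j"
    "\<forall>j\<le>Suc l. simplex_push m \<beta> w j = (s(Suc l := s (Suc l) - t (Suc k))) j"
    using assms(1) unfolding mass_refinement_def by blast
  let ?w = "w(Suc m := t (Suc k))"
  let ?a = "restrict (\<alpha>(Suc m := Suc k)) {..Suc m}" and ?b = "restrict (\<beta>(Suc m := Suc l)) {..Suc m}"
  have a: "?a \<in> simplex_maps (Suc m) (Suc k)"
    by (rule restrict_simplex_maps)
      (use simplex_maps_le[OF *(3)] simplex_maps_mono[OF *(3)] in \<open>auto simp: le_Suc_eq\<close>)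
  have b: "?b \<in> simplex_maps (Suc m) (Suc l)"
    by (rule restrict_simplex_maps)
      (use simplex_maps_le[OF *(4)] simplex_maps_mono[OF *(4)] in \<open>auto simp: le_Suc_eq\<close>)
  have z: "simplex_push m \<alpha> w (Suc k) = 0"
  proof -
    have "{i. i \<le> m \<and> \<alpha> i = Suc k} = {}" using simplex_maps_le[OF *(3)] by force
    then show ?thesis by (simp only: simplex_push_def sum.empty)
  qed
  have "simplex_push (Suc m) ?a ?w j = t j" if "j \<le> Suc k" for j
    using *(5) z that by (auto simp: simplex_push_append[OF *(3)] le_Suc_eq)
  moreover have "simplex_push (Suc m) ?b ?w j = s j" if "j \<le> Suc l" for j
    using *(6) that by (auto simp: simplex_push_append[OF *(4)])
  moreover have "\<forall>i\<le>Suc m. 0 \<le> ?w i" using *(2) assms(2) by (auto simp: le_Suc_eq)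
  moreover have "Suc m \<le> Suc k + Suc l" using *(1) by simp
  ultimately show ?thesis
    unfolding mass_refinement_def using a b by blast
qed

lemma mass_refinement_exists:
  assumes "\<And>i. i \<le> k \<Longrightarrow> 0 \<le> t i" "\<And>i. i \<le> l \<Longrightarrow> 0 \<le> s i" "(\<Sum>i\<le>k. t i) = (\<Sum>i\<le>l. s i)"
  shows "mass_refinement k t l s"
  using assms
proof (induction "k + l" arbitrary: k l t s rule: less_induct)
  case less
  show ?case
  proof (cases k)
    case 0
    then show ?thesis using less.prems by (auto intro: mass_refinement_0)
  next
    case k: (Suc k')
    show ?thesis
    proof (cases l)
      case 0
      then show ?thesis
        using less.prems by (auto intro!: mass_refinement_sym[OF mass_refinement_0])
    next
      case l: (Suc l')
      have upd: "(\<Sum>i\<le>Suc n. (u(Suc n := u (Suc n) - x)) i) = (\<Sum>i\<le>Suc n. u i) - x"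
        for n :: nat and u :: "nat \<Rightarrow> real" and x
        by simp
      show ?thesis
      \<comment> \<open>The shorter of the two last blocks is cut off, so that the remaining lengths
        stay nonnegative and the totals stay equal.\<close>
      proof (cases "t k \<le> s l")
        case True
        have "mass_refinement k' t l (s(l := s l - t k))"
          using less.prems True upd[where n = l' and u = s and x = "t k"] k l
          by (intro less.hyps) auto
        then show ?thesis
          using mass_refinement_step[of k' t l' s] less.prems k l by simp
      next
        case False
        have "mass_refinement l' s k (t(k := t k - s l))"
          using less.prems False upd[where n = k' and u = t and x = "s l"] k l
          by (intro less.hyps) auto
        then show ?thesis
          using mass_refinement_step[of l' s k' t] less.prems k l by (simp add: mass_refinement_sym)
      qed
    qed
  qed
qed

text \<open>This is the triangulation of a product of two simplices, seen at one point:
  \<open>(t, s)\<close> lies inside a simplex whose two projections are \<open>\<alpha>\<close> and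
  \<open>\<beta>\<close>.\<close>

lemma simplex_refinement:
  assumes t: "t \<in> standard_simplex k" and s: "s \<in> standard_simplex l"
  obtains m w \<alpha> \<beta> where "m \<le> k + l" "w \<in> open_simplex m" "\<alpha> \<in> simplex_maps m k"
    "\<beta> \<in> simplex_maps m l" "simplex_push m \<alpha> w = t" "simplex_push m \<beta> w = s"
proof -
  have "mass_refinement k t l s"
    using standard_simplex_nonneg[OF t] standard_simplex_nonneg[OF s]
      standard_simplex_sum[OF t] standard_simplex_sum[OF s]
    by (intro mass_refinement_exists) auto
  then obtain m w \<alpha> \<beta> where *: "m \<le> k + l" "\<forall>i\<le>m. 0 \<le> w i"
    "\<alpha> \<in> simplex_maps m k" "\<beta> \<in> simplex_maps m l"
    "\<forall>j\<le>k. simplex_push m \<alpha> w j = t j" "\<forall>j\<le>l. simplex_push m \<beta> w j = s j"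
    unfolding mass_refinement_def by blast
  \<comment> \<open>The refinement says nothing about \<open>w\<close> beyond \<open>m\<close>,
    while points of a simplex vanish there.\<close>
  define w' where "w' = (\<lambda>i. if i \<le> m then w i else 0)"
  have pw: "simplex_push m \<gamma> w' = simplex_push m \<gamma> w" for \<gamma>
    by (auto simp: simplex_push_def w'_def fun_eq_iff intro!: sum.cong)
  have w': "w' \<in> standard_simplex m"
  proof (rule standard_simplexI)
    have "{i. i \<le> m \<and> \<alpha> i \<in> {..k}} = {..m}" using simplex_maps_le[OF *(3)] by auto
    then have "sum w' {..m} = (\<Sum>j\<le>k. simplex_push m \<alpha> w' j)"
      by (simp add: sum_simplex_push)
    also have "\<dots> = (\<Sum>j\<le>k. t j)" using *(5) by (simp add: pw)
    finally show "sum w' {..m} = 1" using standard_simplex_sum[OF t] by simp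
  qed (use *(2) in \<open>auto simp: w'_def\<close>)
  have eq: "simplex_push m \<alpha> w' = t" "simplex_push m \<beta> w' = s"
    using simplex_push_in[OF *(3) w'] simplex_push_in[OF *(4) w'] *(5,6) t s
      standard_simplex_out not_le pw by (metis ext)+
  \<comment> \<open>Pieces of length 0 are dropped to reach an interior point; this only lowers the
    dimension, so the bound survives.\<close>
  obtain m' v \<iota> where v: "m' \<le> m" "v \<in> open_simplex m'" "\<iota> \<in> simplex_maps m' m"
    "simplex_push m' \<iota> v = w'"
    using open_simplex_support[OF w'] .
  show ?thesis
    using that[OF _ v(2) compose_simplex_maps[OF v(3) *(3)] compose_simplex_maps[OF v(3) *(4)]]
      simplex_push_compose[OF v(3)] v *(1) eq by simp
qed

section \<open>Points of the geometric realization\<close>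

abbreviation simplex_space :: "nat \<Rightarrow> (nat \<Rightarrow> real) topology" where
  "simplex_space k \<equiv> subtopology (powertop_real UNIV) (standard_simplex k)"

lemma compact_simplex_space: "compact_space (simplex_space k)"
  by (simp add: compact_space_subtopology compactin_standard_simplex)

lemma Hausdorff_simplex_space: "Hausdorff_space (simplex_space k)"
  by (simp add: Hausdorff_space_product_topology Hausdorff_space_subtopology)

lemma continuous_map_simplex_coordinate:
  "continuous_map (simplex_space k) euclideanreal (\<lambda>t. t i)"
  by (intro continuous_map_from_subtopology continuous_map_product_projection) simp

lemma continuous_map_into_simplex:
  assumes "\<And>i. continuous_map T euclideanreal (\<lambda>x. f x i)" "\<And>x. x \<in> topspace T \<Longrightarrow> f x \<in> standard_simplex k"
  shows "continuous_map T (simplex_space k) f"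
  using assms by (auto simp: continuous_map_in_subtopology continuous_map_componentwise_UNIV)

lemma continuous_map_simplex_push:
  assumes "\<theta> \<in> simplex_maps m n"
  shows "continuous_map (simplex_space m) (simplex_space n) (simplex_push m \<theta>)"
proof (rule continuous_map_into_simplex)
  show "continuous_map (simplex_space m) euclideanreal (\<lambda>t. simplex_push m \<theta> t i)" for i
    unfolding simplex_push_def by (intro continuous_map_sum continuous_map_simplex_coordinate) simp
qed (use simplex_push_in[OF assms] in simp)

definition realization_point :: "'a sset \<Rightarrow> nat \<Rightarrow> 'a \<Rightarrow> (nat \<Rightarrow> real) \<Rightarrow> ((nat \<times> 'a) \<times> (nat \<Rightarrow> real)) set"
  where "realization_point X k x t =
    generated_equiv (topspace (simplex_coproduct X)) (simplex_gluing X) `` {((k, x), t)}"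

lemma topspace_simplex_coproduct:
  "topspace (simplex_coproduct X) = {((k, x), t) | k x t. x \<in> cells X k \<and> t \<in> standard_simplex k}"
  unfolding simplex_coproduct_def by (auto simp: o_def)

lemma generated_equivI:
  "x \<in> A \<Longrightarrow> y \<in> A \<Longrightarrow> r x y \<Longrightarrow> (x, y) \<in> generated_equiv A r"
  by (simp add: generated_equiv_def r_into_equivclp)

lemma generated_equiv_class_eq_iff:
  "x \<in> A \<Longrightarrow> y \<in> A \<Longrightarrow>
    generated_equiv A r `` {x} = generated_equiv A r `` {y} \<longleftrightarrow> (x, y) \<in> generated_equiv A r"
  using eq_equiv_class_iff[OF equiv_generated_equiv] .

lemma equiv_Image_eq:
  assumes "equiv S E" "a \<in> A" "\<And>b. b \<in> A \<Longrightarrow> (a, b) \<in> E"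
  shows "E `` A = E `` {a}"
  using assms unfolding equiv_def by (auto dest: transD)

lemma generated_equiv_induct [consumes 1, case_names refl base sym trans]:
  assumes "(x, y) \<in> generated_equiv A r"
    and "\<And>u. u \<in> A \<Longrightarrow> P u u"
    and "\<And>u v. u \<in> A \<Longrightarrow> v \<in> A \<Longrightarrow> r u v \<Longrightarrow> P u v"
    and "\<And>u v. P u v \<Longrightarrow> P v u"
    and "\<And>u v w. P u v \<Longrightarrow> P v w \<Longrightarrow> P u w"
  shows "P x y"
proof -
  have "equivclp (\<lambda>u v. u \<in> A \<and> v \<in> A \<and> r u v) x y" and x: "x \<in> A"
    using assms(1) by (auto simp: generated_equiv_def)
  then show ?thesis
  proof (induction rule: equivclp_induct)
    case base
    then show ?case by (rule assms(2))
  next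
    case (step y z)
    then have "P y z" using assms(3,4) by blast
    with step show ?case using assms(5) by blast
  qed
qed

lemma topspace_quotient_space: "topspace (quotient_space T r) = topspace T // generated_equiv (topspace T) r"
proof -
  have "openin (quotient_space T r) (topspace T // generated_equiv (topspace T) r)"
    by (simp add: openin_quotient_space Union_quotient[OF equiv_generated_equiv])
  then show ?thesis
    by (metis openin_quotient_space openin_subset openin_topspace subset_antisym)
qed

lemma quotient_map_quotient_space:
  "quotient_map T (quotient_space T r) (\<lambda>p. generated_equiv (topspace T) r `` {p})"
proof -
  let ?E = "generated_equiv (topspace T) r"
  have "{p \<in> topspace T. ?E `` {p} \<in> U} = \<Union>U" if U: "U \<subseteq> topspace T // ?E" for U
  proof (intro equalityI subsetI)
    fix p assume "p \<in> {p \<in> topspace T. ?E `` {p} \<in> U}"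
    then show "p \<in> \<Union>U" using equiv_class_self[OF equiv_generated_equiv, of p "topspace T"] by blast
  next
    fix p assume "p \<in> \<Union>U"
    then obtain C where C: "C \<in> U" "p \<in> C" by blast
    then have "C \<in> topspace T // ?E" using U by blast
    then obtain a where a: "a \<in> topspace T" "C = ?E `` {a}" by (rule quotientE)
    then have "(a, p) \<in> ?E" using C(2) by simp
    then have "C = ?E `` {p}" "p \<in> topspace T"
      unfolding a(2) by (rule equiv_class_eq[OF equiv_generated_equiv], simp add: generated_equiv_def)
    then show "p \<in> {p \<in> topspace T. ?E `` {p} \<in> U}" using C by blast
  qed
  then show ?thesis
    unfolding quotient_map_def
    by (auto simp: topspace_quotient_space openin_quotient_space quotient_def)
qed

lemma quotient_map_realization:
  "quotient_map (simplex_coproduct X) (realization X) (\<lambda>((k, x), t). realization_point X k x t)"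
proof -
  have "(\<lambda>((k, x), t). realization_point X k x t)
      = (\<lambda>p. generated_equiv (topspace (simplex_coproduct X)) (simplex_gluing X) `` {p})"
    by (auto simp: realization_point_def)
  then show ?thesis
    unfolding realization_def by (simp only: quotient_map_quotient_space)
qed

lemma topspace_realization:
  "topspace (realization X) =
    {realization_point X k x t | k x t. x \<in> cells X k \<and> t \<in> standard_simplex k}"
proof -
  have "topspace (realization X) =
      (\<lambda>((k, x), t). realization_point X k x t) ` {((k, x), t) | k x t. x \<in> cells X k \<and> t \<in> standard_simplex k}"
    using quotient_imp_surjective_map[OF quotient_map_realization[of X]]
    by (simp only: topspace_simplex_coproduct)
  also have "\<dots> = {realization_point X k x t | k x t. x \<in> cells X k \<and> t \<in> standard_simplex k}"
    by force
  finally show ?thesis .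
qed

lemma realization_point_in:
  "x \<in> cells X k \<Longrightarrow> t \<in> standard_simplex k \<Longrightarrow> realization_point X k x t \<in> topspace (realization X)"
  by (auto simp: topspace_realization)

text \<open>The topology is the weak one with respect to the characteristic maps of all cells,
  degenerate ones included.\<close>

lemma closedin_realization:
  "closedin (realization X) C \<longleftrightarrow> C \<subseteq> topspace (realization X) \<and>
    (\<forall>k. \<forall>x\<in>cells X k. closedin (simplex_space k) {t \<in> standard_simplex k. realization_point X k x t \<in> C})"
proof (cases "C \<subseteq> topspace (realization X)")
  case True
  let ?D = "{p \<in> topspace (simplex_coproduct X). (\<lambda>((k, x), t). realization_point X k x t) p \<in> C}"
  have "closedin (realization X) C \<longleftrightarrow> closedin (simplex_coproduct X) ?D"
    using quotient_map_realization[of X, unfolded quotient_map_closedin] True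
    by (elim conjE allE[of _ C] impE) (assumption, rule sym)
  also have "\<dots> \<longleftrightarrow> (\<forall>k. \<forall>x\<in>cells X k.
      closedin (simplex_space k) {t \<in> standard_simplex k. realization_point X k x t \<in> C})"
    unfolding simplex_coproduct_def closedin_sum_topology
    by (auto simp: o_def cong: conj_cong)
  finally show ?thesis using True by simp
qed (auto dest: closedin_subset)

lemma continuous_map_from_prod_sum_topology:
  assumes "\<And>i. i \<in> I \<Longrightarrow> continuous_map (prod_topology (X i) Q) Z (\<lambda>(t, s). F ((i, t), s))"
  shows "continuous_map (prod_topology (sum_topology X I) Q) Z F"
  unfolding continuous_map_def
proof (intro conjI allI impI)
  show "F \<in> topspace (prod_topology (sum_topology X I) Q) \<rightarrow> topspace Z"
  proof
    fix p assume "p \<in> topspace (prod_topology (sum_topology X I) Q)"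
    then obtain i t s where "p = ((i, t), s)" "i \<in> I" "t \<in> topspace (X i)" "s \<in> topspace Q" by auto
    then show "F p \<in> topspace Z"
      using continuous_map_funspace[OF assms[of i]] by (auto dest!: funcset_mem[of _ _ _ "(t, s)"])
  qed
next
  fix U assume U: "openin Z U"
  show "openin (prod_topology (sum_topology X I) Q)
      {p \<in> topspace (prod_topology (sum_topology X I) Q). F p \<in> U}"
    unfolding openin_prod_topology_alt
  proof (intro allI impI)
    fix p s assume p: "(p, s) \<in> {p \<in> topspace (prod_topology (sum_topology X I) Q). F p \<in> U}"
    then obtain i t where i: "p = (i, t)" "i \<in> I" "t \<in> topspace (X i)" "s \<in> topspace Q" by auto
    have "openin (prod_topology (X i) Q)
        {q \<in> topspace (prod_topology (X i) Q). (\<lambda>(t, s). F ((i, t), s)) q \<in> U}" (is "openin _ ?P")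
      using assms[OF i(2)] U unfolding continuous_map_def by blast
    moreover have "(t, s) \<in> ?P" using p i by simp
    ultimately have "\<exists>V W. openin (X i) V \<and> openin Q W \<and> t \<in> V \<and> s \<in> W \<and> V \<times> W \<subseteq> ?P"
      unfolding openin_prod_topology_alt by (elim allE[of _ t] allE[of _ s] impE)
    then obtain V W where VW: "openin (X i) V" "openin Q W" "t \<in> V" "s \<in> W" "V \<times> W \<subseteq> ?P"
      by (elim exE conjE)
    have "openin (sum_topology X I) ({i} \<times> V)"
      unfolding openin_sum_topology
    proof (intro conjI ballI)
      show "{i} \<times> V \<subseteq> Sigma I (topspace \<circ> X)" using openin_subset[OF VW(1)] i by auto
      fix j assume "j \<in> I"
      have "{x. (j, x) \<in> {i} \<times> V} = (if j = i then V else {})" by auto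
      then show "openin (X j) {x. (j, x) \<in> {i} \<times> V}" using VW(1) by simp
    qed
    moreover have "({i} \<times> V) \<times> W \<subseteq> {p \<in> topspace (prod_topology (sum_topology X I) Q). F p \<in> U}"
      using VW(5) i(2) by fastforce
    ultimately show "\<exists>V' W'. openin (sum_topology X I) V' \<and> openin Q W' \<and> p \<in> V' \<and> s \<in> W' \<and>
        V' \<times> W' \<subseteq> {p \<in> topspace (prod_topology (sum_topology X I) Q). F p \<in> U}"
      using VW i by blast
  qed
qed

text \<open>A product of a quotient map with \<open>Q\<close> is again a quotient map because
  \<open>Q\<close> is locally compact Hausdorff; so a homotopy may be checked on closed
  cells.\<close>

lemma continuous_map_from_realization_prod:
  assumes Q: "locally_compact_space Q" "Hausdorff_space Q"
    and F: "\<And>k x. x \<in> cells X k \<Longrightarrow>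
      continuous_map (prod_topology (simplex_space k) Q) Z (\<lambda>(t, s). F (realization_point X k x t, s))"
  shows "continuous_map (prod_topology (realization X) Q) Z F"
proof (rule continuous_compose_quotient_map)
  show "quotient_map (prod_topology (simplex_coproduct X) Q) (prod_topology (realization X) Q)
      (\<lambda>(p, s). ((\<lambda>((k, x), t). realization_point X k x t) p, s))"
    using Q by (intro quotient_map_prod_left quotient_map_realization) auto
  show "continuous_map (prod_topology (simplex_coproduct X) Q) Z
      (F \<circ> (\<lambda>(p, s). ((\<lambda>((k, x), t). realization_point X k x t) p, s)))"
    unfolding simplex_coproduct_def
    by (rule continuous_map_from_prod_sum_topology) (use F in \<open>auto simp: case_prod_unfold\<close>)
qed

lemma continuous_map_from_realization:
  assumes F: "\<And>k x. x \<in> cells X k \<Longrightarrow> continuous_map (simplex_space k) Z (\<lambda>t. F (realization_point X k x t))"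
  shows "continuous_map (realization X) Z F"
  unfolding continuous_map_closedin
proof (intro conjI allI impI ballI)
  show "F \<in> topspace (realization X) \<rightarrow> topspace Z"
    using F by (fastforce simp: topspace_realization continuous_map_def)
  fix C assume C: "closedin Z C"
  have "{t \<in> standard_simplex k. realization_point X k x t \<in> {p \<in> topspace (realization X). F p \<in> C}}
      = {t \<in> topspace (simplex_space k). F (realization_point X k x t) \<in> C}" if "x \<in> cells X k" for k x
    using that by (auto intro: realization_point_in)
  then show "closedin (realization X) {p \<in> topspace (realization X). F p \<in> C}"
    unfolding closedin_realization using closedin_continuous_map_preimage[OF F C] by auto
qed

lemma continuous_map_realization_point:
  assumes "x \<in> cells X k"
  shows "continuous_map (simplex_space k) (realization X) (realization_point X k x)"
  unfolding continuous_map_closedin using assms realization_point_in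
  by (auto simp: closedin_realization)

section \<open>Equality of points of a realization\<close>

context simplicial_set
begin

text \<open>The action of a section of \<open>\<gamma>\<close> is a left inverse.\<close>

lemma act_surj_inj:
  assumes "\<gamma> \<in> simplex_maps m k" "\<gamma> ` {..m} = {..k}" "x \<in> cells X k" "y \<in> cells X k"
    "act X m k \<gamma> x = act X m k \<gamma> y"
  shows "x = y"
proof -
  obtain d where d: "d \<in> simplex_maps k m" "compose {..k} \<gamma> d = restrict id {..k}"
    using simplex_maps_section[OF assms(1,2), of 0] by auto
  have "act X k k (compose {..k} \<gamma> d) x = act X k k (compose {..k} \<gamma> d) y"
    using act_compose[OF d(1) assms(1)] assms(3-5) by simp
  then show ?thesis using d(2) assms(3,4) act_id by simp
qed

text \<open>A generated equivalence only provides zigzags of gluings. This is its one-step form: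
  after pulling back to a common refinement the two cells coincide.\<close>

definition same_point :: "(nat \<times> 'a) \<times> (nat \<Rightarrow> real) \<Rightarrow> (nat \<times> 'a) \<times> (nat \<Rightarrow> real) \<Rightarrow> bool" where
  "same_point p q \<longleftrightarrow> p \<in> topspace (simplex_coproduct X) \<and> q \<in> topspace (simplex_coproduct X) \<and>
    (\<exists>m w \<alpha> \<beta>. w \<in> open_simplex m \<and> \<alpha> \<in> simplex_maps m (fst (fst p)) \<and>
       \<beta> \<in> simplex_maps m (fst (fst q)) \<and> simplex_push m \<alpha> w = snd p \<and> simplex_push m \<beta> w = snd q \<and>
       act X m (fst (fst p)) \<alpha> (snd (fst p)) = act X m (fst (fst q)) \<beta> (snd (fst q)))"

lemma same_point_sym: "same_point p q \<Longrightarrow> same_point q p"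
  unfolding same_point_def by metis

text \<open>The two refinements are refined once more. Since \<open>v\<close> is interior, the
  composite operators agree, which gives the equation after applying \<open>\<gamma>'\<close>; as
  \<open>w'\<close> is interior too, \<open>\<gamma>'\<close> is surjective and its action can be
  cancelled.\<close>

lemma refinement_independent:
  assumes x: "x \<in> cells X k" and y: "y \<in> cells X l"
    and w: "w \<in> open_simplex m" "\<alpha> \<in> simplex_maps m k" "\<beta> \<in> simplex_maps m l"
    and e: "act X m k \<alpha> x = act X m l \<beta> y"
    and w': "w' \<in> open_simplex m'" "\<alpha>' \<in> simplex_maps m' k" "\<beta>' \<in> simplex_maps m' l"
    and p: "simplex_push m' \<alpha>' w' = simplex_push m \<alpha> w" "simplex_push m' \<beta>' w' = simplex_push m \<beta> w"
  shows "act X m' k \<alpha>' x = act X m' l \<beta>' y"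
proof -
  obtain r v \<gamma> \<gamma>' where v: "v \<in> open_simplex r" "\<gamma> \<in> simplex_maps r m" "\<gamma>' \<in> simplex_maps r m'"
    "simplex_push r \<gamma> v = w" "simplex_push r \<gamma>' v = w'"
    using simplex_refinement[OF open_simplex_standard[OF w(1)] open_simplex_standard[OF w'(1)]] by metis
  have 1: "compose {..r} \<alpha> \<gamma> = compose {..r} \<alpha>' \<gamma>'"
    by (rule simplex_push_inj[OF v(1) compose_simplex_maps compose_simplex_maps])
      (use v w w' p in \<open>auto simp: simplex_push_compose\<close>)
  have 2: "compose {..r} \<beta> \<gamma> = compose {..r} \<beta>' \<gamma>'"
    by (rule simplex_push_inj[OF v(1) compose_simplex_maps compose_simplex_maps])
      (use v w w' p in \<open>auto simp: simplex_push_compose\<close>)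
  have "act X r m' \<gamma>' (act X m' k \<alpha>' x) = act X r m' \<gamma>' (act X m' l \<beta>' y)"
    using act_compose[OF v(2) w(2) x] act_compose[OF v(2) w(3) y]
      act_compose[OF v(3) w'(2) x] act_compose[OF v(3) w'(3) y] e 1 2 by simp
  then show ?thesis
    using act_surj_inj[OF v(3) simplex_push_open_surj[OF w'(1) v(3,5)]]
      act_closed w'(2,3) x y by blast
qed

text \<open>The two given refinements both subdivide the middle point \<open>s\<close>. A common
  refinement of them reaches \<open>s\<close> by two operators, which are equal because
  \<open>v\<close> is interior.\<close>

lemma same_point_trans:
  assumes "same_point p q" "same_point q z"
  shows "same_point p z"
proof -
  obtain k x t where p: "p = ((k, x), t)" by (metis surj_pair)
  obtain l y s where q: "q = ((l, y), s)" by (metis surj_pair)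
  obtain n c u where z: "z = ((n, c), u)" by (metis surj_pair)
  have top: "p \<in> topspace (simplex_coproduct X)" "z \<in> topspace (simplex_coproduct X)"
    and x: "x \<in> cells X k" and y: "y \<in> cells X l" and c: "c \<in> cells X n"
    using assms p q z unfolding same_point_def by (auto simp: topspace_simplex_coproduct)
  obtain m w \<alpha> \<beta> where w: "w \<in> open_simplex m" "\<alpha> \<in> simplex_maps m k"
    "\<beta> \<in> simplex_maps m l" "simplex_push m \<alpha> w = t" "simplex_push m \<beta> w = s"
    "act X m k \<alpha> x = act X m l \<beta> y"
    using assms(1) p q unfolding same_point_def by auto
  obtain m' w' \<alpha>' \<beta>' where w': "w' \<in> open_simplex m'" "\<alpha>' \<in> simplex_maps m' l"
    "\<beta>' \<in> simplex_maps m' n" "simplex_push m' \<alpha>' w' = s" "simplex_push m' \<beta>' w' = u"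
    "act X m' l \<alpha>' y = act X m' n \<beta>' c"
    using assms(2) z q unfolding same_point_def by auto
  obtain r v \<gamma> \<gamma>' where v: "v \<in> open_simplex r" "\<gamma> \<in> simplex_maps r m" "\<gamma>' \<in> simplex_maps r m'"
    "simplex_push r \<gamma> v = w" "simplex_push r \<gamma>' v = w'"
    using simplex_refinement[OF open_simplex_standard[OF w(1)] open_simplex_standard[OF w'(1)]] by metis
  have "compose {..r} \<beta> \<gamma> = compose {..r} \<alpha>' \<gamma>'"
    by (rule simplex_push_inj[OF v(1) compose_simplex_maps compose_simplex_maps])
      (use v w w' in \<open>auto simp: simplex_push_compose\<close>)
  then have "act X r k (compose {..r} \<alpha> \<gamma>) x = act X r n (compose {..r} \<beta>' \<gamma>') c"
    using act_compose[OF v(2) w(2) x] act_compose[OF v(2) w(3) y]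
      act_compose[OF v(3) w'(2) y] act_compose[OF v(3) w'(3) c] w w' by simp
  moreover have "simplex_push r (compose {..r} \<alpha> \<gamma>) v = t" "simplex_push r (compose {..r} \<beta>' \<gamma>') v = u"
    using v w w' by (auto simp: simplex_push_compose)
  ultimately show ?thesis
    unfolding same_point_def p z fst_conv snd_conv
    using top compose_simplex_maps[OF v(2) w(2)] compose_simplex_maps[OF v(3) w'(3)] v(1) p z by blast
qed

text \<open>In one direction \<open>same_point\<close> is an equivalence relation containing the
  gluing; in the other the common pulled-back cell is glued to both sides.\<close>

lemma same_point_generated:
  assumes "p \<in> topspace (simplex_coproduct X)" "q \<in> topspace (simplex_coproduct X)"
  shows "(p, q) \<in> generated_equiv (topspace (simplex_coproduct X)) (simplex_gluing X) \<longleftrightarrow> same_point p q"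
proof
  assume "(p, q) \<in> generated_equiv (topspace (simplex_coproduct X)) (simplex_gluing X)"
  then show "same_point p q"
  proof (induction rule: generated_equiv_induct)
    case (refl u)
    then obtain k x t where u: "u = ((k, x), t)" "x \<in> cells X k" "t \<in> standard_simplex k"
      by (auto simp: topspace_simplex_coproduct)
    obtain m w \<iota> where "w \<in> open_simplex m" "\<iota> \<in> simplex_maps m k" "simplex_push m \<iota> w = t"
      using open_simplex_support[OF u(3)] by metis
    then show ?case using u refl unfolding same_point_def by auto
  next
    case (base u v)
    then obtain m n \<theta> x t where *: "\<theta> \<in> simplex_maps m n" "x \<in> cells X n" "t \<in> standard_simplex m"
        "u = ((m, act X m n \<theta> x), t)" "v = ((n, x), simplex_push m \<theta> t)"
      unfolding simplex_gluing_def by blast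
    obtain r w \<iota> where w: "w \<in> open_simplex r" "\<iota> \<in> simplex_maps r m" "simplex_push r \<iota> w = t"
      using open_simplex_support[OF *(3)] by metis
    show ?case
      unfolding same_point_def *(4,5) fst_conv snd_conv
      using base(1,2) * w compose_simplex_maps[OF w(2) *(1)] act_compose[OF w(2) *(1,2)]
        simplex_push_compose[OF w(2), of \<theta> w]
      by (intro conjI exI[of _ r] exI[of _ w] exI[of _ \<iota>] exI[of _ "compose {..r} \<theta> \<iota>"]) auto
  next
    case (sym u v)
    then show ?case by (rule same_point_sym)
  next
    case (trans u v w)
    then show ?case by (rule same_point_trans)
  qed
next
  assume s: "same_point p q"
  obtain k x t where p: "p = ((k, x), t)" by (metis surj_pair)
  obtain l y u where q: "q = ((l, y), u)" by (metis surj_pair)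
  have x: "x \<in> cells X k" and y: "y \<in> cells X l"
    using assms p q by (auto simp: topspace_simplex_coproduct)
  obtain m w \<alpha> \<beta> where w: "w \<in> open_simplex m" "\<alpha> \<in> simplex_maps m k"
    "\<beta> \<in> simplex_maps m l" "simplex_push m \<alpha> w = t" "simplex_push m \<beta> w = u"
    "act X m k \<alpha> x = act X m l \<beta> y"
    using s p q unfolding same_point_def by auto
  note w0 = open_simplex_standard[OF w(1)]
  let ?E = "generated_equiv (topspace (simplex_coproduct X)) (simplex_gluing X)"
  have c: "((m, act X m k \<alpha> x), w) \<in> topspace (simplex_coproduct X)"
    using w0 act_closed[OF w(2) x] by (simp add: topspace_simplex_coproduct)
  have "simplex_gluing X ((m, act X m k \<alpha> x), w) p"
    unfolding simplex_gluing_def p using w(2,4) x w0 by blast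
  moreover have "simplex_gluing X ((m, act X m k \<alpha> x), w) q"
    unfolding simplex_gluing_def q w(6) using w(3,5) y w0 by blast
  ultimately have "(((m, act X m k \<alpha> x), w), p) \<in> ?E" "(((m, act X m k \<alpha> x), w), q) \<in> ?E"
    using c assms by (auto intro: generated_equivI)
  then show "(p, q) \<in> ?E"
    by (meson equiv_def equiv_generated_equiv symD transD)
qed

lemma realization_point_eq_iff:
  assumes "x \<in> cells X k" "t \<in> standard_simplex k" "y \<in> cells X l" "s \<in> standard_simplex l"
  shows "realization_point X k x t = realization_point X l y s \<longleftrightarrow> same_point ((k, x), t) ((l, y), s)"
proof -
  have "((k, x), t) \<in> topspace (simplex_coproduct X)" "((l, y), s) \<in> topspace (simplex_coproduct X)"
    using assms by (auto simp: topspace_simplex_coproduct)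
  then show ?thesis
    unfolding realization_point_def
    by (simp add: generated_equiv_class_eq_iff same_point_generated)
qed

text \<open>By \<open>refinement_independent\<close> the refinement is free to choose. This is the
  usual way below to turn an equation of points into one of cells.\<close>

lemma realization_point_eqD:
  assumes "realization_point X k x t = realization_point X l y s"
    and "x \<in> cells X k" "t \<in> standard_simplex k" "y \<in> cells X l" "s \<in> standard_simplex l"
    and "w \<in> open_simplex m" "\<alpha> \<in> simplex_maps m k" "\<beta> \<in> simplex_maps m l"
      "simplex_push m \<alpha> w = t" "simplex_push m \<beta> w = s"
  shows "act X m k \<alpha> x = act X m l \<beta> y"
proof -
  have "same_point ((k, x), t) ((l, y), s)"
    using assms realization_point_eq_iff by blast
  then obtain m' w' \<alpha>' \<beta>' where w: "w' \<in> open_simplex m'" "\<alpha>' \<in> simplex_maps m' k"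
    "\<beta>' \<in> simplex_maps m' l" "simplex_push m' \<alpha>' w' = t" "simplex_push m' \<beta>' w' = s"
    "act X m' k \<alpha>' x = act X m' l \<beta>' y"
    unfolding same_point_def by auto
  show ?thesis
    by (rule refinement_independent[OF assms(2,4) w(1-3,6) assms(6-8)]) (use w assms in auto)
qed

lemma realization_point_act:
  assumes "\<theta> \<in> simplex_maps m n" "x \<in> cells X n" "t \<in> standard_simplex m"
  shows "realization_point X m (act X m n \<theta> x) t = realization_point X n x (simplex_push m \<theta> t)"
proof -
  have "simplex_gluing X ((m, act X m n \<theta> x), t) ((n, x), simplex_push m \<theta> t)"
    unfolding simplex_gluing_def using assms by blast
  moreover have "((m, act X m n \<theta> x), t) \<in> topspace (simplex_coproduct X)"
      "((n, x), simplex_push m \<theta> t) \<in> topspace (simplex_coproduct X)"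
    using assms act_closed simplex_push_in by (auto simp: topspace_simplex_coproduct)
  ultimately show ?thesis
    unfolding realization_point_def by (simp add: generated_equiv_class_eq_iff generated_equivI)
qed

lemma realization_point_open_inj:
  assumes "u \<in> open_simplex m" "x \<in> cells X m" "y \<in> cells X m"
    "realization_point X m x u = realization_point X m y u"
  shows "x = y"
  using realization_point_eqD[OF assms(4,2) _ assms(3) _ assms(1) id_simplex_maps id_simplex_maps]
    open_simplex_standard[OF assms(1)] assms by (simp add: simplex_push_id act_id)

end

section \<open>Subcomplexes and realizations of injective maps\<close>

definition subcomplex :: "'a sset \<Rightarrow> (nat \<Rightarrow> 'a set) \<Rightarrow> bool" where
  "subcomplex X S \<longleftrightarrow> (\<forall>k. S k \<subseteq> cells X k) \<and>
    (\<forall>m n. \<forall>\<theta>\<in>simplex_maps m n. \<forall>x\<in>S n. act X m n \<theta> x \<in> S m)"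

lemma subcomplex_cells: "subcomplex X S \<Longrightarrow> x \<in> S k \<Longrightarrow> x \<in> cells X k"
  unfolding subcomplex_def by blast

lemma subcomplex_act: "subcomplex X S \<Longrightarrow> \<theta> \<in> simplex_maps m n \<Longrightarrow> x \<in> S n \<Longrightarrow> act X m n \<theta> x \<in> S m"
  unfolding subcomplex_def by blast

definition realization_of :: "'a sset \<Rightarrow> (nat \<Rightarrow> 'a set) \<Rightarrow> ((nat \<times> 'a) \<times> (nat \<Rightarrow> real)) set set" where
  "realization_of X S = {realization_point X k x t | k x t. x \<in> S k \<and> t \<in> standard_simplex k}"

context simplicial_set
begin

text \<open>A section of \<open>\<gamma>\<close> recovers \<open>x\<close> from
  \<open>act X m k \<gamma> x\<close>.\<close>

lemma subcomplex_act_surj: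
  assumes "subcomplex X S" "\<gamma> \<in> simplex_maps m k" "\<gamma> ` {..m} = {..k}" "x \<in> cells X k"
    "act X m k \<gamma> x \<in> S m"
  shows "x \<in> S k"
proof -
  obtain d where d: "d \<in> simplex_maps k m" "compose {..k} \<gamma> d = restrict id {..k}"
    using simplex_maps_section[OF assms(2,3), of 0] by auto
  have "act X k m d (act X m k \<gamma> x) = x"
    using act_compose[OF d(1) assms(2,4)] d(2) assms(4) act_id by simp
  then show ?thesis using subcomplex_act[OF assms(1) d(1) assms(5)] by simp
qed

text \<open>On a common refinement the pulled-back cell of \<open>x\<close> is one of a cell of
  \<open>S\<close>. The operator on the side of \<open>x\<close> is surjective since
  \<open>u\<close> is interior, so \<open>x\<close> can be recovered within
  \<open>S\<close>.\<close>

lemma realization_of_open: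
  assumes S: "subcomplex X S" and u: "u \<in> open_simplex m" and x: "x \<in> cells X m"
    and p: "realization_point X m x u \<in> realization_of X S"
  shows "x \<in> S m"
proof -
  obtain k y t where y: "y \<in> S k" "t \<in> standard_simplex k"
    "realization_point X m x u = realization_point X k y t"
    using p unfolding realization_of_def by blast
  note yc = subcomplex_cells[OF S y(1)]
  obtain r w \<alpha> \<beta> where w: "w \<in> open_simplex r" "\<alpha> \<in> simplex_maps r m" "\<beta> \<in> simplex_maps r k"
    "simplex_push r \<alpha> w = u" "simplex_push r \<beta> w = t"
    using simplex_refinement[OF open_simplex_standard[OF u] y(2)] by metis
  have "act X r m \<alpha> x = act X r k \<beta> y"
    by (rule realization_point_eqD[OF y(3) x open_simplex_standard[OF u] yc y(2) w])
  then show ?thesis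
    using subcomplex_act_surj[OF S w(2) simplex_push_open_surj[OF u w(2,4)] x]
      subcomplex_act[OF S w(3) y(1)] by simp
qed

end

context simplicial_map
begin

text \<open>Naturality carries gluings to gluings, so the image of a class lies in a single
  class.\<close>

lemma realization_map_point:
  assumes "x \<in> cells X k" "t \<in> standard_simplex k"
  shows "realization_map Y f (realization_point X k x t) = realization_point Y k (f k x) t"
proof -
  let ?EX = "generated_equiv (topspace (simplex_coproduct X)) (simplex_gluing X)"
  let ?EY = "generated_equiv (topspace (simplex_coproduct Y)) (simplex_gluing Y)"
  let ?g = "\<lambda>((k, x), t). ((k, f k x), t)"
  have rel: "(?g p, ?g q) \<in> ?EY" if "(p, q) \<in> ?EX" for p q
    using that
  proof (induction rule: generated_equiv_induct)
    case (refl u)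
    then have "?g u \<in> topspace (simplex_coproduct Y)"
      by (auto simp: topspace_simplex_coproduct map_closed)
    then show ?case by (meson equiv_def equiv_generated_equiv refl_onD)
  next
    case (base u v)
    then have g: "?g u \<in> topspace (simplex_coproduct Y)" "?g v \<in> topspace (simplex_coproduct Y)"
      by (auto simp: topspace_simplex_coproduct map_closed)
    have "simplex_gluing Y (?g u) (?g v)"
      using base(3) map_natural map_closed unfolding simplex_gluing_def by fastforce
    with g show ?case by (rule generated_equivI)
  next
    case (sym u v)
    then show ?case using equiv_generated_equiv by (meson equiv_def symD)
  next
    case (trans u v w)
    then show ?case using equiv_generated_equiv by (meson equiv_def transD)
  qed
  have "((k, x), t) \<in> topspace (simplex_coproduct X)"
    using assms by (simp add: topspace_simplex_coproduct)
  then have "((k, x), t) \<in> realization_point X k x t"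
    unfolding realization_point_def using equiv_class_self[OF equiv_generated_equiv] by fastforce
  moreover have "(((k, f k x), t), ?g q) \<in> ?EY" if "q \<in> realization_point X k x t" for q
    using rel[of "((k, x), t)" q] that unfolding realization_point_def by simp
  ultimately have "?EY `` (?g ` realization_point X k x t) = ?EY `` {((k, f k x), t)}"
    by (intro equiv_Image_eq[OF equiv_generated_equiv]) force+
  then show ?thesis
    unfolding realization_map_def realization_point_def[of Y] .
qed

lemma continuous_map_realization_map:
  "continuous_map (realization X) (realization Y) (realization_map Y f)"
proof (rule continuous_map_from_realization)
  fix k x assume x: "x \<in> cells X k"
  show "continuous_map (simplex_space k) (realization Y) (\<lambda>t. realization_map Y f (realization_point X k x t))"
    by (rule continuous_map_eq[OF continuous_map_realization_point[OF map_closed[OF x]]])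
      (simp add: realization_map_point x)
qed

lemma subcomplex_image: "subcomplex Y (\<lambda>k. f k ` cells X k)"
  unfolding subcomplex_def
proof (intro conjI allI ballI)
  fix m n \<theta> y assume \<theta>: "\<theta> \<in> simplex_maps m n" and "y \<in> f n ` cells X n"
  then obtain x where x: "x \<in> cells X n" "y = f n x" by blast
  then have "act Y m n \<theta> y = f m (act X m n \<theta> x)" using map_natural[OF \<theta>] by simp
  then show "act Y m n \<theta> y \<in> f m ` cells X m" using source.act_closed[OF \<theta> x(1)] by blast
qed (use map_closed in auto)

lemma realization_map_image:
  "realization_map Y f ` topspace (realization X) = realization_of Y (\<lambda>k. f k ` cells X k)"
proof -
  have "realization_map Y f ` topspace (realization X)
      = {realization_map Y f (realization_point X k x t) | k x t. x \<in> cells X k \<and> t \<in> standard_simplex k}"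
    unfolding topspace_realization by blast
  also have "\<dots> = {realization_point Y k (f k x) t | k x t. x \<in> cells X k \<and> t \<in> standard_simplex k}"
    by (intro Collect_cong ex_cong1) (auto simp: realization_map_point)
  also have "\<dots> = realization_of Y (\<lambda>k. f k ` cells X k)"
    unfolding realization_of_def by blast
  finally show ?thesis .
qed

text \<open>After a common refinement, equality of the images is equality of two cells of
  \<open>Y\<close> of one dimension \<open>r\<close>, where \<open>f r\<close> can be
  cancelled.\<close>

lemma inj_on_realization_map:
  assumes inj: "\<And>k. inj_on (f k) (cells X k)"
  shows "inj_on (realization_map Y f) (topspace (realization X))"
proof (rule inj_onI)
  fix p q assume "p \<in> topspace (realization X)" "q \<in> topspace (realization X)"
    and e: "realization_map Y f p = realization_map Y f q"
  then obtain k x t l y s where p: "p = realization_point X k x t" "x \<in> cells X k" "t \<in> standard_simplex k"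
    and q: "q = realization_point X l y s" "y \<in> cells X l" "s \<in> standard_simplex l"
    unfolding topspace_realization by blast
  obtain r w \<alpha> \<beta> where w: "w \<in> open_simplex r" "\<alpha> \<in> simplex_maps r k" "\<beta> \<in> simplex_maps r l"
    "simplex_push r \<alpha> w = t" "simplex_push r \<beta> w = s"
    using simplex_refinement[OF p(3) q(3)] by metis
  have "realization_point Y k (f k x) t = realization_point Y l (f l y) s"
    using e p q by (simp add: realization_map_point)
  then have "act Y r k \<alpha> (f k x) = act Y r l \<beta> (f l y)"
    by (rule target.realization_point_eqD[OF _ _ p(3) _ q(3) w]) (use p q map_closed in auto)
  then have "f r (act X r k \<alpha> x) = f r (act X r l \<beta> y)"
    using map_natural w p q by simp
  then have "act X r k \<alpha> x = act X r l \<beta> y"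
    using inj_onD[OF inj] source.act_closed w p q by metis
  then show "p = q"
    using source.realization_point_act[OF w(2) p(2)] source.realization_point_act[OF w(3) q(2)]
      open_simplex_standard[OF w(1)] p q w by metis
qed

text \<open>
  A point of a closed cell \<open>y\<close> lies in the image iff it lies on a face of \<open>y\<close> which comes from \<open>X\<close>,
  so that the trace of a closed set on the cell is a finite union of compact sets.
\<close>

lemma closed_map_realization_map:
  assumes inj: "\<And>k. inj_on (f k) (cells X k)"
  shows "closed_map (realization X) (realization Y) (realization_map Y f)"
  unfolding closed_map_def
proof (intro allI impI)
  fix C assume C: "closedin (realization X) C"
  note Csub = closedin_subset[OF C]
  let ?i = "realization_map Y f"
  show "closedin (realization Y) (?i ` C)"
    unfolding closedin_realization
  proof (intro conjI allI ballI)
    show "?i ` C \<subseteq> topspace (realization Y)"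
      using Csub continuous_map_image_subset_topspace[OF continuous_map_realization_map] by blast
    fix k y assume y: "y \<in> cells Y k"
    define P where "P = (SIGMA m:{..k}. {\<theta> \<in> simplex_maps m k. act Y m k \<theta> y \<in> f m ` cells X m})"
    define D where "D = (\<lambda>(m, \<theta>). simplex_push m \<theta> `
      {u \<in> standard_simplex m. realization_point X m (inv_into (cells X m) (f m) (act Y m k \<theta> y)) u \<in> C})"
    have "finite P"
      unfolding P_def by (intro finite_SigmaI) (auto intro: finite_subset[OF _ finite_simplex_maps])
    moreover have "closedin (simplex_space k) (D p)" if pP: "p \<in> P" for p
    proof -
      obtain m \<theta> where p: "p = (m, \<theta>)" "\<theta> \<in> simplex_maps m k" "act Y m k \<theta> y \<in> f m ` cells X m"
        using pP unfolding P_def by auto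
      let ?x = "inv_into (cells X m) (f m) (act Y m k \<theta> y)"
      have "?x \<in> cells X m" using p(3) by (rule inv_into_into)
      then have "closedin (simplex_space m) {u \<in> standard_simplex m. realization_point X m ?x u \<in> C}"
        using C unfolding closedin_realization by blast
      then have "compactin (simplex_space m) {u \<in> standard_simplex m. realization_point X m ?x u \<in> C}"
        by (rule closedin_compact_space[OF compact_simplex_space])
      then have "compactin (simplex_space k) (D p)"
        unfolding D_def p by (auto intro: image_compactin continuous_map_simplex_push[OF p(2)])
      then show ?thesis by (rule compactin_imp_closedin[OF Hausdorff_simplex_space])
    qed
    moreover have "{t \<in> standard_simplex k. realization_point Y k y t \<in> ?i ` C} = (\<Union>p\<in>P. D p)"
    proof (intro equalityI subsetI)
      fix t assume t: "t \<in> {t \<in> standard_simplex k. realization_point Y k y t \<in> ?i ` C}"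
      then have t1: "t \<in> standard_simplex k" by simp
      obtain q where q: "q \<in> C" "realization_point Y k y t = ?i q" using t by blast
      obtain m u \<iota> where m: "m \<le> k" "u \<in> open_simplex m" "\<iota> \<in> simplex_maps m k" "simplex_push m \<iota> u = t"
        using open_simplex_support[OF t1] .
      note u1 = open_simplex_standard[OF m(2)]
      have pt: "realization_point Y m (act Y m k \<iota> y) u = ?i q"
        using target.realization_point_act[OF m(3) y u1] m(4) q(2) by simp
      have "?i q \<in> realization_of Y (\<lambda>k. f k ` cells X k)"
        using q(1) Csub realization_map_image by blast
      then have in_im: "act Y m k \<iota> y \<in> f m ` cells X m"
        using target.realization_of_open[OF subcomplex_image m(2) target.act_closed[OF m(3) y]] pt by simp
      let ?x = "inv_into (cells X m) (f m) (act Y m k \<iota> y)"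
      have x: "?x \<in> cells X m" "f m ?x = act Y m k \<iota> y"
        using in_im by (auto intro: inv_into_into f_inv_into_f)
      have "?i (realization_point X m ?x u) = ?i q"
        using pt x u1 by (simp add: realization_map_point)
      then have "realization_point X m ?x u = q"
        using inj_onD[OF inj_on_realization_map[OF inj]] realization_point_in[OF x(1) u1] q(1) Csub by blast
      then have "t \<in> D (m, \<iota>)" unfolding D_def using m(4) u1 q(1) by auto
      moreover have "(m, \<iota>) \<in> P" unfolding P_def using m in_im by auto
      ultimately show "t \<in> (\<Union>p\<in>P. D p)" by blast
    next
      fix t assume "t \<in> (\<Union>p\<in>P. D p)"
      then obtain m \<theta> u where *: "\<theta> \<in> simplex_maps m k" "act Y m k \<theta> y \<in> f m ` cells X m"
        "u \<in> standard_simplex m" "realization_point X m (inv_into (cells X m) (f m) (act Y m k \<theta> y)) u \<in> C"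
        "t = simplex_push m \<theta> u"
        unfolding P_def D_def by auto
      let ?x = "inv_into (cells X m) (f m) (act Y m k \<theta> y)"
      have x: "?x \<in> cells X m" "f m ?x = act Y m k \<theta> y"
        using *(2) by (auto intro: inv_into_into f_inv_into_f)
      have "?i (realization_point X m ?x u) = realization_point Y k y t"
        using x * y by (simp add: realization_map_point target.realization_point_act)
      then have "realization_point Y k y t \<in> ?i ` C" using *(4) by (metis imageI)
      then show "t \<in> {t \<in> standard_simplex k. realization_point Y k y t \<in> ?i ` C}"
        using * simplex_push_in by auto
    qed
    ultimately show "closedin (simplex_space k) {t \<in> standard_simplex k. realization_point Y k y t \<in> ?i ` C}"
      by (auto intro!: closedin_Union)
  qed
qed

end

section \<open>Extension of maps cell by cell\<close>

text \<open>All operators to a smaller dimension are excluded, not only surjective ones. This is the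
  usual notion, since every operator factors as a surjection followed by an injection.\<close>

definition nondegenerate :: "'a sset \<Rightarrow> nat \<Rightarrow> 'a \<Rightarrow> bool" where
  "nondegenerate X k x \<longleftrightarrow> x \<in> cells X k \<and>
    \<not> (\<exists>m<k. \<exists>\<theta>\<in>simplex_maps k m. \<exists>z\<in>cells X m. x = act X k m \<theta> z)"

definition simplex_boundary :: "nat \<Rightarrow> (nat \<Rightarrow> real) set" where
  "simplex_boundary k = {t \<in> standard_simplex k. \<exists>i\<le>k. t i = 0}"

lemma simplex_boundary_0: "simplex_boundary 0 = {}"
  by (auto simp: simplex_boundary_def standard_simplex_def)

lemma simplex_boundary_standard: "t \<in> simplex_boundary k \<Longrightarrow> t \<in> standard_simplex k"
  by (simp add: simplex_boundary_def)

lemma simplex_boundary_or_open: "t \<in> standard_simplex k \<Longrightarrow> t \<in> simplex_boundary k \<or> t \<in> open_simplex k"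
  using standard_simplex_nonneg[of t k] by (auto simp: simplex_boundary_def open_simplex_def less_le)

lemma closedin_simplex_face: "closedin (simplex_space k) {t \<in> standard_simplex k. t i = 0}"
  using closedin_continuous_map_preimage[OF continuous_map_simplex_coordinate[of k i], of "{0}"] by simp

lemma closedin_simplex_boundary: "closedin (simplex_space k) (simplex_boundary k)"
proof -
  have "simplex_boundary k = (\<Union>i\<le>k. {t \<in> standard_simplex k. t i = 0})"
    by (auto simp: simplex_boundary_def)
  then show ?thesis using closedin_simplex_face by (auto intro!: closedin_Union)
qed

context simplicial_set
begin

text \<open>Uniqueness in the Eilenberg-Zilber lemma. A section of \<open>\<alpha>\<close> expresses
  \<open>x\<close> through \<open>y\<close> and conversely, so nondegeneracy forces equal
  dimensions; the operator in between is then an endomorphism and must be the identity.\<close>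

lemma nondegenerate_unique:
  assumes \<alpha>: "\<alpha> \<in> simplex_maps m k" "\<alpha> ` {..m} = {..k}" and x: "nondegenerate X k x"
    and \<beta>: "\<beta> \<in> simplex_maps m l" "\<beta> ` {..m} = {..l}" and y: "nondegenerate X l y"
    and e: "act X m k \<alpha> x = act X m l \<beta> y"
  shows "k = l \<and> x = y \<and> \<alpha> = \<beta>"
proof -
  have xc: "x \<in> cells X k" and yc: "y \<in> cells X l" using x y by (auto simp: nondegenerate_def)
  have eq: "u = act X k' l' (compose {..k'} \<beta>' d) v"
    if "d \<in> simplex_maps k' m" "compose {..k'} \<alpha>' d = restrict id {..k'}" "\<alpha>' \<in> simplex_maps m k'"
      "\<beta>' \<in> simplex_maps m l'" "u \<in> cells X k'" "v \<in> cells X l'" "act X m k' \<alpha>' u = act X m l' \<beta>' v"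
    for d k' l' \<alpha>' \<beta>' u v
    using act_compose[OF that(1,3,5)] act_compose[OF that(1,4,6)] that act_id by simp
  obtain d where d: "d \<in> simplex_maps k m" "compose {..k} \<alpha> d = restrict id {..k}"
    using simplex_maps_section[OF \<alpha>, of 0] by auto
  obtain d' where d': "d' \<in> simplex_maps l m" "compose {..l} \<beta> d' = restrict id {..l}"
    using simplex_maps_section[OF \<beta>, of 0] by auto
  have "\<not> l < k"
    using eq[OF d \<alpha>(1) \<beta>(1) xc yc e] compose_simplex_maps[OF d(1) \<beta>(1)] x yc
    unfolding nondegenerate_def by blast
  moreover have "\<not> k < l"
    using eq[OF d' \<beta>(1) \<alpha>(1) yc xc e[symmetric]] compose_simplex_maps[OF d'(1) \<alpha>(1)] y xc
    unfolding nondegenerate_def by blast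
  ultimately have kl: "k = l" by simp
  \<comment> \<open>An endomorphism other than the identity is not surjective and factors through a
    smaller dimension, against nondegeneracy of \<open>x\<close>. This holds for every section
    \<open>c\<close>, which is what gives \<open>\<alpha> = \<beta>\<close>.\<close>
  have id: "compose {..k} \<beta> c = restrict id {..k}"
    if c: "c \<in> simplex_maps k m" "compose {..k} \<alpha> c = restrict id {..k}" for c
  proof (rule ccontr)
    assume ne: "compose {..k} \<beta> c \<noteq> restrict id {..k}"
    have cm: "compose {..k} \<beta> c \<in> simplex_maps k k"
      using compose_simplex_maps[OF c(1) \<beta>(1)] kl by simp
    obtain r \<iota> \<rho> where r: "r < k" "\<iota> \<in> simplex_maps r k" "\<rho> \<in> simplex_maps k r"
      "compose {..k} \<beta> c = compose {..k} \<iota> \<rho>"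
      using simplex_maps_factor[OF cm] simplex_maps_surj_endo[OF cm] ne by metis
    have "x = act X k r \<rho> (act X r k \<iota> y)"
      using eq[OF c \<alpha>(1) \<beta>(1) xc yc e] r(4) act_compose[OF r(3,2)] yc kl by simp
    then show False
      using x r act_closed[OF r(2)] yc kl unfolding nondegenerate_def by blast
  qed
  have "x = y"
    using eq[OF d \<alpha>(1) \<beta>(1) xc yc e] id[OF d] act_id yc kl by simp
  moreover have "\<alpha> = \<beta>"
  proof (rule simplex_maps_eqI[OF \<alpha>(1) \<beta>(1)])
    fix j assume j: "j \<le> m"
    \<comment> \<open>With a section through \<open>j\<close>, the identity
      \<open>compose {..k} \<beta> c\<close> evaluated at \<open>\<alpha> j\<close> reads
      \<open>\<beta> j = \<alpha> j\<close>.\<close>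
    obtain c where c: "c \<in> simplex_maps k m" "compose {..k} \<alpha> c = restrict id {..k}" "c (\<alpha> j) = j"
      using simplex_maps_section[OF \<alpha> j] .
    have "\<alpha> j \<le> k" using simplex_maps_le[OF \<alpha>(1) j] .
    then have "compose {..k} \<beta> c (\<alpha> j) = \<beta> j" using c(3) by (simp add: compose_def)
    then show "\<alpha> j = \<beta> j" using id[OF c(1,2)] \<open>\<alpha> j \<le> k\<close> by simp
  qed
  ultimately show ?thesis using kl by simp
qed

text \<open>Among all representations one of least dimension is taken and passed to the support of
  its point; a cell coming from a lower dimension would give a smaller representation.\<close>

lemma realization_point_nondegenerate:
  assumes "p \<in> topspace (realization X)"
  obtains k x t where "nondegenerate X k x" "t \<in> open_simplex k" "p = realization_point X k x t"
proof -
  define P where "P = (\<lambda>k. \<exists>x t. x \<in> cells X k \<and> t \<in> standard_simplex k \<and> p = realization_point X k x t)"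
  have "\<exists>k. P k" using assms unfolding P_def topspace_realization by blast
  define k where "k = (LEAST k. P k)"
  have "P k" unfolding k_def using \<open>\<exists>k. P k\<close> by (rule LeastI_ex)
  then obtain x t where x: "x \<in> cells X k" "t \<in> standard_simplex k" "p = realization_point X k x t"
    unfolding P_def by blast
  have least: "k \<le> m" if "P m" for m unfolding k_def using that by (rule Least_le)
  obtain m w \<iota> where w: "m \<le> k" "w \<in> open_simplex m" "\<iota> \<in> simplex_maps m k" "simplex_push m \<iota> w = t"
    using open_simplex_support[OF x(2)] .
  have c: "act X m k \<iota> x \<in> cells X m" using act_closed w(3) x(1) .
  have p: "p = realization_point X m (act X m k \<iota> x) w"
    using realization_point_act[OF w(3) x(1) open_simplex_standard[OF w(2)]] w(4) x(3) by simp
  then have "k \<le> m" using c open_simplex_standard[OF w(2)] by (intro least) (auto simp: P_def)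
  have "nondegenerate X m (act X m k \<iota> x)"
    unfolding nondegenerate_def
  proof (intro conjI c notI)
    assume "\<exists>r<m. \<exists>\<theta>\<in>simplex_maps m r. \<exists>z\<in>cells X r. act X m k \<iota> x = act X m r \<theta> z"
    then obtain r \<theta> z where r: "r < m" "\<theta> \<in> simplex_maps m r" "z \<in> cells X r"
      "act X m k \<iota> x = act X m r \<theta> z" by blast
    have "P r"
      unfolding P_def p r(4) realization_point_act[OF r(2,3) open_simplex_standard[OF w(2)]]
      using r(3) simplex_push_in[OF r(2) open_simplex_standard[OF w(2)]] by blast
    then show False using least r(1) w(1) by fastforce
  qed
  then show ?thesis using that w(2) p by blast
qed

text \<open>With the preceding existence statement, this makes the realization the disjoint union of
  its open nondegenerate cells.\<close>

lemma realization_point_nondegenerate_unique: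
  assumes "nondegenerate X k x" "t \<in> open_simplex k" "nondegenerate X l y" "s \<in> open_simplex l"
    "realization_point X k x t = realization_point X l y s"
  shows "k = l \<and> x = y \<and> t = s"
proof -
  note st = open_simplex_standard[OF assms(2)] open_simplex_standard[OF assms(4)]
  obtain m w \<alpha> \<beta> where w: "w \<in> open_simplex m" "\<alpha> \<in> simplex_maps m k" "\<beta> \<in> simplex_maps m l"
    "simplex_push m \<alpha> w = t" "simplex_push m \<beta> w = s"
    using simplex_refinement[OF st] by metis
  have "act X m k \<alpha> x = act X m l \<beta> y"
    by (rule realization_point_eqD[OF assms(5) _ st(1) _ st(2) w])
      (use assms in \<open>auto simp: nondegenerate_def\<close>)
  then show ?thesis
    using nondegenerate_unique[OF w(2) simplex_push_open_surj[OF assms(2) w(2,4)] assms(1)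
        w(3) simplex_push_open_surj[OF assms(4) w(3,5)] assms(3)] w by blast
qed

end

section \<open>Extension of compatible families over the skeleta\<close>

text \<open>Such a family amounts to a map from the realization of \<open>A\<close> times
  \<open>Q\<close>. Given cell by cell, it avoids comparing the weak and the subspace topology of
  that realization. \<open>R\<close> is a condition on the values that every extension has to
  keep.\<close>

definition cell_family ::
    "'a sset \<Rightarrow> (nat \<Rightarrow> 'a set) \<Rightarrow> 'q topology \<Rightarrow> 'z topology
      \<Rightarrow> (((nat \<times> 'a) \<times> (nat \<Rightarrow> real)) set \<Rightarrow> 'q \<Rightarrow> 'z \<Rightarrow> bool)
      \<Rightarrow> (nat \<Rightarrow> 'a \<Rightarrow> (nat \<Rightarrow> real) \<times> 'q \<Rightarrow> 'z) \<Rightarrow> bool" where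
  "cell_family X A Q Z R h \<longleftrightarrow>
    (\<forall>k. \<forall>y\<in>A k. continuous_map (prod_topology (simplex_space k) Q) Z (h k y)) \<and>
    (\<forall>m n. \<forall>\<theta>\<in>simplex_maps m n. \<forall>y\<in>A n. \<forall>t\<in>standard_simplex m. \<forall>s\<in>topspace Q.
       h m (act X m n \<theta> y) (t, s) = h n y (simplex_push m \<theta> t, s)) \<and>
    (\<forall>k. \<forall>y\<in>A k. \<forall>t\<in>standard_simplex k. \<forall>s\<in>topspace Q.
       R (realization_point X k y t) s (h k y (t, s)))"

text \<open>The only input about a single cell: its boundary values extend, subject to
  \<open>R\<close>. It is solved by Tietze extension for prescribed real values, and by a retraction
  of a cylinder for homotopies.\<close>

definition extends_from_boundary ::
    "'a sset \<Rightarrow> 'q topology \<Rightarrow> 'z topology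
      \<Rightarrow> (((nat \<times> 'a) \<times> (nat \<Rightarrow> real)) set \<Rightarrow> 'q \<Rightarrow> 'z \<Rightarrow> bool) \<Rightarrow> nat \<Rightarrow> 'a \<Rightarrow> bool" where
  "extends_from_boundary X Q Z R n y \<longleftrightarrow>
    (\<forall>b. continuous_map (prod_topology (subtopology (simplex_space n) (simplex_boundary n)) Q) Z b \<longrightarrow>
      (\<forall>t\<in>simplex_boundary n. \<forall>s\<in>topspace Q. R (realization_point X n y t) s (b (t, s))) \<longrightarrow>
      (\<exists>\<phi>. continuous_map (prod_topology (simplex_space n) Q) Z \<phi> \<and>
        (\<forall>t\<in>simplex_boundary n. \<forall>s\<in>topspace Q. \<phi> (t, s) = b (t, s)) \<and>
        (\<forall>t\<in>standard_simplex n. \<forall>s\<in>topspace Q. R (realization_point X n y t) s (\<phi> (t, s)))))"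

context simplicial_set
begin

text \<open>Here \<open>y\<close> itself may lie outside \<open>A\<close>. The two ways to reach the
  point agree on a common refinement, where compatibility of the family applies.\<close>

lemma cell_family_push_independent:
  assumes fam: "cell_family X A Q Z R h" and y: "y \<in> cells X n"
    and \<theta>: "\<theta> \<in> simplex_maps r n" "act X r n \<theta> y \<in> A r" "t \<in> standard_simplex r"
    and \<theta>': "\<theta>' \<in> simplex_maps r' n" "act X r' n \<theta>' y \<in> A r'" "t' \<in> standard_simplex r'"
    and e: "simplex_push r \<theta> t = simplex_push r' \<theta>' t'" and s: "s \<in> topspace Q"
  shows "h r (act X r n \<theta> y) (t, s) = h r' (act X r' n \<theta>' y) (t', s)"
proof -
  obtain m w \<gamma> \<gamma>' where w: "w \<in> open_simplex m" "\<gamma> \<in> simplex_maps m r" "\<gamma>' \<in> simplex_maps m r'"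
    "simplex_push m \<gamma> w = t" "simplex_push m \<gamma>' w = t'"
    using simplex_refinement[OF \<theta>(3) \<theta>'(3)] by metis
  have "compose {..m} \<theta> \<gamma> = compose {..m} \<theta>' \<gamma>'"
    by (rule simplex_push_inj[OF w(1) compose_simplex_maps compose_simplex_maps])
      (use w \<theta> \<theta>' e in \<open>auto simp: simplex_push_compose\<close>)
  then have "act X m r \<gamma> (act X r n \<theta> y) = act X m r' \<gamma>' (act X r' n \<theta>' y)"
    using act_compose[OF w(2) \<theta>(1) y] act_compose[OF w(3) \<theta>'(1) y] by simp
  moreover have "h m (act X m r \<gamma> (act X r n \<theta> y)) (w, s) = h r (act X r n \<theta> y) (t, s)"
    "h m (act X m r' \<gamma>' (act X r' n \<theta>' y)) (w, s) = h r' (act X r' n \<theta>' y) (t', s)"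
    using fam w \<theta>(2) \<theta>'(2) s open_simplex_standard[OF w(1)] unfolding cell_family_def by auto
  ultimately show ?thesis by simp
qed

text \<open>The facets of \<open>y\<close> lie in \<open>A\<close>, being of dimension below
  \<open>n\<close>. Their maps agree on overlaps by the preceding lemma and are glued over finitely
  many closed facets.\<close>

lemma cell_family_boundary:
  assumes A: "subcomplex X A" and low: "\<And>m. m < n \<Longrightarrow> cells X m \<subseteq> A m"
    and fam: "cell_family X A Q Z R h" and y: "y \<in> cells X n"
  obtains b where "continuous_map (prod_topology (subtopology (simplex_space n) (simplex_boundary n)) Q) Z b"
    "\<And>r \<theta> t s. \<theta> \<in> simplex_maps r n \<Longrightarrow> act X r n \<theta> y \<in> A r \<Longrightarrow> t \<in> standard_simplex r \<Longrightarrow>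
      simplex_push r \<theta> t \<in> simplex_boundary n \<Longrightarrow> s \<in> topspace Q \<Longrightarrow>
      b (simplex_push r \<theta> t, s) = h r (act X r n \<theta> y) (t, s)"
    "\<And>t s. t \<in> simplex_boundary n \<Longrightarrow> s \<in> topspace Q \<Longrightarrow> R (realization_point X n y t) s (b (t, s))"
proof (cases n)
  case 0
  \<comment> \<open>The boundary of a point is empty, so every function is an admissible boundary
    map.\<close>
  have "continuous_map (prod_topology (subtopology (simplex_space 0) {}) Q) Z b" for b
    by (simp add: continuous_map_def)
  then show ?thesis using that 0 simplex_boundary_0 by simp
next
  case (Suc n')
  define c where "c = (\<lambda>i (t :: nat \<Rightarrow> real) j. if j < i then t j else t (Suc j))"
  define F where "F = (\<lambda>i (t, s). h n' (act X n' n (coface n' i) y) (c i t, s))"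
  \<comment> \<open>Any facet containing \<open>t\<close> would do: \<open>indep\<close> shows that
    the choice does not affect the value.\<close>
  define b where "b = (\<lambda>(t, s). F (SOME i. i \<le> n \<and> t i = 0) (t, s))"
  let ?P = "prod_topology (subtopology (simplex_space n) (simplex_boundary n)) Q"
  have cof: "coface n' i \<in> simplex_maps n' n" for i using coface_simplex_maps Suc by simp
  have inA: "act X n' n (coface n' i) y \<in> A n'" for i
    using act_closed[OF cof y] low[of n'] Suc by blast
  have c: "c i t \<in> standard_simplex n'" "simplex_push n' (coface n' i) (c i t) = t"
    if "t \<in> standard_simplex n" "i \<le> n" "t i = 0" for i t
    using simplex_push_coface[of t n' i] that Suc unfolding c_def by auto
  have indep: "F i (t, s) = h r (act X r n \<theta> y) (t', s)"
    if "i \<le> n" "t i = 0" "t \<in> standard_simplex n" "s \<in> topspace Q" "\<theta> \<in> simplex_maps r n"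
      "act X r n \<theta> y \<in> A r" "t' \<in> standard_simplex r" "simplex_push r \<theta> t' = t" for i t s r \<theta> t'
    unfolding F_def case_prod_conv
    by (rule cell_family_push_independent[OF fam y cof inA _ that(5,6,7) _ that(4)]) (use c that in auto)
  have some: "(SOME i. i \<le> n \<and> t i = 0) \<le> n" "t (SOME i. i \<le> n \<and> t i = 0) = 0"
    if "t \<in> simplex_boundary n" for t
    using someI_ex[of "\<lambda>i. i \<le> n \<and> t i = 0"] that unfolding simplex_boundary_def by blast+
  have top: "topspace ?P = simplex_boundary n \<times> topspace Q"
    using simplex_boundary_standard by auto
  have cont: "continuous_map ?P Z b"
  proof (rule pasting_lemma_closed[where I = "{..n}" and T = "\<lambda>i. {q \<in> topspace ?P. fst q i = 0}" and f = F])
    fix i assume i: "i \<in> {..n}"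
    let ?T = "subtopology ?P {q \<in> topspace ?P. fst q i = 0}"
    have coord: "continuous_map ?P euclideanreal (\<lambda>q. fst q j)" for j
    proof -
      have "continuous_map ?P (simplex_space n) fst"
        by (rule continuous_map_into_fulltopology[OF continuous_map_fst])
      from continuous_map_compose[OF this continuous_map_simplex_coordinate] show ?thesis
        by (simp add: o_def)
    qed
    show "closedin ?P {q \<in> topspace ?P. fst q i = 0}"
      using closedin_continuous_map_preimage[OF coord[of i], of "{0}"] by simp
    have fst: "continuous_map ?T (simplex_space n') (\<lambda>q. c i (fst q))"
    proof (rule continuous_map_into_simplex)
      show "continuous_map ?T euclideanreal (\<lambda>q. c i (fst q) j)" for j
        unfolding c_def using continuous_map_from_subtopology[OF coord] by (cases "j < i") auto
    qed (use c i top simplex_boundary_standard in auto)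
    have "continuous_map ?T Q snd"
      by (intro continuous_map_from_subtopology continuous_map_snd)
    with fst have "continuous_map ?T (prod_topology (simplex_space n') Q) (\<lambda>q. (c i (fst q), snd q))"
      by (simp add: continuous_map_pairwise o_def)
    moreover have "continuous_map (prod_topology (simplex_space n') Q) Z (h n' (act X n' n (coface n' i) y))"
      using fam inA unfolding cell_family_def by blast
    ultimately have "continuous_map ?T Z (h n' (act X n' n (coface n' i) y) \<circ> (\<lambda>q. (c i (fst q), snd q)))"
      by (rule continuous_map_compose)
    then show "continuous_map ?T Z (F i)"
      by (simp add: F_def o_def case_prod_unfold)
  next
    fix i j q assume ij: "i \<in> {..n}" "j \<in> {..n}"
      and q: "q \<in> topspace ?P \<inter> {q \<in> topspace ?P. fst q i = 0} \<inter> {q \<in> topspace ?P. fst q j = 0}"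
    obtain t s where ts: "q = (t, s)" by fastforce
    then have t: "t \<in> standard_simplex n" "t i = 0" "t j = 0" "s \<in> topspace Q"
      using q top simplex_boundary_standard by auto
    have "F i q = h n' (act X n' n (coface n' j) y) (c j t, s)"
      unfolding ts by (rule indep) (use t ij cof inA c in auto)
    then show "F i q = F j q" unfolding ts F_def by simp
  next
    fix q assume q: "q \<in> topspace ?P"
    obtain t s where ts: "q = (t, s)" by fastforce
    have "t \<in> simplex_boundary n" using q ts top by auto
    then show "\<exists>j. j \<in> {..n} \<and> q \<in> {q \<in> topspace ?P. fst q j = 0} \<and> b q = F j q"
      using some[of t] q ts unfolding b_def by auto
  qed simp
  have val: "b (simplex_push r \<theta> t, s) = h r (act X r n \<theta> y) (t, s)"
    if "\<theta> \<in> simplex_maps r n" "act X r n \<theta> y \<in> A r" "t \<in> standard_simplex r"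
      "simplex_push r \<theta> t \<in> simplex_boundary n" "s \<in> topspace Q" for r \<theta> t s
    unfolding b_def case_prod_conv
    by (rule indep) (use that some[OF that(4)] simplex_boundary_standard in auto)
  have "R (realization_point X n y t) s (b (t, s))" if t: "t \<in> simplex_boundary n" and s: "s \<in> topspace Q" for t s
  proof -
    obtain i where i: "i \<le> n" "t i = 0" using t by (auto simp: simplex_boundary_def)
    note ci = c[OF simplex_boundary_standard[OF t] i]
    have "b (t, s) = h n' (act X n' n (coface n' i) y) (c i t, s)"
      using val[OF cof[of i] inA[of i] ci(1) _ s] ci t by simp
    moreover have "R (realization_point X n' (act X n' n (coface n' i) y) (c i t)) s
        (h n' (act X n' n (coface n' i) y) (c i t, s))"
      using fam inA ci s unfolding cell_family_def by blast
    ultimately show ?thesis using realization_point_act[OF cof y ci(1)] ci(2) by simp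
  qed
  with that cont val show ?thesis by blast
qed

text \<open>A cell added here has a unique form \<open>act X k n \<theta> y\<close> with
  \<open>\<theta>\<close> surjective and \<open>y\<close> nondegenerate outside \<open>A\<close>. So
  extensions \<open>\<phi> y\<close> can be chosen independently for each \<open>y\<close>, and
  every other new cell inherits its map from them.\<close>

lemma cell_family_step:
  assumes A: "subcomplex X A" and low: "\<And>m. m < n \<Longrightarrow> cells X m \<subseteq> A m"
    and fam: "cell_family X A Q Z R h"
    and ext: "\<And>y. nondegenerate X n y \<Longrightarrow> y \<notin> A n \<Longrightarrow> extends_from_boundary X Q Z R n y"
  obtains h' where "cell_family X (\<lambda>k. A k \<union> {act X k n \<theta> y | \<theta> y. \<theta> \<in> simplex_maps k n \<and> y \<in> cells X n}) Q Z R h'"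
    "\<And>k y. y \<in> A k \<Longrightarrow> h' k y = h k y"
proof -
  \<comment> \<open>A degenerate cell of dimension \<open>n\<close> comes from a lower dimension,
    and those cells are all in \<open>A\<close>.\<close>
  have nd: "nondegenerate X n y" if "y \<in> cells X n" "y \<notin> A n" for y
    using that low subcomplex_act[OF A] unfolding nondegenerate_def by blast
  define P where "P = (\<lambda>y \<phi>. continuous_map (prod_topology (simplex_space n) Q) Z \<phi> \<and>
      (\<forall>r \<theta> t s. \<theta> \<in> simplex_maps r n \<longrightarrow> act X r n \<theta> y \<in> A r \<longrightarrow> t \<in> standard_simplex r \<longrightarrow>
        simplex_push r \<theta> t \<in> simplex_boundary n \<longrightarrow> s \<in> topspace Q \<longrightarrow>
        \<phi> (simplex_push r \<theta> t, s) = h r (act X r n \<theta> y) (t, s)) \<and>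
      (\<forall>t\<in>standard_simplex n. \<forall>s\<in>topspace Q. R (realization_point X n y t) s (\<phi> (t, s))))"
  have "\<exists>\<phi>. P y \<phi>"
    if y: "y \<in> cells X n" "y \<notin> A n" for y
  proof -
    obtain b where b: "continuous_map (prod_topology (subtopology (simplex_space n) (simplex_boundary n)) Q) Z b"
      "\<And>r \<theta> t s. \<theta> \<in> simplex_maps r n \<Longrightarrow> act X r n \<theta> y \<in> A r \<Longrightarrow> t \<in> standard_simplex r \<Longrightarrow>
        simplex_push r \<theta> t \<in> simplex_boundary n \<Longrightarrow> s \<in> topspace Q \<Longrightarrow>
        b (simplex_push r \<theta> t, s) = h r (act X r n \<theta> y) (t, s)"
      "\<And>t s. t \<in> simplex_boundary n \<Longrightarrow> s \<in> topspace Q \<Longrightarrow> R (realization_point X n y t) s (b (t, s))"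
      using cell_family_boundary[OF A low fam y(1)] by blast
    obtain \<phi> where "continuous_map (prod_topology (simplex_space n) Q) Z \<phi>"
      "\<forall>t\<in>simplex_boundary n. \<forall>s\<in>topspace Q. \<phi> (t, s) = b (t, s)"
      "\<forall>t\<in>standard_simplex n. \<forall>s\<in>topspace Q. R (realization_point X n y t) s (\<phi> (t, s))"
      using ext[OF nd[OF y] y(2)] b(1,3) unfolding extends_from_boundary_def by blast
    then show ?thesis using b(2) unfolding P_def by (intro exI[of _ \<phi>]) simp
  qed
  then have "\<forall>y\<in>cells X n - A n. \<exists>\<phi>. P y \<phi>" by blast
  then obtain \<phi> where "\<forall>y\<in>cells X n - A n. P y (\<phi> y)" by (rule bchoice[THEN exE])
  then have \<phi>: "\<And>y. y \<in> cells X n \<Longrightarrow> y \<notin> A n \<Longrightarrow>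
      continuous_map (prod_topology (simplex_space n) Q) Z (\<phi> y)"
    "\<And>y r \<theta> t s. y \<in> cells X n \<Longrightarrow> y \<notin> A n \<Longrightarrow> \<theta> \<in> simplex_maps r n \<Longrightarrow> act X r n \<theta> y \<in> A r \<Longrightarrow>
        t \<in> standard_simplex r \<Longrightarrow> simplex_push r \<theta> t \<in> simplex_boundary n \<Longrightarrow> s \<in> topspace Q \<Longrightarrow>
        \<phi> y (simplex_push r \<theta> t, s) = h r (act X r n \<theta> y) (t, s)"
    "\<And>y t s. y \<in> cells X n \<Longrightarrow> y \<notin> A n \<Longrightarrow> t \<in> standard_simplex n \<Longrightarrow> s \<in> topspace Q \<Longrightarrow>
        R (realization_point X n y t) s (\<phi> y (t, s))"
    unfolding P_def by simp_all
  define rep where "rep = (\<lambda>k z. SOME q. fst q \<in> simplex_maps k n \<and> snd q \<in> cells X n \<and> z = act X k n (fst q) (snd q))"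
  define h' where "h' = (\<lambda>k z. if z \<in> A k then h k z
    else (\<lambda>(t, s). \<phi> (snd (rep k z)) (simplex_push k (fst (rep k z)) t, s)))"
  have surj: "\<theta> ` {..k} = {..n}" "y \<notin> A n"
    if \<theta>n: "\<theta> \<in> simplex_maps k n" and yn: "y \<in> cells X n" "act X k n \<theta> y \<notin> A k" for k \<theta> y
  proof -
    note that = \<theta>n yn
    show "y \<notin> A n" using subcomplex_act[OF A that(1)] that(3) by blast
    show "\<theta> ` {..k} = {..n}"
    proof (rule ccontr)
      assume "\<theta> ` {..k} \<noteq> {..n}"
      then obtain r \<iota> \<rho> where r: "r < n" "\<iota> \<in> simplex_maps r n" "\<rho> \<in> simplex_maps k r"
        "\<theta> = compose {..k} \<iota> \<rho>" by (rule simplex_maps_factor[OF \<theta>n])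
      have "act X r n \<iota> y \<in> A r" using low[OF r(1)] act_closed[OF r(2) that(2)] by blast
      then have "act X k r \<rho> (act X r n \<iota> y) \<in> A k" using subcomplex_act[OF A r(3)] by blast
      then show False using that(3) r(4) act_compose[OF r(3,2) that(2)] by simp
    qed
  qed
  have rep: "rep k (act X k n \<theta> y) = (\<theta>, y)"
    if "\<theta> \<in> simplex_maps k n" "y \<in> cells X n" "act X k n \<theta> y \<notin> A k" for k \<theta> y
  proof -
    let ?q = "rep k (act X k n \<theta> y)"
    have q: "fst ?q \<in> simplex_maps k n \<and> snd ?q \<in> cells X n \<and> act X k n \<theta> y = act X k n (fst ?q) (snd ?q)"
      unfolding rep_def by (rule someI[of _ "(\<theta>, y)"]) (use that in simp)
    then have "fst ?q ` {..k} = {..n}" "snd ?q \<notin> A n" using surj that(3) by metis+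
    then have "\<theta> = fst ?q" "y = snd ?q"
      using nondegenerate_unique[OF that(1) surj(1)[OF that] nd[OF that(2) surj(2)[OF that]], of "fst ?q" n "snd ?q"]
        q nd by blast+
    then show ?thesis by (metis prod.collapse)
  qed
  \<comment> \<open>The formula holds also when the cell already lies in \<open>A\<close>: then
    \<open>\<theta>\<close> is not surjective, its image is in the boundary, and there
    \<open>\<phi> y\<close> was made to agree with \<open>h\<close>.\<close>
  have K: "h' k (act X k n \<theta> y) (t, s) = \<phi> y (simplex_push k \<theta> t, s)"
    if "\<theta> \<in> simplex_maps k n" "y \<in> cells X n" "y \<notin> A n" "t \<in> standard_simplex k" "s \<in> topspace Q"
    for k \<theta> y t s
  proof (cases "act X k n \<theta> y \<in> A k")
    case True
    then have "\<theta> ` {..k} \<noteq> {..n}"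
      using subcomplex_act_surj[OF A that(1) _ that(2)] that(3) by blast
    then have "simplex_push k \<theta> t \<in> simplex_boundary n"
      using simplex_push_nonsurj_zero[OF that(1)] simplex_push_in[OF that(1,4)]
      by (auto simp: simplex_boundary_def)
    then show ?thesis using \<phi>(2)[OF that(2,3,1) True that(4) _ that(5)] True by (simp add: h'_def)
  next
    case False
    then show ?thesis by (simp add: h'_def rep that)
  qed
  let ?B = "\<lambda>k. A k \<union> {act X k n \<theta> y | \<theta> y. \<theta> \<in> simplex_maps k n \<and> y \<in> cells X n}"
  have cases: "(z \<in> A k \<Longrightarrow> P) \<Longrightarrow>
      (\<And>\<theta> y. \<theta> \<in> simplex_maps k n \<Longrightarrow> y \<in> cells X n \<Longrightarrow> y \<notin> A n \<Longrightarrow> z = act X k n \<theta> y \<Longrightarrow> P) \<Longrightarrow> P"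
    if "z \<in> ?B k" for z k P
    using that surj(2) by blast
  have "cell_family X ?B Q Z R h'"
    unfolding cell_family_def
  proof (intro conjI allI ballI)
    fix k z assume "z \<in> ?B k"
    then show "continuous_map (prod_topology (simplex_space k) Q) Z (h' k z)"
    proof (rule cases)
      assume "z \<in> A k"
      then show ?thesis using fam unfolding cell_family_def h'_def by simp
    next
      fix \<theta> y assume *: "\<theta> \<in> simplex_maps k n" "y \<in> cells X n" "y \<notin> A n" "z = act X k n \<theta> y"
      let ?P = "prod_topology (simplex_space k) Q"
      have "continuous_map ?P (simplex_space n) (\<lambda>q. simplex_push k \<theta> (fst q))"
        using continuous_map_compose[OF continuous_map_fst continuous_map_simplex_push[OF *(1)]]
        by (simp add: o_def)
      then have "continuous_map ?P (prod_topology (simplex_space n) Q) (\<lambda>q. (simplex_push k \<theta> (fst q), snd q))"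
        by (simp add: continuous_map_pairwise o_def continuous_map_snd)
      from continuous_map_compose[OF this \<phi>(1)[OF *(2,3)]]
      show ?thesis by (rule continuous_map_eq) (auto simp: K *)
    qed
  next
    fix m k \<psi> z t s assume \<psi>: "\<psi> \<in> simplex_maps m k" and z: "z \<in> ?B k" and t: "t \<in> standard_simplex m"
      and s: "s \<in> topspace Q"
    from z show "h' m (act X m k \<psi> z) (t, s) = h' k z (simplex_push m \<psi> t, s)"
    proof (rule cases)
      assume "z \<in> A k"
      then show ?thesis
        using fam subcomplex_act[OF A \<psi>] \<psi> t s unfolding cell_family_def h'_def by simp
    next
      fix \<theta> y assume *: "\<theta> \<in> simplex_maps k n" "y \<in> cells X n" "y \<notin> A n" "z = act X k n \<theta> y"
      have "act X m k \<psi> z = act X m n (compose {..m} \<theta> \<psi>) y"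
        using act_compose[OF \<psi> *(1,2)] *(4) by simp
      then show ?thesis
        using K[OF compose_simplex_maps[OF \<psi> *(1)] *(2,3) t s] K[OF *(1-3) simplex_push_in[OF \<psi> t] s]
          simplex_push_compose[OF \<psi>] *(4) by simp
    qed
  next
    fix k z t s assume z: "z \<in> ?B k" and t: "t \<in> standard_simplex k" and s: "s \<in> topspace Q"
    from z show "R (realization_point X k z t) s (h' k z (t, s))"
    proof (rule cases)
      assume "z \<in> A k"
      then show ?thesis using fam t s unfolding cell_family_def h'_def by simp
    next
      fix \<theta> y assume *: "\<theta> \<in> simplex_maps k n" "y \<in> cells X n" "y \<notin> A n" "z = act X k n \<theta> y"
      then show ?thesis
        using K[OF *(1-3) t s] \<phi>(3)[OF *(2,3) simplex_push_in[OF *(1) t] s]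
          realization_point_act[OF *(1,2) t] by simp
    qed
  qed
  then show ?thesis by (rule that) (simp add: h'_def)
qed

text \<open>The step is iterated by dependent choice over the relative skeleta; each stage keeps the
  earlier values, so the limit is defined cell by cell.\<close>

lemma cell_family_extend:
  assumes S: "subcomplex X S" and fam: "cell_family X S Q Z R h0"
    and ext: "\<And>n y. nondegenerate X n y \<Longrightarrow> y \<notin> S n \<Longrightarrow> extends_from_boundary X Q Z R n y"
  obtains h where "cell_family X (cells X) Q Z R h" "\<And>k y. y \<in> S k \<Longrightarrow> h k y = h0 k y"
proof -
  \<comment> \<open>\<open>S\<close> together with all cells generated in dimensions strictly below
    \<open>n\<close>.\<close>
  define A where "A = (\<lambda>n k. S k \<union> {act X k m \<theta> y | m \<theta> y. m < n \<and> \<theta> \<in> simplex_maps k m \<and> y \<in> cells X m})"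
  have A0: "A 0 = S" by (auto simp: A_def)
  have ASuc: "A (Suc n) = (\<lambda>k. A n k \<union> {act X k n \<theta> y | \<theta> y. \<theta> \<in> simplex_maps k n \<and> y \<in> cells X n})" for n
    unfolding A_def less_Suc_eq by blast
  have mono: "A n k \<subseteq> A n' k" if "n \<le> n'" for n n' k
    unfolding A_def using that by fastforce
  have low: "cells X m \<subseteq> A n m" if "m < n" for m n
  proof
    fix y assume "y \<in> cells X m"
    then have "y = act X m m (restrict id {..m}) y" by (simp add: act_id)
    then show "y \<in> A n m" using that id_simplex_maps \<open>y \<in> cells X m\<close> unfolding A_def by blast
  qed
  have Asub: "subcomplex X (A n)" for n
    unfolding subcomplex_def
  proof (intro conjI allI ballI)
    show "A n k \<subseteq> cells X k" for k
      using subcomplex_cells[OF S] act_closed unfolding A_def by auto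
    fix l k \<theta> x assume \<theta>: "\<theta> \<in> simplex_maps l k" and x: "x \<in> A n k"
    show "act X l k \<theta> x \<in> A n l"
    proof (cases "x \<in> S k")
      case True
      then show ?thesis using subcomplex_act[OF S \<theta>] by (simp add: A_def)
    next
      case False
      then obtain m \<psi> y where *: "m < n" "\<psi> \<in> simplex_maps k m" "y \<in> cells X m" "x = act X k m \<psi> y"
        using x unfolding A_def by blast
      then have "act X l k \<theta> x = act X l m (compose {..l} \<psi> \<theta>) y" using act_compose[OF \<theta>] by simp
      then show ?thesis using * compose_simplex_maps[OF \<theta> *(2)] unfolding A_def by blast
    qed
  qed
  have "\<exists>hs. hs 0 = h0 \<and> (\<forall>n. cell_family X (A n) Q Z R (hs n) \<and> (\<forall>k. \<forall>y\<in>A n k. hs (Suc n) k y = hs n k y))"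
  proof -
    have "\<exists>hs. \<forall>n. (cell_family X (A n) Q Z R (hs n) \<and> (n = 0 \<longrightarrow> hs n = h0)) \<and>
        (\<forall>k. \<forall>y\<in>A n k. hs (Suc n) k y = hs n k y)"
    proof (rule dependent_nat_choice)
      show "\<exists>h. cell_family X (A 0) Q Z R h \<and> (0 = 0 \<longrightarrow> h = h0)" using fam A0 by simp
      fix h n assume h: "cell_family X (A n) Q Z R h \<and> (n = 0 \<longrightarrow> h = h0)"
      have "extends_from_boundary X Q Z R n y" if "nondegenerate X n y" "y \<notin> A n n" for y
        using ext that by (auto simp: A_def)
      then obtain h' where "cell_family X (A (Suc n)) Q Z R h'" "\<And>k y. y \<in> A n k \<Longrightarrow> h' k y = h k y"
        using cell_family_step[OF Asub low conjunct1[OF h]] unfolding ASuc by blast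
      then show "\<exists>h'. (cell_family X (A (Suc n)) Q Z R h' \<and> (Suc n = 0 \<longrightarrow> h' = h0)) \<and>
          (\<forall>k. \<forall>y\<in>A n k. h' k y = h k y)" by auto
    qed
    then show ?thesis by blast
  qed
  then obtain hs where hs: "hs 0 = h0" "\<And>n. cell_family X (A n) Q Z R (hs n)"
    "\<And>n k y. y \<in> A n k \<Longrightarrow> hs (Suc n) k y = hs n k y" by blast
  have stable: "hs n' k y = hs n k y" if "n \<le> n'" "y \<in> A n k" for n n' k y
    using that
  proof (induction rule: dec_induct)
    case (step m)
    then show ?case using hs(3)[of y m k] mono[OF step.hyps(1), of k] by auto
  qed simp
  \<comment> \<open>All cells of dimension \<open>k\<close> are present from stage
    \<open>Suc k\<close> on.\<close>
  define h where "h = (\<lambda>k. hs (Suc k) k)"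
  have h: "h k y = hs n k y" if "k < n" "y \<in> cells X k" for n k y
    unfolding h_def using stable[of "Suc k" n y k] that low[of k "Suc k"] by auto
  have "cell_family X (cells X) Q Z R h"
    unfolding cell_family_def
  proof (intro conjI allI ballI)
    show "continuous_map (prod_topology (simplex_space k) Q) Z (h k y)" if "y \<in> cells X k" for k y
      using hs(2)[of "Suc k"] low[of k "Suc k"] that unfolding cell_family_def h_def by auto
    show "R (realization_point X k y t) s (h k y (t, s))"
      if "y \<in> cells X k" "t \<in> standard_simplex k" "s \<in> topspace Q" for k y t s
      using hs(2)[of "Suc k"] low[of k "Suc k"] that unfolding cell_family_def h_def by auto
    fix m n \<theta> y t s assume *: "\<theta> \<in> simplex_maps m n" "y \<in> cells X n" "t \<in> standard_simplex m" "s \<in> topspace Q"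
    let ?N = "Suc (max m n)"
    have yA: "y \<in> A ?N n" using low[of n ?N] *(2) by (simp add: subset_iff)
    have "hs ?N m (act X m n \<theta> y) (t, s) = hs ?N n y (simplex_push m \<theta> t, s)"
      using hs(2)[of ?N] yA * unfolding cell_family_def by blast
    then show "h m (act X m n \<theta> y) (t, s) = h n y (simplex_push m \<theta> t, s)"
      using h[of m ?N "act X m n \<theta> y"] h[of n ?N y] act_closed * by simp
  qed
  moreover have "h k y = h0 k y" if "y \<in> S k" for k y
    using stable[of 0 "Suc k" y k] that hs(1) A0 by (simp add: h_def)
  ultimately show ?thesis by (rule that)
qed

text \<open>Continuity of \<open>G\<close> is asked only on the cells of \<open>S\<close>, which is
  the form in which the given maps come and avoids topologizing the realization of
  \<open>S\<close>.\<close>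

lemma realization_extend:
  assumes S: "subcomplex X S" and Q: "locally_compact_space Q" "Hausdorff_space Q"
    and G: "\<And>k y. y \<in> S k \<Longrightarrow>
      continuous_map (prod_topology (simplex_space k) Q) Z (\<lambda>(t, s). G (realization_point X k y t, s))"
    and RG: "\<And>p s. p \<in> realization_of X S \<Longrightarrow> s \<in> topspace Q \<Longrightarrow> R p s (G (p, s))"
    and ext: "\<And>n y. nondegenerate X n y \<Longrightarrow> y \<notin> S n \<Longrightarrow> extends_from_boundary X Q Z R n y"
  obtains F where "continuous_map (prod_topology (realization X) Q) Z F"
    "\<And>p s. p \<in> realization_of X S \<Longrightarrow> s \<in> topspace Q \<Longrightarrow> F (p, s) = G (p, s)"
    "\<And>p s. p \<in> topspace (realization X) \<Longrightarrow> s \<in> topspace Q \<Longrightarrow> R p s (F (p, s))"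
proof -
  have "cell_family X S Q Z R (\<lambda>k y (t, s). G (realization_point X k y t, s))"
    unfolding cell_family_def
  proof (intro conjI allI ballI)
    show "continuous_map (prod_topology (simplex_space k) Q) Z (\<lambda>(t, s). G (realization_point X k y t, s))"
      if "y \<in> S k" for k y using G[OF that] .
    show "R (realization_point X k y t) s (case (t, s) of (t, s) \<Rightarrow> G (realization_point X k y t, s))"
      if "y \<in> S k" "t \<in> standard_simplex k" "s \<in> topspace Q" for k y t s
      using RG[of "realization_point X k y t" s] that by (auto simp: realization_of_def)
  qed (use subcomplex_cells[OF S] realization_point_act in auto)
  then obtain h where h: "cell_family X (cells X) Q Z R h"
    "\<And>k y. y \<in> S k \<Longrightarrow> h k y = (\<lambda>(t, s). G (realization_point X k y t, s))"
    by (rule cell_family_extend[OF S _ ext]) auto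
  \<comment> \<open>A representation of each point is chosen; any two give the same value, since the
    family is compatible and they agree on a common refinement.\<close>
  define rep where "rep = (\<lambda>p. SOME (k, y, t). y \<in> cells X k \<and> t \<in> standard_simplex k \<and> p = realization_point X k y t)"
  define F where "F = (\<lambda>(p, s). case rep p of (k, y, t) \<Rightarrow> h k y (t, s))"
  have F: "F (realization_point X k y t, s) = h k y (t, s)"
    if y: "y \<in> cells X k" and t: "t \<in> standard_simplex k" and s: "s \<in> topspace Q" for k y t s
  proof -
    obtain l z u where r: "rep (realization_point X k y t) = (l, z, u)" using prod_cases3 by blast
    have "case rep (realization_point X k y t) of (l, z, u) \<Rightarrow>
        z \<in> cells X l \<and> u \<in> standard_simplex l \<and> realization_point X k y t = realization_point X l z u"
      unfolding rep_def by (rule someI[of _ "(k, y, t)"]) (use y t in simp)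
    then have z: "z \<in> cells X l" "u \<in> standard_simplex l" "realization_point X k y t = realization_point X l z u"
      using r by auto
    obtain m w \<alpha> \<beta> where w: "w \<in> open_simplex m" "\<alpha> \<in> simplex_maps m k" "\<beta> \<in> simplex_maps m l"
      "simplex_push m \<alpha> w = t" "simplex_push m \<beta> w = u"
      using simplex_refinement[OF t z(2)] by metis
    have "act X m k \<alpha> y = act X m l \<beta> z" by (rule realization_point_eqD[OF z(3) y t z(1,2) w])
    moreover have "h m (act X m k \<alpha> y) (w, s) = h k y (t, s)" "h m (act X m l \<beta> z) (w, s) = h l z (u, s)"
      using h(1) w y z s open_simplex_standard[OF w(1)] unfolding cell_family_def by auto
    ultimately show ?thesis by (simp add: F_def r)
  qed
  show ?thesis
  proof (rule that)
    show "continuous_map (prod_topology (realization X) Q) Z F"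
    proof (rule continuous_map_from_realization_prod[OF Q])
      fix k x assume x: "x \<in> cells X k"
      then have "continuous_map (prod_topology (simplex_space k) Q) Z (h k x)"
        using h(1) unfolding cell_family_def by blast
      then show "continuous_map (prod_topology (simplex_space k) Q) Z (\<lambda>(t, s). F (realization_point X k x t, s))"
        by (rule continuous_map_eq) (auto simp: F x)
    qed
    show "F (p, s) = G (p, s)" if pS: "p \<in> realization_of X S" and sQ: "s \<in> topspace Q" for p s
    proof -
      obtain k y t where "y \<in> S k" "t \<in> standard_simplex k" "p = realization_point X k y t"
          using pS unfolding realization_of_def by blast
      then show ?thesis using F[of y k t s] sQ h(2) subcomplex_cells[OF S] by simp
    qed
    show "R p s (F (p, s))" if "p \<in> topspace (realization X)" "s \<in> topspace Q" for p s
      using that F h(1) unfolding topspace_realization cell_family_def by auto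
  qed
qed

section \<open>Real functions on a realization, separation and compact sets\<close>

text \<open>In each simplex the boundary together with finitely many interior points is closed, so
  boundary values and the values demanded on \<open>V\<close> extend by Tietze.\<close>

lemma realization_prescribe:
  fixes v :: "((nat \<times> 'a) \<times> (nat \<Rightarrow> real)) set \<Rightarrow> real"
  assumes fin: "\<And>k y. nondegenerate X k y \<Longrightarrow> finite {t \<in> open_simplex k. realization_point X k y t \<in> V}"
  obtains h where "continuous_map (realization X) euclideanreal h"
    "\<And>p. p \<in> topspace (realization X) \<Longrightarrow> p \<in> V \<Longrightarrow> h p = v p"
proof -
  \<comment> \<open>A one-point parameter space specializes the extension of families to single
    functions.\<close>
  let ?Q = "discrete_topology {()}"
  let ?R = "\<lambda>p (s :: unit) z. p \<in> V \<longrightarrow> z = v p"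
  have ext: "extends_from_boundary X ?Q euclideanreal ?R n y" if y: "nondegenerate X n y" for n y
    unfolding extends_from_boundary_def
  proof (intro allI impI)
    fix b assume b: "continuous_map (prod_topology (subtopology (simplex_space n) (simplex_boundary n)) ?Q) euclideanreal b"
      and Rb: "\<forall>t\<in>simplex_boundary n. \<forall>s\<in>topspace ?Q. ?R (realization_point X n y t) s (b (t, s))"
    define B where "B = simplex_boundary n"
    define E where "E = {t \<in> open_simplex n. realization_point X n y t \<in> V}"
    have "finite E" unfolding E_def using fin[OF y] .
    have Bs: "B \<subseteq> standard_simplex n" and Es: "E \<subseteq> standard_simplex n"
      by (auto simp: B_def simplex_boundary_def E_def open_simplex_def)
    define f where "f = (\<lambda>t. if t \<in> B then b (t, ()) else v (realization_point X n y t))"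
    let ?C = "subtopology (simplex_space n) (B \<union> E)"
    have cb: "closedin (simplex_space n) B" unfolding B_def by (rule closedin_simplex_boundary)
    have ce: "closedin (simplex_space n) {t}" if "t \<in> E" for t
      using closedin_Hausdorff_singleton[OF Hausdorff_simplex_space] that Es by auto
    have "closedin (simplex_space n) (\<Union>t\<in>E. {t})"
      using \<open>finite E\<close> ce by (intro closedin_Union) auto
    then have cl: "closedin (simplex_space n) (B \<union> E)" using cb by (simp add: closedin_Un)
    have "continuous_map ?C euclideanreal f"
    \<comment> \<open>The pieces are the boundary (\<open>None\<close>) and the single points of
      \<open>E\<close> (\<open>Some t\<close>); they are disjoint because \<open>E\<close> consists
      of interior points.\<close>
    proof (rule pasting_lemma_closed[where I = "insert None (Some ` E)"
          and T = "\<lambda>i. case i of None \<Rightarrow> B | Some t \<Rightarrow> {t}"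
          and f = "\<lambda>i t. case i of None \<Rightarrow> b (t, ()) | Some u \<Rightarrow> f u"])
      show "finite (insert None (Some ` E))" using \<open>finite E\<close> by simp
      fix i assume i: "i \<in> insert None (Some ` E)"
      show "closedin ?C (case i of None \<Rightarrow> B | Some t \<Rightarrow> {t})"
        using i cb ce by (cases i) (auto intro: closedin_subset_topspace)
      have "continuous_map (subtopology (simplex_space n) B) euclideanreal (b \<circ> (\<lambda>t. (t, ())))"
        by (rule continuous_map_compose[OF _ b]) (simp add: B_def continuous_map_pairwise o_def)
      moreover have "subtopology ?C B = subtopology (simplex_space n) B"
        unfolding subtopology_subtopology by (rule arg_cong[where f = "subtopology _"]) blast
      ultimately show "continuous_map (subtopology ?C (case i of None \<Rightarrow> B | Some t \<Rightarrow> {t})) euclideanreal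
          (\<lambda>t. case i of None \<Rightarrow> b (t, ()) | Some u \<Rightarrow> f u)"
        by (cases i) (simp_all add: o_def)
    qed (auto simp: f_def E_def B_def open_simplex_def simplex_boundary_def split: option.splits)
    moreover have "normal_space (simplex_space n)"
      using compact_Hausdorff_or_regular_imp_normal_space compact_simplex_space Hausdorff_simplex_space by blast
    ultimately obtain g where g: "continuous_map (simplex_space n) euclideanreal g" "\<And>t. t \<in> B \<union> E \<Longrightarrow> g t = f t"
      using Tietze_extension_realinterval[OF _ cl is_interval_univ, of f] by auto
    show "\<exists>\<phi>. continuous_map (prod_topology (simplex_space n) ?Q) euclideanreal \<phi> \<and>
        (\<forall>t\<in>simplex_boundary n. \<forall>s\<in>topspace ?Q. \<phi> (t, s) = b (t, s)) \<and>
        (\<forall>t\<in>standard_simplex n. \<forall>s\<in>topspace ?Q. ?R (realization_point X n y t) s (\<phi> (t, s)))"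
    proof (intro exI[of _ "g \<circ> fst"] conjI ballI)
      show "continuous_map (prod_topology (simplex_space n) ?Q) euclideanreal (g \<circ> fst)"
        by (rule continuous_map_compose[OF continuous_map_fst g(1)])
      show "(g \<circ> fst) (t, s) = b (t, s)" if "t \<in> simplex_boundary n" "s \<in> topspace ?Q" for t s
        using g(2)[of t] that by (simp add: f_def B_def)
      show "?R (realization_point X n y t) s ((g \<circ> fst) (t, s))" if "t \<in> standard_simplex n" "s \<in> topspace ?Q" for t s
      proof
        assume tV: "realization_point X n y t \<in> V"
        show "(g \<circ> fst) (t, s) = v (realization_point X n y t)"
        proof (cases "t \<in> B")
          case True
          then show ?thesis using g(2)[of t] Rb tV by (simp add: f_def B_def)
        next
          case False
          then have "t \<in> E" using simplex_boundary_or_open[OF that(1)] tV by (simp add: B_def E_def)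
          then show ?thesis using g(2)[of t] False by (simp add: f_def)
        qed
      qed
    qed
  qed
  obtain F where F: "continuous_map (prod_topology (realization X) ?Q) euclideanreal F"
    "\<And>p s. p \<in> topspace (realization X) \<Longrightarrow> s \<in> topspace ?Q \<Longrightarrow> ?R p s (F (p, s))"
    by (rule realization_extend[of "\<lambda>_. {}" ?Q euclideanreal "\<lambda>_. 0" ?R])
      (use ext in \<open>auto simp: subcomplex_def realization_of_def compact_imp_locally_compact_space compact_space_discrete_topology\<close>)
  show ?thesis
  proof (rule that)
    show "continuous_map (realization X) euclideanreal (F \<circ> (\<lambda>p. (p, ())))"
      by (rule continuous_map_compose[OF _ F(1)]) (simp add: continuous_map_pairwise o_def)
    show "(F \<circ> (\<lambda>p. (p, ()))) p = v p" if "p \<in> topspace (realization X)" "p \<in> V" for p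
      using F(2)[OF that(1)] that(2) by simp
  qed
qed

text \<open>Two points meet each open cell in a finite set, so a real function with values 0 and 1
  at them separates.\<close>

lemma Hausdorff_realization: "Hausdorff_space (realization X)"
  unfolding Hausdorff_space_def
proof (intro allI impI)
  fix p q assume pq: "p \<in> topspace (realization X) \<and> q \<in> topspace (realization X) \<and> p \<noteq> q"
  obtain h where h: "continuous_map (realization X) euclideanreal h"
    "\<And>x. x \<in> topspace (realization X) \<Longrightarrow> x \<in> {p, q} \<Longrightarrow> h x = (if x = p then 0 else 1)"
  proof (rule realization_prescribe[of "{p, q}" "\<lambda>x. if x = p then 0 else 1"])
    fix k y assume y: "nondegenerate X k y"
    have "inj_on (realization_point X k y) {t \<in> open_simplex k. realization_point X k y t \<in> {p, q}}"
      using realization_point_nondegenerate_unique[OF y _ y] by (auto intro!: inj_onI)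
    then show "finite {t \<in> open_simplex k. realization_point X k y t \<in> {p, q}}"
      by (rule inj_on_finite[of _ _ "{p, q}"]) auto
  qed blast
  let ?U = "{x \<in> topspace (realization X). h x \<in> {..<1/2}}"
  let ?V = "{x \<in> topspace (realization X). h x \<in> {1/2<..}}"
  have "openin (realization X) ?U" "openin (realization X) ?V"
    by (rule openin_continuous_map_preimage[OF h(1)], simp)+
  moreover have "p \<in> ?U" "q \<in> ?V" "disjnt ?U ?V"
    using pq h(2)[of p] h(2)[of q] by (auto simp: disjnt_iff)
  ultimately show "\<exists>U V. openin (realization X) U \<and> openin (realization X) V \<and> p \<in> U \<and> q \<in> V \<and> disjnt U V"
    by blast
qed

text \<open>If \<open>K\<close> met infinitely many open cells, one point of \<open>K\<close> in
  each of countably many of them could be given the values 0, 1, 2, ... by a continuous function,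
  which would be unbounded on \<open>K\<close>.\<close>

lemma compactin_realization_finite:
  assumes K: "compactin (realization X) K"
  shows "finite {(k, y). nondegenerate X k y \<and> (\<exists>t\<in>open_simplex k. realization_point X k y t \<in> K)}"
    (is "finite ?D")
proof (rule ccontr)
  assume "infinite ?D"
  then obtain e :: "nat \<Rightarrow> nat \<times> 'a" where e: "inj e" "range e \<subseteq> ?D"
    using infinite_countable_subset by blast
  have "\<forall>j. \<exists>t. t \<in> open_simplex (fst (e j)) \<and> realization_point X (fst (e j)) (snd (e j)) t \<in> K"
    using e(2) by (fastforce simp: image_subset_iff case_prod_unfold)
  then obtain t where t: "\<And>j. t j \<in> open_simplex (fst (e j))"
    "\<And>j. realization_point X (fst (e j)) (snd (e j)) (t j) \<in> K" by metis
  have nd: "nondegenerate X (fst (e j)) (snd (e j))" for j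
    using e(2) by (auto simp: image_subset_iff case_prod_unfold)
  define p where "p = (\<lambda>j. realization_point X (fst (e j)) (snd (e j)) (t j))"
  have "inj p"
  proof (rule injI)
    fix i j assume "p i = p j"
    then have "e i = e j"
      using realization_point_nondegenerate_unique[OF nd t(1) nd t(1)] unfolding p_def
      by (metis prod_eqI)
    then show "i = j" using e(1) by (simp add: inj_eq)
  qed
  obtain h where h: "continuous_map (realization X) euclideanreal h"
    "\<And>x. x \<in> topspace (realization X) \<Longrightarrow> x \<in> range p \<Longrightarrow> h x = real (inv_into UNIV p x)"
  proof (rule realization_prescribe[of "range p" "\<lambda>x. real (inv_into UNIV p x)"])
    fix k y assume y: "nondegenerate X k y"
    have "{u \<in> open_simplex k. realization_point X k y u \<in> range p} \<subseteq> t ` (e -` {(k, y)})"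
    proof
      fix u assume "u \<in> {u \<in> open_simplex k. realization_point X k y u \<in> range p}"
      then obtain j where j: "u \<in> open_simplex k" "realization_point X k y u = p j" by auto
      then have "k = fst (e j) \<and> y = snd (e j) \<and> u = t j"
        using realization_point_nondegenerate_unique[OF y j(1) nd t(1)] unfolding p_def by blast
      then show "u \<in> t ` (e -` {(k, y)})" by auto
    qed
    then show "finite {u \<in> open_simplex k. realization_point X k y u \<in> range p}"
      using e(1) by (meson finite.emptyI finite.insertI finite_imageI finite_subset finite_vimageI)
  qed blast
  have "compactin euclideanreal (h ` K)" using image_compactin[OF K h(1)] .
  then have "bounded (h ` K)" by (simp add: compact_imp_bounded)
  then obtain M where M: "\<And>x. x \<in> K \<Longrightarrow> \<bar>h x\<bar> \<le> M" by (auto simp: bounded_iff)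
  obtain j :: nat where j: "M < real j" using reals_Archimedean2 by blast
  have "p j \<in> K" using t(2) by (simp add: p_def)
  moreover have "h (p j) = real j"
    using h(2)[of "p j"] \<open>p j \<in> K\<close> compactin_subset_topspace[OF K] \<open>inj p\<close> by auto
  ultimately show False using M[of "p j"] j by simp
qed

end

section \<open>Homotopy extension and strong deformation\<close>

abbreviation unit_interval :: "real topology" where
  "unit_interval \<equiv> top_of_set {0..1}"

lemma compact_unit_interval: "compact_space unit_interval"
  by (simp add: compact_space_subtopology)

lemma Hausdorff_unit_interval: "Hausdorff_space unit_interval"
  by (simp add: Hausdorff_space_subtopology)

lemma continuous_map_comp:
  "continuous_map B C g \<Longrightarrow> continuous_map A B f \<Longrightarrow> continuous_map A C (\<lambda>x. g (f x))"
  using continuous_map_compose[of A B f C g] by (simp add: o_def)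

lemma continuous_map_unit_intervalD:
  "continuous_map A unit_interval f \<Longrightarrow> continuous_map A euclideanreal f"
  by (rule continuous_map_into_fulltopology)

lemma continuous_map_unit_intervalI:
  "continuous_map A euclideanreal f \<Longrightarrow> (\<And>x. x \<in> topspace A \<Longrightarrow> 0 \<le> f x \<and> f x \<le> 1)
    \<Longrightarrow> continuous_map A unit_interval f"
  by (rule continuous_map_into_subtopology) auto

primrec min_coord :: "nat \<Rightarrow> (nat \<Rightarrow> real) \<Rightarrow> real" where
  "min_coord 0 x = x 0"
| "min_coord (Suc k) x = min (min_coord k x) (x (Suc k))"

lemma min_coord_le: "i \<le> k \<Longrightarrow> min_coord k x \<le> x i"
  by (induction k) (auto simp: le_Suc_eq)

lemma min_coord_attained: "\<exists>i\<le>k. min_coord k x = x i"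
proof (induction k)
  case (Suc k)
  then show ?case by (cases "min_coord k x \<le> x (Suc k)") (auto simp: min_def intro: le_SucI)
qed auto

lemma continuous_map_min_coord:
  "(\<And>i. continuous_map A euclideanreal (\<lambda>x. f x i)) \<Longrightarrow> continuous_map A euclideanreal (\<lambda>x. min_coord k (f x))"
  by (induction k) (auto intro: continuous_map_real_min)

text \<open>
  The retraction of \<open>\<Delta>\<^sup>k \<times> [0,1]\<close> onto \<open>\<Delta>\<^sup>k \<times> {0} \<union> \<partial>\<Delta>\<^sup>k \<times> [0,1]\<close> is the projection from the point
  at height \<open>2\<close> above the barycentre. The value \<open>\<rho> x = 1 - (k + 1) * min_coord k x\<close> is the radial
  coordinate of \<open>x\<close>, which is \<open>0\<close> at the barycentre and \<open>1\<close> on the boundary.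
\<close>

lemma simplex_cylinder_retraction:
  obtains r where
    "continuous_map (prod_topology (simplex_space k) unit_interval) (prod_topology (simplex_space k) unit_interval) r"
    "\<And>x u. x \<in> standard_simplex k \<Longrightarrow> u \<in> {0..1} \<Longrightarrow> fst (r (x, u)) \<in> simplex_boundary k \<or> snd (r (x, u)) = 0"
    "\<And>x. x \<in> standard_simplex k \<Longrightarrow> r (x, 0) = (x, 0)"
    "\<And>x u. x \<in> simplex_boundary k \<Longrightarrow> u \<in> {0..1} \<Longrightarrow> r (x, u) = (x, u)"
proof -
  define c where "c = 1 / real (Suc k)"
  define \<rho> where "\<rho> = (\<lambda>x. 1 - real (Suc k) * min_coord k x)"
  \<comment> \<open>The ray from (barycentre, 2) through \<open>(x, u)\<close>, scaled by
    \<open>1 / M\<close>, reaches height 0 for \<open>M = 1 - u / 2\<close> and the wall over the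
    boundary for \<open>M = \<rho> x\<close>. The maximum of the two selects whichever is hit
    first.\<close>
  define M where "M = (\<lambda>(x, u). max (\<rho> x) (1 - u / 2))"
  define X where "X = (\<lambda>(x, u) i. if i \<le> k then c + (x i - c) / M (x, u) else 0)"
  define U where "U = (\<lambda>(x, u). 2 - (2 - u) / M (x, u))"
  let ?P = "prod_topology (simplex_space k) unit_interval"
  have c: "real (Suc k) * c = 1" "0 < c" by (auto simp: c_def)
  have a: "0 \<le> min_coord k x" if "x \<in> standard_simplex k" for x
    using min_coord_attained[of k x] standard_simplex_nonneg[OF that] by metis
  have \<rho>le: "\<rho> x \<le> 1" if "x \<in> standard_simplex k" for x using a[OF that] by (simp add: \<rho>_def)
  have min: "min_coord k x = c - c * \<rho> x" for x
  proof -
    have "c * \<rho> x = c - real (Suc k) * c * min_coord k x" by (simp add: \<rho>_def algebra_simps)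
    then show ?thesis using c(1) by simp
  qed
  have M: "1 / 2 \<le> M (x, u)" "M (x, u) \<le> 1" "\<rho> x \<le> M (x, u)" "1 - u / 2 \<le> M (x, u)"
    if "x \<in> standard_simplex k" "u \<in> {0..1}" for x u
  proof -
    show le: "1 - u / 2 \<le> M (x, u)" "\<rho> x \<le> M (x, u)" by (simp_all add: M_def)
    show "1 / 2 \<le> M (x, u)" using le(1) that by auto
    show "M (x, u) \<le> 1" using that \<rho>le[of x] by (simp add: M_def)
  qed
  have Xin: "X (x, u) \<in> standard_simplex k" if x: "x \<in> standard_simplex k" and u: "u \<in> {0..1}" for x u
  proof (rule standard_simplexI)
    note m = M[OF x u]
    show "0 \<le> X (x, u) i" if i: "i \<le> k" for i
    proof -
      have "c * \<rho> x \<le> c * M (x, u)" using m c by (intro mult_left_mono) auto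
      then have "- c * M (x, u) \<le> x i - c" using min_coord_le[OF i, of x] min[of x] by simp
      then have "- c \<le> (x i - c) / M (x, u)" using m by (simp add: pos_le_divide_eq)
      then show ?thesis using i by (simp add: X_def)
    qed
    show "X (x, u) i = 0" if "k < i" for i using that by (simp add: X_def)
    have "(\<Sum>i\<le>k. X (x, u) i) = (\<Sum>i\<le>k. c + (x i - c) / M (x, u))"
      by (rule sum.cong) (auto simp: X_def)
    also have "\<dots> = real (Suc k) * c + ((\<Sum>i\<le>k. x i) - real (Suc k) * c) / M (x, u)"
      by (simp add: sum.distrib sum_subtractf flip: sum_divide_distrib)
    finally show "(\<Sum>i\<le>k. X (x, u) i) = 1" using standard_simplex_sum[OF x] c(1) by simp
  qed
  have Uin: "0 \<le> U (x, u) \<and> U (x, u) \<le> 1" if x: "x \<in> standard_simplex k" and u: "u \<in> {0..1}" for x u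
  proof -
    note m = M[OF x u]
    have "(2 - u) / M (x, u) \<le> 2" "1 \<le> (2 - u) / M (x, u)"
      using m u by (auto simp: pos_divide_le_eq pos_le_divide_eq)
    then show ?thesis by (simp add: U_def)
  qed
  have cx: "continuous_map ?P euclideanreal (\<lambda>q. fst q i)" for i
    by (rule continuous_map_comp[OF continuous_map_simplex_coordinate continuous_map_fst])
  have cu: "continuous_map ?P euclideanreal snd"
    by (rule continuous_map_unit_intervalD[OF continuous_map_snd])
  have c\<rho>: "continuous_map ?P euclideanreal (\<lambda>q. \<rho> (fst q))"
    unfolding \<rho>_def by (intro continuous_map_diff continuous_map_real_mult_left continuous_map_min_coord cx) simp
  have cM: "continuous_map ?P euclideanreal M"
    unfolding M_def case_prod_unfold
    by (intro continuous_map_real_max c\<rho> continuous_map_diff continuous_map_real_divide cu) auto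
  have M0: "M q \<noteq> 0" if "q \<in> topspace ?P" for q
    using M(1)[of "fst q" "snd q"] that by auto
  have "continuous_map ?P euclideanreal (\<lambda>q. X q i)" for i
  proof (cases "i \<le> k")
    case True
    have "continuous_map ?P euclideanreal (\<lambda>q. c + (fst q i - c) / M q)"
      by (intro continuous_map_add continuous_map_real_divide continuous_map_diff cx cM M0) auto
    then show ?thesis using True by (simp add: X_def case_prod_unfold)
  qed (simp add: X_def case_prod_unfold)
  then have cX: "continuous_map ?P (simplex_space k) X"
    by (rule continuous_map_into_simplex) (use Xin in auto)
  have "continuous_map ?P euclideanreal U"
    unfolding U_def case_prod_unfold
    by (intro continuous_map_diff continuous_map_real_divide) (use cu cM M0 in auto)
  then have cU: "continuous_map ?P unit_interval U"
    by (rule continuous_map_unit_intervalI) (use Uin in auto)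
  have M1: "X (x, u) = x" "U (x, u) = u" if "M (x, u) = 1" "x \<in> standard_simplex k" for x u
    using that standard_simplex_out[OF that(2)] by (auto simp: X_def U_def fun_eq_iff)
  show ?thesis
  proof (rule that[of "\<lambda>q. (X q, U q)"])
    show "continuous_map ?P ?P (\<lambda>q. (X q, U q))" by (rule continuous_map_pairedI[OF cX cU])
    fix x u assume x: "x \<in> standard_simplex k" and u: "u \<in> {0..1::real}"
    note m = M[OF x u]
    consider "M (x, u) = \<rho> x" | "M (x, u) = 1 - u / 2" by (cases "\<rho> x \<le> 1 - u / 2") (auto simp: M_def)
    then show "fst (X (x, u), U (x, u)) \<in> simplex_boundary k \<or> snd (X (x, u), U (x, u)) = 0"
    proof cases
      case 1
      obtain i where i: "i \<le> k" "min_coord k x = x i" using min_coord_attained by blast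
      have "x i - c = - c * M (x, u)" using min[of x] i 1 by simp
      then have "X (x, u) i = 0" using i(1) m(1) by (simp add: X_def)
      then show ?thesis using i(1) Xin[OF x u] by (auto simp: simplex_boundary_def)
    next
      case 2
      then have "2 - u = 2 * M (x, u)" by simp
      then show ?thesis using m(1) by (simp add: U_def)
    qed
  next
    fix x assume x: "x \<in> standard_simplex k"
    have "M (x, 0) = 1" using \<rho>le[OF x] by (simp add: M_def)
    then show "(X (x, 0), U (x, 0)) = (x, 0)" using M1 x by simp
  next
    fix x u assume x: "x \<in> simplex_boundary k" and u: "u \<in> {0..1::real}"
    note xs = simplex_boundary_standard[OF x]
    obtain i where "i \<le> k" "x i = 0" using x by (auto simp: simplex_boundary_def)
    then have "min_coord k x = 0" using min_coord_le[of i k x] a[OF xs] by simp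
    then have "M (x, u) = 1" using u by (simp add: M_def \<rho>_def)
    then show "(X (x, u), U (x, u)) = (x, u)" using M1 xs by simp
  qed
qed

text \<open>The homotopy runs in \<open>u\<close>. The map \<open>F\<close> to start from carries
  its own parameter \<open>q\<close>, because one application extends a deformation of a homotopy.
  On a single cell the cylinder retraction is applied in \<open>u\<close>, with \<open>q\<close>
  carried along.\<close>

lemma (in simplicial_set) realization_homotopy_extension:
  assumes S: "subcomplex X S"
    and F: "continuous_map (prod_topology (realization X) unit_interval) Z F"
    and G: "\<And>k y. y \<in> S k \<Longrightarrow>
      continuous_map (prod_topology (simplex_space k) (prod_topology unit_interval unit_interval)) Z
        (\<lambda>(t, s). G (realization_point X k y t, s))"
    and G0: "\<And>p q. p \<in> realization_of X S \<Longrightarrow> q \<in> {0..1} \<Longrightarrow> G (p, (q, 0)) = F (p, q)"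
  obtains N where
    "continuous_map (prod_topology (realization X) (prod_topology unit_interval unit_interval)) Z N"
    "\<And>p q. p \<in> topspace (realization X) \<Longrightarrow> q \<in> {0..1} \<Longrightarrow> N (p, (q, 0)) = F (p, q)"
    "\<And>p q u. p \<in> realization_of X S \<Longrightarrow> q \<in> {0..1} \<Longrightarrow> u \<in> {0..1} \<Longrightarrow> N (p, (q, u)) = G (p, (q, u))"
proof -
  let ?Q = "prod_topology unit_interval unit_interval"
  let ?R = "\<lambda>p (q, u) z. u = 0 \<longrightarrow> z = F (p, q)"
  have Q: "compact_space ?Q" "Hausdorff_space ?Q"
    unfolding compact_space_prod_topology Hausdorff_space_prod_topology
    using compact_unit_interval Hausdorff_unit_interval by blast+
  have ext: "extends_from_boundary X ?Q Z ?R n y" if y: "nondegenerate X n y" for n y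
    unfolding extends_from_boundary_def
  proof (intro allI impI)
    fix b assume b: "continuous_map (prod_topology (subtopology (simplex_space n) (simplex_boundary n)) ?Q) Z b"
      and Rb: "\<forall>t\<in>simplex_boundary n. \<forall>s\<in>topspace ?Q. ?R (realization_point X n y t) s (b (t, s))"
    have yc: "y \<in> cells X n" using y by (simp add: nondegenerate_def)
    obtain r where r:
      "continuous_map (prod_topology (simplex_space n) unit_interval) (prod_topology (simplex_space n) unit_interval) r"
      "\<And>x u. x \<in> standard_simplex n \<Longrightarrow> u \<in> {0..1} \<Longrightarrow> fst (r (x, u)) \<in> simplex_boundary n \<or> snd (r (x, u)) = 0"
      "\<And>x. x \<in> standard_simplex n \<Longrightarrow> r (x, 0) = (x, 0)"
      "\<And>x u. x \<in> simplex_boundary n \<Longrightarrow> u \<in> {0..1} \<Longrightarrow> r (x, u) = (x, u)"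
      by (rule simplex_cylinder_retraction[of n], rule that) blast+
    let ?P = "prod_topology (simplex_space n) ?Q"
    define rx where "rx = (\<lambda>a :: (nat \<Rightarrow> real) \<times> real \<times> real. fst (r (fst a, snd (snd a))))"
    define ru where "ru = (\<lambda>a :: (nat \<Rightarrow> real) \<times> real \<times> real. snd (r (fst a, snd (snd a))))"
    define f1 where "f1 = (\<lambda>a. b (rx a, (fst (snd a), ru a)))"
    define f2 where "f2 = (\<lambda>a :: (nat \<Rightarrow> real) \<times> real \<times> real. F (realization_point X n y (rx a), fst (snd a)))"
    \<comment> \<open>The retraction lands on the wall, where the boundary map is known, or on the
      bottom, where \<open>F\<close> is known; on their intersection the two agree by
      \<open>Rb\<close>.\<close>
    define \<phi> where "\<phi> = (\<lambda>a. if rx a \<in> simplex_boundary n then f1 a else f2 a)"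
    have cr: "continuous_map ?P (prod_topology (simplex_space n) unit_interval) (\<lambda>a. r (fst a, snd (snd a)))"
      by (rule continuous_map_comp[OF r(1)], rule continuous_map_pairedI[OF continuous_map_fst
            continuous_map_comp[OF continuous_map_snd continuous_map_snd]])
    have crx: "continuous_map ?P (simplex_space n) rx"
      unfolding rx_def by (rule continuous_map_comp[OF continuous_map_fst cr])
    have cru: "continuous_map ?P unit_interval ru"
      unfolding ru_def by (rule continuous_map_comp[OF continuous_map_snd cr])
    have cq: "continuous_map ?P unit_interval (\<lambda>a. fst (snd a))"
      by (rule continuous_map_comp[OF continuous_map_fst continuous_map_snd])
    have rin: "rx a \<in> standard_simplex n" "ru a \<in> {0..1}" "fst (snd a) \<in> {0..1}" if "a \<in> topspace ?P" for a
      using continuous_map_funspace[OF crx] continuous_map_funspace[OF cru] continuous_map_funspace[OF cq] that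
      by auto
    have cover: "rx a \<in> simplex_boundary n \<or> ru a = 0" if "a \<in> topspace ?P" for a
      using r(2)[of "fst a" "snd (snd a)"] that unfolding rx_def ru_def by auto
    define T1 where "T1 = {a \<in> topspace ?P. rx a \<in> simplex_boundary n}"
    define T2 where "T2 = {a \<in> topspace ?P. ru a \<in> {0}}"
    have "continuous_map ?P Z \<phi>"
    proof (rule pasting_lemma_closed[where I = UNIV and T = "\<lambda>i. if i then T1 else T2" and f = "\<lambda>i. if i then f1 else f2"])
      show "finite (UNIV :: bool set)" by simp
      show "closedin ?P (if i then T1 else T2)" for i
        using closedin_continuous_map_preimage[OF crx closedin_simplex_boundary]
          closedin_continuous_map_preimage[OF cru, of "{0}"] by (auto simp: T1_def T2_def)
      have "continuous_map (subtopology ?P T1) (subtopology (simplex_space n) (simplex_boundary n)) rx"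
        by (intro continuous_map_into_subtopology continuous_map_from_subtopology crx) (auto simp: T1_def)
      moreover have "continuous_map (subtopology ?P T1) ?Q (\<lambda>a. (fst (snd a), ru a))"
        by (intro continuous_map_pairedI continuous_map_from_subtopology cq cru)
      ultimately have c1: "continuous_map (subtopology ?P T1) Z f1"
        unfolding f1_def by (rule continuous_map_comp[OF b continuous_map_pairedI])
      have c2: "continuous_map (subtopology ?P T2) Z f2"
        unfolding f2_def
        by (intro continuous_map_comp[OF F] continuous_map_pairedI continuous_map_from_subtopology cq
            continuous_map_comp[OF continuous_map_realization_point[OF yc] crx])
      show "continuous_map (subtopology ?P (if i then T1 else T2)) Z (if i then f1 else f2)" for i
        using c1 c2 by simp
      have agree: "f1 a = f2 a" if "a \<in> T1" "a \<in> T2" for a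
      proof -
        have a: "a \<in> topspace ?P" "rx a \<in> simplex_boundary n" "ru a = 0" using that by (auto simp: T1_def T2_def)
        have "(fst (snd a), ru a) \<in> topspace ?Q" using rin[OF a(1)] by simp
        from Rb[rule_format, OF a(2) this] show ?thesis using a(3) by (simp add: f1_def f2_def)
      qed
      show "(if i then f1 else f2) a = (if j then f1 else f2) a"
        if "a \<in> topspace ?P \<inter> (if i then T1 else T2) \<inter> (if j then T1 else T2)" for i j a
        using that agree[of a] by (auto split: if_splits)
      show "\<exists>j. j \<in> UNIV \<and> a \<in> (if j then T1 else T2) \<and> \<phi> a = (if j then f1 else f2) a"
        if "a \<in> topspace ?P" for a
      proof (cases "rx a \<in> simplex_boundary n")
        case True
        then show ?thesis using that by (intro exI[of _ True]) (simp add: T1_def \<phi>_def)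
      next
        case False
        then show ?thesis using that cover[OF that] by (intro exI[of _ False]) (simp add: T2_def \<phi>_def)
      qed
    qed
    moreover have "\<phi> (t, s) = b (t, s)" if t: "t \<in> simplex_boundary n" and s: "s \<in> topspace ?Q" for t s
    proof -
      have "r (t, snd s) = (t, snd s)" using r(4)[OF t, of "snd s"] s by auto
      then show ?thesis using t by (simp add: \<phi>_def f1_def rx_def ru_def)
    qed
    moreover have "?R (realization_point X n y t) s (\<phi> (t, s))" if t: "t \<in> standard_simplex n" and s: "s \<in> topspace ?Q" for t s
    proof -
      obtain q u where qu: "s = (q, u)" by fastforce
      have "\<phi> (t, (q, 0)) = F (realization_point X n y t, q)"
      proof (cases "t \<in> simplex_boundary n")
        case True
        have "(q, 0) \<in> topspace ?Q" using s qu by auto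
        from Rb[rule_format, OF True this] show ?thesis
          using r(3)[OF t] True by (simp add: \<phi>_def f1_def rx_def ru_def)
      next
        case False
        then show ?thesis using r(3)[OF t] by (simp add: \<phi>_def f2_def rx_def)
      qed
      then show ?thesis using qu by simp
    qed
    ultimately show "\<exists>\<phi>. continuous_map ?P Z \<phi> \<and>
        (\<forall>t\<in>simplex_boundary n. \<forall>s\<in>topspace ?Q. \<phi> (t, s) = b (t, s)) \<and>
        (\<forall>t\<in>standard_simplex n. \<forall>s\<in>topspace ?Q. ?R (realization_point X n y t) s (\<phi> (t, s)))"
      by blast
  qed
  have loc: "locally_compact_space ?Q" using Q by (simp add: compact_imp_locally_compact_space)
  have RG: "?R p s (G (p, s))" if "p \<in> realization_of X S" "s \<in> topspace ?Q" for p s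
    using G0[OF that(1)] that(2) by (auto split: prod.splits)
  obtain N where N: "continuous_map (prod_topology (realization X) ?Q) Z N"
    "\<And>p s. p \<in> realization_of X S \<Longrightarrow> s \<in> topspace ?Q \<Longrightarrow> N (p, s) = G (p, s)"
    "\<And>p s. p \<in> topspace (realization X) \<Longrightarrow> s \<in> topspace ?Q \<Longrightarrow> ?R p s (N (p, s))"
    using realization_extend[OF S loc Q(2) G, of ?R, OF _ RG ext] by blast
  show ?thesis
  proof (rule that[OF N(1)])
    show "N (p, (q, 0)) = F (p, q)" if "p \<in> topspace (realization X)" "q \<in> {0..1}" for p q
      using N(3)[OF that(1), of "(q, 0)"] that(2) by simp
    show "N (p, (q, u)) = G (p, (q, u))" if "p \<in> realization_of X S" "q \<in> {0..1}" "u \<in> {0..1}" for p q u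
      using N(2)[OF that(1), of "(q, u)"] that(2,3) by simp
  qed
qed

text \<open>
  A homotopy inverse \<open>g\<close> is first corrected to \<open>g'\<close> with \<open>g' = id\<close> on \<open>|X|\<close>. If \<open>L\<close> is a homotopy from the
  identity to \<open>g'\<close>, then following \<open>L\<close> at \<open>p\<close> and then \<open>L\<close> at \<open>g' p\<close> backwards is a homotopy \<open>M\<close> between the
  same maps whose restriction to \<open>|X|\<close> contracts rel endpoints to the constant one. Extend this
  contraction to \<open>|Y|\<close>, and go around the other three sides of the square of parameters.
\<close>

lemma (in simplicial_map) strong_deformation:
  assumes inj: "\<And>k. inj_on (f k) (cells X k)"
    and equiv: "homotopy_equivalence_map (realization X) (realization Y) (realization_map Y f)"
  obtains H where "continuous_map (prod_topology (realization Y) unit_interval) (realization Y) H"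
    "\<And>p. p \<in> topspace (realization Y) \<Longrightarrow> H (p, 0) = p"
    "\<And>p. p \<in> topspace (realization Y) \<Longrightarrow> H (p, 1) \<in> realization_of Y (\<lambda>k. f k ` cells X k)"
    "\<And>p s. p \<in> realization_of Y (\<lambda>k. f k ` cells X k) \<Longrightarrow> s \<in> {0..1} \<Longrightarrow> H (p, s) = p"
proof -
  let ?X = "realization X" and ?Y = "realization Y" and ?I = unit_interval
  define i where "i = realization_map Y f"
  define S where "S = (\<lambda>k. f k ` cells X k)"
  define j where "j = inv_into (topspace ?X) i"
  have S: "subcomplex Y S" unfolding S_def by (rule subcomplex_image)
  have im: "realization_of Y S = i ` topspace ?X" unfolding S_def i_def by (rule realization_map_image[symmetric])
  have ci: "continuous_map ?X ?Y i" unfolding i_def by (rule continuous_map_realization_map)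
  have ji: "j (i x) = x" if "x \<in> topspace ?X" for x
    unfolding j_def using inv_into_f_f[OF inj_on_realization_map[OF inj]] that unfolding i_def by blast
  have Ssub: "realization_of Y S \<subseteq> topspace ?Y"
    using im continuous_map_image_subset_topspace[OF ci] by simp
  have ipt: "i (realization_point X k x t) = realization_point Y k (f k x) t" if "x \<in> cells X k" "t \<in> standard_simplex k" for k x t
    unfolding i_def using realization_map_point[OF that] .
  obtain g where g: "continuous_map ?Y ?X g" "homotopic_with (\<lambda>_. True) ?X ?X (g \<circ> i) id"
    "homotopic_with (\<lambda>_. True) ?Y ?Y (i \<circ> g) id"
    using equiv unfolding homotopy_equivalence_map_def i_def by blast
  obtain K where K: "continuous_map (prod_topology ?I ?X) ?X K" "\<And>x. K (0, x) = g (i x)" "\<And>x. K (1, x) = x"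
    using g(2) unfolding homotopic_with_def by auto
  \<comment> \<open>The homotopy \<open>K\<close> from \<open>g \<circ> i\<close> to the identity is
    transported to the image of \<open>i\<close> and extended with start \<open>g\<close>; both
    given maps are constant in \<open>q\<close>. Time 1 is the corrected inverse
    \<open>g'\<close>.\<close>
  obtain N1 where N1: "continuous_map (prod_topology ?Y (prod_topology ?I ?I)) ?X N1"
    "\<And>p q. p \<in> topspace ?Y \<Longrightarrow> q \<in> {0..1} \<Longrightarrow> N1 (p, (q, 0)) = g p"
    "\<And>p q u. p \<in> realization_of Y S \<Longrightarrow> q \<in> {0..1} \<Longrightarrow> u \<in> {0..1} \<Longrightarrow> N1 (p, (q, u)) = K (u, j p)"
  proof (rule target.realization_homotopy_extension[OF S, where F = "\<lambda>(p, q). g p" and G = "\<lambda>(p, (q, u)). K (u, j p)" and Z = ?X])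
    show "continuous_map (prod_topology ?Y ?I) ?X (\<lambda>(p, q). g p)"
      unfolding case_prod_unfold by (rule continuous_map_comp[OF g(1) continuous_map_fst])
    fix k y assume "y \<in> S k"
    then obtain x where x: "x \<in> cells X k" "y = f k x" by (auto simp: S_def)
    let ?P = "prod_topology (simplex_space k) (prod_topology ?I ?I)"
    have "continuous_map ?P ?X (\<lambda>a. K (snd (snd a), realization_point X k x (fst a)))"
      by (intro continuous_map_comp[OF K(1)] continuous_map_pairedI continuous_map_comp[OF continuous_map_snd continuous_map_snd]
          continuous_map_comp[OF continuous_map_realization_point[OF x(1)] continuous_map_fst])
    then show "continuous_map ?P ?X (\<lambda>(t, s). (\<lambda>(p, (q, u)). K (u, j p)) (realization_point Y k y t, s))"
      by (rule continuous_map_eq)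
        (use x ipt ji[OF realization_point_in] in \<open>auto simp flip: ipt\<close>)
  qed (use im ji K in auto)
  define g' where "g' = (\<lambda>p. N1 (p, (0, 1)))"
  have cg': "continuous_map ?Y ?X g'"
    unfolding g'_def
    by (intro continuous_map_comp[OF N1(1)] continuous_map_pairedI) auto
  have g'i: "g' (i x) = x" if "x \<in> topspace ?X" for x
    using N1(3)[of "i x" 0 1] im that ji K(3) by (simp add: g'_def)
  have gin: "g' p \<in> topspace ?X" if "p \<in> topspace ?Y" for p
    using continuous_map_funspace[OF cg'] that by auto
  have "homotopic_with (\<lambda>_. True) ?Y ?X g g'"
  proof -
    have "continuous_map (prod_topology ?I ?Y) ?X (\<lambda>a. N1 (snd a, (0, fst a)))"
      by (intro continuous_map_comp[OF N1(1)] continuous_map_pairedI continuous_map_fst continuous_map_snd) auto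
    then show ?thesis
      by (subst homotopic_with) (use N1(2) in \<open>auto simp: g'_def\<close>)
  qed
  then have "homotopic_with (\<lambda>_. True) ?Y ?Y (i \<circ> g) (i \<circ> g')"
    by (rule homotopic_with_compose_continuous_map_left[OF _ ci]) simp
  then have "homotopic_with (\<lambda>_. True) ?Y ?Y id (i \<circ> g')"
    using homotopic_with_trans[OF homotopic_with_symD[OF g(3)]] by blast
  then obtain L where L: "continuous_map (prod_topology ?I ?Y) ?Y L" "\<And>p. L (0, p) = p" "\<And>p. L (1, p) = i (g' p)"
    unfolding homotopic_with_def by auto
  \<comment> \<open>The two halves meet at 1/2 because \<open>L\<close> ends in
    \<open>i \<circ> g'\<close> and \<open>g' \<circ> i\<close> is the identity.\<close>
  define M where "M = (\<lambda>a. if snd a \<le> 1 / 2 then L (2 * snd a, fst a) else L (2 - 2 * snd a, i (g' (fst a))))"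
  let ?P = "prod_topology ?Y ?I"
  have cM: "continuous_map ?P ?Y M"
    unfolding M_def
  proof (rule continuous_map_cases_le)
    show cs: "continuous_map ?P euclideanreal snd"
      by (rule continuous_map_unit_intervalD[OF continuous_map_snd])
    show "continuous_map ?P euclideanreal (\<lambda>_. 1 / 2)" by simp
    show "continuous_map (subtopology ?P {a \<in> topspace ?P. snd a \<le> 1 / 2}) ?Y (\<lambda>a. L (2 * snd a, fst a))"
      by (intro continuous_map_comp[OF L(1)] continuous_map_pairedI continuous_map_unit_intervalI
          continuous_map_real_mult_left continuous_map_from_subtopology cs continuous_map_fst) auto
    show "continuous_map (subtopology ?P {a \<in> topspace ?P. 1 / 2 \<le> snd a}) ?Y
        (\<lambda>a. L (2 - 2 * snd a, i (g' (fst a))))"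
      by (intro continuous_map_comp[OF L(1)] continuous_map_pairedI continuous_map_unit_intervalI
          continuous_map_diff continuous_map_real_mult_left continuous_map_from_subtopology cs
          continuous_map_comp[OF ci] continuous_map_comp[OF cg'] continuous_map_fst) auto
    show "L (2 * snd a, fst a) = L (2 - 2 * snd a, i (g' (fst a)))"
      if "a \<in> topspace ?P" "snd a = 1 / 2" for a
    proof -
      have "2 * snd a = 1" "2 - 2 * snd a = 1" using that(2) by auto
      then show ?thesis using that(1) L(3) g'i[OF gin] by auto
    qed
  qed
  \<comment> \<open>On the image of \<open>i\<close>, where \<open>i (g' p) = p\<close>, the
    homotopy \<open>M\<close> runs along \<open>L\<close> up to time 1 and back; the factor
    \<open>1 - u\<close> shortens the excursion until it is constant at
    \<open>u = 1\<close>.\<close>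
  obtain N where N: "continuous_map (prod_topology ?Y (prod_topology ?I ?I)) ?Y N"
    "\<And>p q. p \<in> topspace ?Y \<Longrightarrow> q \<in> {0..1} \<Longrightarrow> N (p, (q, 0)) = M (p, q)"
    "\<And>p q u. p \<in> realization_of Y S \<Longrightarrow> q \<in> {0..1} \<Longrightarrow> u \<in> {0..1} \<Longrightarrow>
      N (p, (q, u)) = L ((1 - u) * min (2 * q) (2 - 2 * q), p)"
  proof (rule target.realization_homotopy_extension[OF S cM,
        where G = "\<lambda>(p, (q, u)). L ((1 - u) * min (2 * q) (2 - 2 * q), p)"])
    fix k y assume "y \<in> S k"
    then have y: "y \<in> cells Y k" using subcomplex_cells[OF S] by blast
    let ?P = "prod_topology (simplex_space k) (prod_topology ?I ?I)"
    have q: "continuous_map ?P euclideanreal (\<lambda>a. fst (snd a))"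
      by (intro continuous_map_unit_intervalD continuous_map_comp[OF continuous_map_fst continuous_map_snd])
    have u: "continuous_map ?P euclideanreal (\<lambda>a. snd (snd a))"
      by (intro continuous_map_unit_intervalD continuous_map_comp[OF continuous_map_snd continuous_map_snd])
    have "continuous_map ?P ?I (\<lambda>a. (1 - snd (snd a)) * min (2 * fst (snd a)) (2 - 2 * fst (snd a)))"
    proof (rule continuous_map_unit_intervalI)
      show "continuous_map ?P euclideanreal (\<lambda>a. (1 - snd (snd a)) * min (2 * fst (snd a)) (2 - 2 * fst (snd a)))"
        by (intro continuous_map_real_mult continuous_map_diff continuous_map_real_min continuous_map_real_mult_left q u) auto
      fix a assume "a \<in> topspace ?P"
      then have "0 \<le> 1 - snd (snd a)" "1 - snd (snd a) \<le> 1" "0 \<le> min (2 * fst (snd a)) (2 - 2 * fst (snd a))"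
        "min (2 * fst (snd a)) (2 - 2 * fst (snd a)) \<le> 1" by auto
      then show "0 \<le> (1 - snd (snd a)) * min (2 * fst (snd a)) (2 - 2 * fst (snd a)) \<and>
          (1 - snd (snd a)) * min (2 * fst (snd a)) (2 - 2 * fst (snd a)) \<le> 1"
        by (intro conjI mult_nonneg_nonneg mult_le_one)
    qed
    then show "continuous_map ?P ?Y
        (\<lambda>(t, s). (\<lambda>(p, (q, u)). L ((1 - u) * min (2 * q) (2 - 2 * q), p)) (realization_point Y k y t, s))"
      unfolding case_prod_unfold fst_conv snd_conv
      by (intro continuous_map_comp[OF L(1)] continuous_map_pairedI
          continuous_map_comp[OF continuous_map_realization_point[OF y]] continuous_map_fst)
  next
    fix p q assume p: "p \<in> realization_of Y S" and q: "q \<in> {0..1::real}"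
    have "i (g' p) = p" using p im g'i by auto
    then show "(\<lambda>(p, (q, u)). L ((1 - u) * min (2 * q) (2 - 2 * q), p)) (p, (q, 0)) = M (p, q)"
      by (auto simp: M_def min_def)
  qed simp
  \<comment> \<open>\<open>(a s, b s)\<close> runs in thirds from (0,0) over (0,1) and (1,1) to
    (1,0). On these three sides the time fed to \<open>L\<close> over the image of \<open>i\<close>
    is 0, so the image stays fixed, while the end points keep the values of
    \<open>M\<close>.\<close>
  define a where "a = (\<lambda>s :: real. max 0 (min 1 (3 * s - 1)))"
  define b where "b = (\<lambda>s :: real. max 0 (min 1 (min (3 * s) (3 - 3 * s))))"
  have ab: "a s \<in> {0..1}" "b s \<in> {0..1}" for s by (auto simp: a_def b_def)
  show ?thesis
  proof (rule that[of "\<lambda>c. N (fst c, (a (snd c), b (snd c)))"])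
    have cs: "continuous_map ?P euclideanreal snd"
      by (rule continuous_map_unit_intervalD[OF continuous_map_snd])
    have "continuous_map ?P ?I (\<lambda>c. a (snd c))"
    proof (rule continuous_map_unit_intervalI)
      show "continuous_map ?P euclideanreal (\<lambda>c. a (snd c))"
        unfolding a_def by (intro continuous_map_real_max continuous_map_real_min continuous_map_diff
            continuous_map_real_mult_left cs) auto
    qed (use ab in auto)
    moreover have "continuous_map ?P ?I (\<lambda>c. b (snd c))"
    proof (rule continuous_map_unit_intervalI)
      show "continuous_map ?P euclideanreal (\<lambda>c. b (snd c))"
        unfolding b_def by (intro continuous_map_real_max continuous_map_real_min continuous_map_diff
            continuous_map_real_mult_left cs) auto
    qed (use ab in auto)
    ultimately show "continuous_map ?P ?Y (\<lambda>c. N (fst c, (a (snd c), b (snd c))))"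
      by (intro continuous_map_comp[OF N(1)] continuous_map_pairedI continuous_map_fst)
    fix p assume p: "p \<in> topspace ?Y"
    have v: "a 0 = 0" "b 0 = 0" "a 1 = 1" "b 1 = 0" by (auto simp: a_def b_def)
    show "N (fst (p, 0), (a (snd (p, 0)), b (snd (p, 0)))) = p"
      using N(2)[OF p, of 0] v by (simp add: M_def L(2))
    have "N (p, (1, 0)) = i (g' p)" using N(2)[OF p, of 1] by (simp add: M_def L(2))
    then show "N (fst (p, 1), (a (snd (p, 1)), b (snd (p, 1)))) \<in> realization_of Y (\<lambda>k. f k ` cells X k)"
      using v gin[OF p] im by (simp add: S_def)
  next
    fix p and s :: real assume p: "p \<in> realization_of Y (\<lambda>k. f k ` cells X k)" and s: "s \<in> {0..1}"
    have "a s = 0 \<or> a s = 1 \<or> b s = 1" using s by (auto simp: a_def b_def max_def min_def)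
    then have "(1 - b s) * min (2 * a s) (2 - 2 * a s) = 0" by auto
    then have "L ((1 - b s) * min (2 * a s) (2 - 2 * a s), p) = p" by (simp only: L(2))
    then show "N (fst (p, s), (a (snd (p, s)), b (snd (p, s)))) = p"
      using N(3)[of p "a s" "b s"] p ab by (simp add: S_def)
  qed
qed

section \<open>Realization of quotients of powers\<close>

text \<open>The image only has to be preserved, not fixed pointwise: a tuple with one entry in the
  subspace may have its other entries moved. Closedness makes \<open>i\<close> an embedding, so that
  its inverse on the image is continuous.\<close>

lemma homotopy_equivalence_map_deformation:
  assumes i: "continuous_map A B i" "closed_map A B i" "inj_on i (topspace A)"
    and G: "continuous_map (prod_topology B unit_interval) B G"
    and G0: "\<And>b. b \<in> topspace B \<Longrightarrow> G (b, 0) = b"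
    and G1: "\<And>b. b \<in> topspace B \<Longrightarrow> G (b, 1) \<in> i ` topspace A"
    and GA: "\<And>b s. b \<in> i ` topspace A \<Longrightarrow> s \<in> {0..1} \<Longrightarrow> G (b, s) \<in> i ` topspace A"
  shows "homotopy_equivalence_map A B i"
proof -
  let ?S = "i ` topspace A"
  have "homeomorphic_map A (subtopology B ?S) i"
    using injective_closed_imp_embedding_map[OF i] by (simp add: embedding_map_def)
  then obtain r where r: "homeomorphic_maps A (subtopology B ?S) i r"
    by (auto simp: homeomorphic_map_maps)
  have cr: "continuous_map (subtopology B ?S) A r" and ri: "\<And>a. a \<in> topspace A \<Longrightarrow> r (i a) = a"
    using r by (auto simp: homeomorphic_maps_def)
  have Ssub: "?S \<subseteq> topspace B" using continuous_map_image_subset_topspace[OF i(1)] .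
  have ir: "i (r b) = b" if "b \<in> ?S" for b using that ri by auto
  have cG1: "continuous_map B B (\<lambda>b. G (b, 1))"
    by (intro continuous_map_comp[OF G] continuous_map_pairedI) auto
  define g where "g = (\<lambda>b. r (G (b, 1)))"
  have cg: "continuous_map B A g"
    unfolding g_def
    by (intro continuous_map_comp[OF cr] continuous_map_into_subtopology cG1) (use G1 in auto)
  have "homotopic_with (\<lambda>_. True) A A id (g \<circ> i)"
  proof -
    have "continuous_map (prod_topology unit_interval A) B (\<lambda>a. G (i (snd a), fst a))"
      by (intro continuous_map_comp[OF G] continuous_map_pairedI continuous_map_fst
          continuous_map_comp[OF i(1)] continuous_map_snd)
    then have "continuous_map (prod_topology unit_interval A) A (\<lambda>a. r (G (i (snd a), fst a)))"
      by (intro continuous_map_comp[OF cr] continuous_map_into_subtopology) (use GA in auto)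
    moreover have "i a \<in> topspace B" if "a \<in> topspace A" for a using that Ssub by blast
    ultimately show ?thesis
      by (subst homotopic_with, simp, intro exI[of _ "\<lambda>a. r (G (i (snd a), fst a))"]) (simp add: G0 ri g_def)
  qed
  moreover have "homotopic_with (\<lambda>_. True) B B id (i \<circ> g)"
  proof -
    have "continuous_map (prod_topology unit_interval B) B (\<lambda>a. G (snd a, fst a))"
      by (intro continuous_map_comp[OF G] continuous_map_pairedI continuous_map_fst continuous_map_snd)
    moreover have "i (r (G (b, 1))) = G (b, 1)" if "b \<in> topspace B" for b
      by (rule ir[OF G1[OF that]])
    ultimately show ?thesis
      by (subst homotopic_with, simp, intro exI[of _ "\<lambda>a. G (snd a, fst a)"]) (simp add: G0 g_def)
  qed
  ultimately show ?thesis
    unfolding homotopy_equivalence_map_def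
    by (intro conjI exI[of _ g] i(1) cg) (rule homotopic_with_symD, assumption)+
qed

section \<open>Simultaneous refinement of finitely many points\<close>

text \<open>\<open>E\<close> is a finite stock of tuples that serves all \<open>n\<close>-tuples of
  points in the closed cells of \<open>D\<close> at once. Its finiteness is what the continuity
  proof for tuples needs.\<close>

definition refining_cells ::
    "'a sset \<Rightarrow> (nat \<times> 'a) set \<Rightarrow> nat \<Rightarrow> (nat \<times> 'a list) set \<Rightarrow> bool" where
  "refining_cells X D n E \<longleftrightarrow> finite E \<and>
    (\<forall>m xs. (m, xs) \<in> E \<longrightarrow> length xs = n \<and> set xs \<subseteq> cells X m) \<and>
    (\<forall>ps. length ps = n \<longrightarrow>
      (\<forall>p\<in>set ps. \<exists>k x t. (k, x) \<in> D \<and> t \<in> standard_simplex k \<and> p = realization_point X k x t) \<longrightarrow>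
      (\<exists>m xs u. (m, xs) \<in> E \<and> u \<in> open_simplex m \<and> ps = map (\<lambda>x. realization_point X m x u) xs))"

lemma refining_cellsD:
  assumes "refining_cells X D n E"
  shows "finite E"
    "\<And>m xs. (m, xs) \<in> E \<Longrightarrow> length xs = n \<and> set xs \<subseteq> cells X m"
    "\<And>ps. length ps = n \<Longrightarrow>
      (\<And>p. p \<in> set ps \<Longrightarrow> \<exists>k x t. (k, x) \<in> D \<and> t \<in> standard_simplex k \<and> p = realization_point X k x t) \<Longrightarrow>
      \<exists>m xs u. (m, xs) \<in> E \<and> u \<in> open_simplex m \<and> ps = map (\<lambda>x. realization_point X m x u) xs"
proof -
  show "finite E" using assms unfolding refining_cells_def by (rule conjunct1)
  show "length xs = n \<and> set xs \<subseteq> cells X m" if "(m, xs) \<in> E" for m xs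
    using assms that unfolding refining_cells_def by blast
  fix ps :: "((nat \<times> 'a) \<times> (nat \<Rightarrow> real)) set list"
  assume *: "length ps = n"
    "\<And>p. p \<in> set ps \<Longrightarrow> \<exists>k x t. (k, x) \<in> D \<and> t \<in> standard_simplex k \<and> p = realization_point X k x t"
  show "\<exists>m xs u. (m, xs) \<in> E \<and> u \<in> open_simplex m \<and> ps = map (\<lambda>x. realization_point X m x u) xs"
    by (rule assms[unfolded refining_cells_def, THEN conjunct2, THEN conjunct2, rule_format, OF *(1)])
      (rule *(2))
qed

context simplicial_set
begin

text \<open>The first point is refined against the tuple already obtained for the others. The bound
  \<open>r \<le> k + m\<close> and the finiteness of each set of operators keep the stock
  finite.\<close>

lemma common_refinement_finite:
  assumes "finite D" "\<And>k x. (k, x) \<in> D \<Longrightarrow> x \<in> cells X k"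
  obtains E where "refining_cells X D n E"
proof (induction n arbitrary: thesis)
  case 0
  \<comment> \<open>The empty tuple is represented over the only point of the 0-simplex.\<close>
  have "(\<lambda>j. if j = 0 then 1 else 0) \<in> open_simplex 0"
    by (simp add: open_simplex_def standard_simplex_0)
  then show ?case by (intro "0.prems"[of "{(0, [])}"]) (auto simp: refining_cells_def)
next
  case (Suc n)
  obtain E where "refining_cells X D n E" by (rule Suc.IH)
  note E = refining_cellsD[OF this]
  define E' where "E' = (\<Union>(k, x)\<in>D. \<Union>(m, xs)\<in>E. \<Union>r\<in>{..k + m}. \<Union>\<alpha>\<in>simplex_maps r k. \<Union>\<beta>\<in>simplex_maps r m.
      {(r, act X r k \<alpha> x # map (act X r m \<beta>) xs)})"
  have "finite E'"
    unfolding E'_def using assms(1) E(1) finite_simplex_maps by (auto intro!: finite_UN_I split: prod.splits)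
  moreover have "length ys = Suc n \<and> set ys \<subseteq> cells X r" if rys: "(r, ys) \<in> E'" for r ys
  proof -
    obtain k x m xs \<alpha> \<beta> where *: "(k, x) \<in> D" "(m, xs) \<in> E" "\<alpha> \<in> simplex_maps r k" "\<beta> \<in> simplex_maps r m"
      "ys = act X r k \<alpha> x # map (act X r m \<beta>) xs"
      using rys unfolding E'_def by auto
    then show ?thesis
      using E(2)[OF *(2)] assms(2)[OF *(1)] act_closed[OF *(3)] act_closed[OF *(4)] by auto
  qed
  moreover have "\<exists>m xs u. (m, xs) \<in> E' \<and> u \<in> open_simplex m \<and> ps = map (\<lambda>x. realization_point X m x u) xs"
    if len: "length ps = Suc n"
      and ps: "\<forall>p\<in>set ps. \<exists>k x t. (k, x) \<in> D \<and> t \<in> standard_simplex k \<and> p = realization_point X k x t" for ps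
  proof -
    obtain p ps' where pp: "ps = p # ps'" "length ps' = n" using len by (cases ps) auto
    obtain k x t where x: "(k, x) \<in> D" "t \<in> standard_simplex k" "p = realization_point X k x t"
      using ps pp(1) by auto
    obtain m xs u where xs: "(m, xs) \<in> E" "u \<in> open_simplex m" "ps' = map (\<lambda>x. realization_point X m x u) xs"
      using E(3)[OF pp(2)] ps pp(1) by (metis list.set_intros(2))
    obtain r w \<alpha> \<beta> where w: "r \<le> k + m" "w \<in> open_simplex r" "\<alpha> \<in> simplex_maps r k"
      "\<beta> \<in> simplex_maps r m" "simplex_push r \<alpha> w = t" "simplex_push r \<beta> w = u"
      using simplex_refinement[OF x(2) open_simplex_standard[OF xs(2)]] .
    note ws = open_simplex_standard[OF w(2)]
    have "(r, act X r k \<alpha> x # map (act X r m \<beta>) xs) \<in> E'"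
      unfolding E'_def using x(1) xs(1) w by force
    moreover have "ps = map (\<lambda>x. realization_point X r x w) (act X r k \<alpha> x # map (act X r m \<beta>) xs)"
      using realization_point_act[OF w(3) assms(2)[OF x(1)] ws] realization_point_act[OF w(4) _ ws]
        E(2)[OF xs(1)] w x xs pp by (auto simp: subset_iff)
    ultimately show ?thesis using w(2) by blast
  qed
  ultimately have "refining_cells X D (Suc n) E'" unfolding refining_cells_def by blast
  then show ?case by (rule Suc.prems)
qed

text \<open>One closed cell is chosen for each point; the stock for these finitely many cells
  contains the required tuple. So a tuple of points of a realization is a point of the realization
  of the power.\<close>

lemma common_refinement:
  assumes "set ps \<subseteq> topspace (realization X)"
  obtains m xs u where "u \<in> open_simplex m" "length xs = length ps" "set xs \<subseteq> cells X m"
    "ps = map (\<lambda>x. realization_point X m x u) xs"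
proof -
  define D where "D = (\<lambda>p. SOME d. snd d \<in> cells X (fst d) \<and>
    (\<exists>t\<in>standard_simplex (fst d). p = realization_point X (fst d) (snd d) t)) ` set ps"
  have d: "\<exists>k x t. (k, x) \<in> D \<and> x \<in> cells X k \<and> t \<in> standard_simplex k \<and> p = realization_point X k x t"
    if "p \<in> set ps" for p
  proof -
    let ?P = "\<lambda>d. snd d \<in> cells X (fst d) \<and> (\<exists>t\<in>standard_simplex (fst d). p = realization_point X (fst d) (snd d) t)"
    have "p \<in> topspace (realization X)" using assms that by blast
    then obtain k x t where "x \<in> cells X k" "t \<in> standard_simplex k" "p = realization_point X k x t"
      unfolding topspace_realization by blast
    then have "?P (k, x)" by auto
    then have 1: "?P (SOME d. ?P d)" by (rule someI)
    have 2: "(SOME d. ?P d) \<in> D" unfolding D_def using that by blast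
    obtain l y where ly: "(SOME d. ?P d) = (l, y)" by (cases "SOME d. ?P d")
    from 1 2 show ?thesis unfolding ly by auto
  qed
  have Dc: "x \<in> cells X k" if kx: "(k, x) \<in> D" for k x
  proof -
    obtain p where p: "p \<in> set ps" "(k, x) = (SOME d. snd d \<in> cells X (fst d) \<and>
        (\<exists>t\<in>standard_simplex (fst d). p = realization_point X (fst d) (snd d) t))"
      using kx unfolding D_def by blast
    have "\<exists>d. snd d \<in> cells X (fst d) \<and> (\<exists>t\<in>standard_simplex (fst d). p = realization_point X (fst d) (snd d) t)"
      using d[OF p(1)] by (metis fst_conv snd_conv)
    from someI_ex[OF this] show ?thesis unfolding p(2)[symmetric] by simp
  qed
  obtain E where E: "refining_cells X D (length ps) E"
    by (rule common_refinement_finite[of D, OF _ Dc]) (auto simp: D_def)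
  obtain m xs u where *: "(m, xs) \<in> E" "u \<in> open_simplex m" "ps = map (\<lambda>x. realization_point X m x u) xs"
    using refining_cellsD(3)[OF E refl] d by metis
  show ?thesis by (rule that[OF *(2) _ _ *(3)]) (use refining_cellsD(2)[OF E *(1)] in auto)
qed

end

text \<open>
  \<open>T\<close> is the quotient of \<open>Y\<^sup>n\<close> by permutations in which moreover all cells with some factor in \<open>B\<close> are
  identified: \<open>B = \<emptyset>\<close> gives the symmetric power, and the base point gives the symmetric smash power.
\<close>

locale power_quotient = source: simplicial_set Y + target: simplicial_set T
  for Y :: "'a sset" and T :: "'b sset" +
  fixes n :: nat and q :: "nat \<Rightarrow> 'a list \<Rightarrow> 'b" and B :: "nat \<Rightarrow> 'a set"
  assumes q_closed: "\<lbrakk>length w = n; set w \<subseteq> cells Y k\<rbrakk> \<Longrightarrow> q k w \<in> cells T k"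
    and q_natural: "\<lbrakk>\<theta> \<in> simplex_maps m k; length w = n; set w \<subseteq> cells Y k\<rbrakk> \<Longrightarrow>
      q m (map (act Y m k \<theta>) w) = act T m k \<theta> (q k w)"
    and q_surj: "c \<in> cells T k \<Longrightarrow> \<exists>w. length w = n \<and> set w \<subseteq> cells Y k \<and> q k w = c"
    and q_eq_iff: "\<lbrakk>length w = n; set w \<subseteq> cells Y k; length w' = n; set w' \<subseteq> cells Y k\<rbrakk> \<Longrightarrow>
      q k w = q k w' \<longleftrightarrow> mset w = mset w' \<or> (set w \<inter> B k \<noteq> {} \<and> set w' \<inter> B k \<noteq> {})"
    and B: "subcomplex Y B"
begin

text \<open>
  This need not be continuous for the product topology on \<open>|Y|\<^sup>n\<close>, but its composites with maps from
  compact spaces are.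
\<close>

definition realization_quotient ::
    "((nat \<times> 'a) \<times> (nat \<Rightarrow> real)) set list \<Rightarrow> ((nat \<times> 'b) \<times> (nat \<Rightarrow> real)) set" where
  "realization_quotient ps = (SOME c. \<exists>m ys u. u \<in> standard_simplex m \<and> length ys = n \<and> set ys \<subseteq> cells Y m \<and>
     ps = map (\<lambda>y. realization_point Y m y u) ys \<and> c = realization_point T m (q m ys) u)"

text \<open>Two representations of one tuple have, entry by entry, equal pulled-back cells on a
  common refinement of \<open>u\<close> and \<open>u'\<close>; naturality of \<open>q\<close> then
  makes the chosen value independent.\<close>

lemma realization_quotient_point:
  assumes ys: "length ys = n" "set ys \<subseteq> cells Y m" and u: "u \<in> standard_simplex m"
  shows "realization_quotient (map (\<lambda>y. realization_point Y m y u) ys) = realization_point T m (q m ys) u"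
proof -
  let ?ps = "map (\<lambda>y. realization_point Y m y u) ys"
  have "\<exists>m' ys' u'. u' \<in> standard_simplex m' \<and> length ys' = n \<and> set ys' \<subseteq> cells Y m' \<and>
     ?ps = map (\<lambda>y. realization_point Y m' y u') ys' \<and>
     realization_quotient ?ps = realization_point T m' (q m' ys') u'"
    unfolding realization_quotient_def
    by (rule someI[of _ "realization_point T m (q m ys) u"]) (use assms in blast)
  then obtain m' ys' u' where *: "u' \<in> standard_simplex m'" "length ys' = n" "set ys' \<subseteq> cells Y m'"
    "?ps = map (\<lambda>y. realization_point Y m' y u') ys'"
    "realization_quotient ?ps = realization_point T m' (q m' ys') u'"
    by blast
  obtain r w \<alpha> \<beta> where w: "w \<in> open_simplex r" "\<alpha> \<in> simplex_maps r m" "\<beta> \<in> simplex_maps r m'"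
    "simplex_push r \<alpha> w = u" "simplex_push r \<beta> w = u'"
    using simplex_refinement[OF u *(1)] by metis
  note ws = open_simplex_standard[OF w(1)]
  have "map (act Y r m \<alpha>) ys = map (act Y r m' \<beta>) ys'"
  proof (rule nth_equalityI)
    show "length (map (act Y r m \<alpha>) ys) = length (map (act Y r m' \<beta>) ys')" using ys * by simp
    fix i assume "i < length (map (act Y r m \<alpha>) ys)"
    then have i: "i < length ys" "i < length ys'" using ys * by auto
    have "realization_point Y m (ys ! i) u = realization_point Y m' (ys' ! i) u'"
      using arg_cong[OF *(4), of "\<lambda>l. l ! i"] i by simp
    then have "act Y r m \<alpha> (ys ! i) = act Y r m' \<beta> (ys' ! i)"
      by (rule source.realization_point_eqD[OF _ _ u _ *(1) w]) (use i ys * nth_mem in blast)+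
    then show "map (act Y r m \<alpha>) ys ! i = map (act Y r m' \<beta>) ys' ! i" using i by simp
  qed
  then have "act T r m \<alpha> (q m ys) = act T r m' \<beta> (q m' ys')"
    using q_natural[OF w(2) ys] q_natural[OF w(3) *(2,3)] by simp
  then show ?thesis
    using target.realization_point_act[OF w(2) q_closed[OF ys] ws]
      target.realization_point_act[OF w(3) q_closed[OF *(2,3)] ws] w *(5) by simp
qed

lemma realization_quotient_in:
  assumes "length ps = n" "set ps \<subseteq> topspace (realization Y)"
  shows "realization_quotient ps \<in> topspace (realization T)"
proof -
  obtain m ys u where *: "u \<in> open_simplex m" "length ys = length ps" "set ys \<subseteq> cells Y m"
    "ps = map (\<lambda>y. realization_point Y m y u) ys"
    using source.common_refinement[OF assms(2)] .
  note us = open_simplex_standard[OF *(1)]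
  have "realization_quotient ps = realization_point T m (q m ys) u"
    unfolding *(4) by (rule realization_quotient_point) (use * assms us in auto)
  then show ?thesis
    using realization_point_in[OF q_closed us] * assms by simp
qed

lemma realization_quotient_surj:
  assumes "c \<in> topspace (realization T)"
  obtains ps where "length ps = n" "set ps \<subseteq> topspace (realization Y)" "realization_quotient ps = c"
proof -
  obtain k z t where z: "z \<in> cells T k" "t \<in> standard_simplex k" "c = realization_point T k z t"
    using assms unfolding topspace_realization by blast
  obtain w where w: "length w = n" "set w \<subseteq> cells Y k" "q k w = z" using q_surj[OF z(1)] by blast
  show ?thesis
  proof (rule that)
    show "realization_quotient (map (\<lambda>y. realization_point Y k y t) w) = c"
      using realization_quotient_point[OF w(1,2) z(2)] w(3) z(3) by simp
  qed (use w z in \<open>auto simp: subset_iff intro: realization_point_in\<close>)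
qed

lemma set_refinement_meets:
  assumes S: "subcomplex Y S" and u: "u \<in> open_simplex m" and ys: "set ys \<subseteq> cells Y m"
  shows "set (map (\<lambda>y. realization_point Y m y u) ys) \<inter> realization_of Y S \<noteq> {} \<longleftrightarrow> set ys \<inter> S m \<noteq> {}"
proof
  assume "set (map (\<lambda>y. realization_point Y m y u) ys) \<inter> realization_of Y S \<noteq> {}"
  then obtain y where "y \<in> set ys" "realization_point Y m y u \<in> realization_of Y S" by auto
  then show "set ys \<inter> S m \<noteq> {}" using source.realization_of_open[OF S u] ys by blast
next
  assume "set ys \<inter> S m \<noteq> {}"
  then obtain y where y: "y \<in> set ys" "y \<in> S m" by blast
  then have "realization_point Y m y u \<in> realization_of Y S"
    using open_simplex_standard[OF u] unfolding realization_of_def by blast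
  then show "set (map (\<lambda>y. realization_point Y m y u) ys) \<inter> realization_of Y S \<noteq> {}" using y by auto
qed

text \<open>Over one common interior point, equality of points is equality of cells in
  \<open>Y\<close> and in \<open>T\<close> alike, so the claim is \<open>q_eq_iff\<close>
  transported.\<close>

lemma realization_quotient_eq_iff:
  assumes ps: "length ps = n" "set ps \<subseteq> topspace (realization Y)"
    and ps': "length ps' = n" "set ps' \<subseteq> topspace (realization Y)"
  shows "realization_quotient ps = realization_quotient ps' \<longleftrightarrow>
    mset ps = mset ps' \<or> (set ps \<inter> realization_of Y B \<noteq> {} \<and> set ps' \<inter> realization_of Y B \<noteq> {})"
proof -
  \<comment> \<open>Refining the concatenation puts both tuples over the same
    \<open>u\<close>.\<close>
  have "set (ps @ ps') \<subseteq> topspace (realization Y)" using ps ps' by simp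
  then obtain m zs u where *: "u \<in> open_simplex m" "length zs = length (ps @ ps')" "set zs \<subseteq> cells Y m"
    "ps @ ps' = map (\<lambda>y. realization_point Y m y u) zs"
    by (rule source.common_refinement)
  define ys where "ys = take n zs"
  define ys' where "ys' = drop n zs"
  let ?f = "\<lambda>y. realization_point Y m y u"
  have lz: "length zs = n + n" using *(2) ps ps' by simp
  have "ps = take n (ps @ ps')" "ps' = drop n (ps @ ps')" using ps(1) by auto
  then have eq: "ps = map ?f ys" "ps' = map ?f ys'" unfolding ys_def ys'_def *(4) take_map drop_map by auto
  have ys: "length ys = n" "set ys \<subseteq> cells Y m" "ps = map ?f ys"
    using lz *(3) set_take_subset[of n zs] eq(1) by (auto simp: ys_def)
  have ys': "length ys' = n" "set ys' \<subseteq> cells Y m" "ps' = map ?f ys'"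
    using lz *(3) set_drop_subset[of n zs] eq(2) by (auto simp: ys'_def)
  note us = open_simplex_standard[OF *(1)]
  have inj: "inj_on ?f (cells Y m)"
    using source.realization_point_open_inj[OF *(1)] by (auto intro: inj_onI)
  have "realization_quotient ps = realization_quotient ps' \<longleftrightarrow>
      realization_point T m (q m ys) u = realization_point T m (q m ys') u"
    unfolding ys(3) ys'(3) using realization_quotient_point ys(1,2) ys'(1,2) us by simp
  also have "\<dots> \<longleftrightarrow> q m ys = q m ys'"
    using target.realization_point_open_inj[OF *(1) q_closed[OF ys(1,2)] q_closed[OF ys'(1,2)]] by auto
  also have "\<dots> \<longleftrightarrow> mset ys = mset ys' \<or> (set ys \<inter> B m \<noteq> {} \<and> set ys' \<inter> B m \<noteq> {})"
    by (rule q_eq_iff[OF ys(1,2) ys'(1,2)])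
  also have "mset ys = mset ys' \<longleftrightarrow> mset ps = mset ps'"
  proof
    assume "mset ps = mset ps'"
    then have "image_mset ?f (mset ys) = image_mset ?f (mset ys')" by (simp add: ys(3) ys'(3))
    then have "image_mset (inv_into (cells Y m) ?f) (image_mset ?f (mset ys)) =
        image_mset (inv_into (cells Y m) ?f) (image_mset ?f (mset ys'))" by simp
    \<comment> \<open>On cells of \<open>Y\<close> the passage to points at \<open>u\<close> is
      injective and can be undone inside the multiset.\<close>
    moreover have "image_mset (inv_into (cells Y m) ?f) (image_mset ?f (mset xs)) = mset xs"
      if "set xs \<subseteq> cells Y m" for xs
    proof -
      have "inv_into (cells Y m) ?f (?f x) = x" if "x \<in> set xs" for x
        by (rule inv_into_f_f[OF inj]) (use that \<open>set xs \<subseteq> cells Y m\<close> in blast)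
      then have "image_mset (inv_into (cells Y m) ?f \<circ> ?f) (mset xs) = image_mset id (mset xs)"
        by (intro image_mset_cong) simp
      then show ?thesis by (simp add: multiset.map_comp)
    qed
    ultimately show "mset ys = mset ys'" using ys(2) ys'(2) by simp
  next
    assume "mset ys = mset ys'"
    then show "mset ps = mset ps'" by (simp add: ys(3) ys'(3))
  qed
  also have "set ys \<inter> B m \<noteq> {} \<longleftrightarrow> set ps \<inter> realization_of Y B \<noteq> {}"
    unfolding ys(3) by (rule set_refinement_meets[OF B *(1) ys(2), symmetric])
  also have "set ys' \<inter> B m \<noteq> {} \<longleftrightarrow> set ps' \<inter> realization_of Y B \<noteq> {}"
    unfolding ys'(3) by (rule set_refinement_meets[OF B *(1) ys'(2), symmetric])
  finally show ?thesis .
qed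

text \<open>
  A compact space only meets finitely many cells, so the preimage of a closed set is a finite union of
  projections of closed subsets of \<open>K \<times> \<Delta>\<^sup>m\<close>.
\<close>

lemma continuous_map_realization_quotient:
  assumes K: "compact_space K" and c: "\<And>i. i < n \<Longrightarrow> continuous_map K (realization Y) (c i)"
  shows "continuous_map K (realization T) (\<lambda>a. realization_quotient (map (\<lambda>i. c i a) [0..<n]))"
proof -
  let ?g = "\<lambda>a. realization_quotient (map (\<lambda>i. c i a) [0..<n])"
  have cin: "c i a \<in> topspace (realization Y)" if "i < n" "a \<in> topspace K" for i a
    using continuous_map_funspace[OF c[OF that(1)]] that(2) by auto
  define A where "A = (\<Union>i<n. c i ` topspace K)"
  have "compactin (realization Y) A"
    unfolding A_def using K c
    by (intro compactin_Union) (auto simp: compact_space_def intro: image_compactin)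
  define D where "D = {(k, y). nondegenerate Y k y \<and> (\<exists>t\<in>open_simplex k. realization_point Y k y t \<in> A)}"
  have "finite D" unfolding D_def by (rule source.compactin_realization_finite[OF \<open>compactin _ A\<close>])
  moreover have "\<And>k y. (k, y) \<in> D \<Longrightarrow> y \<in> cells Y k" by (auto simp: D_def nondegenerate_def)
  ultimately obtain E where "refining_cells Y D n E" by (rule source.common_refinement_finite)
  note E = refining_cellsD[OF this]
  have DA: "\<exists>k x t. (k, x) \<in> D \<and> t \<in> standard_simplex k \<and> p = realization_point Y k x t" if "p \<in> A" for p
  proof -
    have "p \<in> topspace (realization Y)" using that cin by (auto simp: A_def)
    then obtain k y t where *: "nondegenerate Y k y" "t \<in> open_simplex k" "p = realization_point Y k y t"
      by (rule source.realization_point_nondegenerate)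
    then have "(k, y) \<in> D" unfolding D_def using that by blast
    then show ?thesis using * open_simplex_standard by blast
  qed
  show ?thesis
    unfolding continuous_map_closedin
  proof (intro conjI allI impI)
    show "?g \<in> topspace K \<rightarrow> topspace (realization T)"
      using cin by (auto intro!: realization_quotient_in)
    fix C assume C: "closedin (realization T) C"
    \<comment> \<open>Pairs \<open>(a, u)\<close> such that the tuple at \<open>a\<close> is
      represented by \<open>ys\<close> over \<open>u\<close> and its image lies in \<open>C\<close>.
      The coincidence conditions are closed because the realization of \<open>Y\<close> is
      Hausdorff.\<close>
    define V where "V = (\<lambda>(m, ys). {x \<in> topspace (prod_topology K (simplex_space m)).
      realization_point T m (q m ys) (snd x) \<in> C} \<inter>
      (\<Inter>i\<in>{..<n}. {x \<in> topspace (prod_topology K (simplex_space m)). c i (fst x) = realization_point Y m (ys ! i) (snd x)}))"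
    have V: "closedin K (fst ` V e)" if "e \<in> E" for e
    proof -
      obtain m ys where e: "e = (m, ys)" by fastforce
      have ys: "length ys = n" "set ys \<subseteq> cells Y m" using E(2) that e by auto
      let ?P = "prod_topology K (simplex_space m)"
      have "continuous_map ?P (realization T) (\<lambda>x. realization_point T m (q m ys) (snd x))"
        by (rule continuous_map_comp[OF continuous_map_realization_point[OF q_closed[OF ys]] continuous_map_snd])
      then have 1: "closedin ?P {x \<in> topspace ?P. realization_point T m (q m ys) (snd x) \<in> C}"
        using C by (rule closedin_continuous_map_preimage)
      have 2: "closedin ?P {x \<in> topspace ?P. c i (fst x) = realization_point Y m (ys ! i) (snd x)}" if i: "i < n" for i
      proof (rule closedin_continuous_maps_eq[OF source.Hausdorff_realization])
        show "continuous_map ?P (realization Y) (\<lambda>x. c i (fst x))"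
          by (rule continuous_map_comp[OF c[OF i] continuous_map_fst])
        have "ys ! i \<in> cells Y m" using ys i nth_mem by blast
        then show "continuous_map ?P (realization Y) (\<lambda>x. realization_point Y m (ys ! i) (snd x))"
          by (intro continuous_map_comp[OF continuous_map_realization_point continuous_map_snd])
      qed
      have "closedin ?P (V e)"
      \<comment> \<open>The intersection over an empty index set is everything and not a closed set
        of the product.\<close>
      proof (cases "n = 0")
        case True
        then show ?thesis using 1 by (simp add: V_def e)
      next
        case False
        then have "closedin ?P (\<Inter>i\<in>{..<n}. {x \<in> topspace ?P. c i (fst x) = realization_point Y m (ys ! i) (snd x)})"
          using 2 by (intro closedin_Inter) auto
        then show ?thesis unfolding V_def e case_prod_conv by (rule closedin_Int[OF 1])
      qed
      \<comment> \<open>Projection along the compact factor \<open>simplex_space m\<close> is a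
        closed map.\<close>
      then show ?thesis
        using Abstract_Topological_Spaces.closed_map_fst[OF compact_simplex_space, of K m] unfolding closed_map_def by blast
    qed
    have "{a \<in> topspace K. ?g a \<in> C} = (\<Union>e\<in>E. fst ` V e)"
    proof (intro equalityI subsetI)
      fix a assume a: "a \<in> {a \<in> topspace K. ?g a \<in> C}"
      have "\<exists>k x t. (k, x) \<in> D \<and> t \<in> standard_simplex k \<and> p = realization_point Y k x t"
        if "p \<in> set (map (\<lambda>i. c i a) [0..<n])" for p
        using a that by (intro DA) (auto simp: A_def)
      then have "\<exists>m ys u. (m, ys) \<in> E \<and> u \<in> open_simplex m \<and>
          map (\<lambda>i. c i a) [0..<n] = map (\<lambda>x. realization_point Y m x u) ys"
        by (intro E(3)) simp
      then obtain m ys u where *: "(m, ys) \<in> E" "u \<in> open_simplex m"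
        "map (\<lambda>i. c i a) [0..<n] = map (\<lambda>x. realization_point Y m x u) ys"
        by (elim exE conjE)
      note us = open_simplex_standard[OF *(2)]
      have ys: "length ys = n" "set ys \<subseteq> cells Y m" using E(2)[OF *(1)] by auto
      have "c i a = realization_point Y m (ys ! i) u" if "i < n" for i
        using arg_cong[OF *(3), of "\<lambda>l. l ! i"] that ys by simp
      moreover have "?g a = realization_point T m (q m ys) u"
        unfolding *(3) by (rule realization_quotient_point[OF ys us])
      ultimately have "(a, u) \<in> V (m, ys)" using a us by (auto simp: V_def)
      then show "a \<in> (\<Union>e\<in>E. fst ` V e)" using *(1) by force
    next
      fix a assume "a \<in> (\<Union>e\<in>E. fst ` V e)"
      then obtain m ys u where *: "(m, ys) \<in> E" "(a, u) \<in> V (m, ys)" by auto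
      have ys: "length ys = n" "set ys \<subseteq> cells Y m" using E(2)[OF *(1)] by auto
      have a: "a \<in> topspace K" "u \<in> standard_simplex m" "realization_point T m (q m ys) u \<in> C"
        "\<And>i. i < n \<Longrightarrow> c i a = realization_point Y m (ys ! i) u"
        using *(2) by (auto simp: V_def)
      have "map (\<lambda>i. c i a) [0..<n] = map (\<lambda>x. realization_point Y m x u) ys"
        by (rule nth_equalityI) (use a(4) ys in auto)
      then have "?g a = realization_point T m (q m ys) u"
        using realization_quotient_point[OF ys a(2)] by simp
      then show "a \<in> {a \<in> topspace K. ?g a \<in> C}" using a by simp
    qed
    then show "closedin K {a \<in> topspace K. ?g a \<in> C}"
      using V E(1) by (auto intro!: closedin_Union)
  qed
qed

lemma realization_of_quotient:
  assumes S: "subcomplex Y S"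
  shows "realization_of T (\<lambda>k. {q k w | w. length w = n \<and> set w \<subseteq> cells Y k \<and> set w \<inter> S k \<noteq> {}}) =
    {realization_quotient ps | ps. length ps = n \<and> set ps \<subseteq> topspace (realization Y) \<and>
      set ps \<inter> realization_of Y S \<noteq> {}}" (is "?L = ?R")
proof (intro equalityI subsetI)
  fix c assume "c \<in> ?L"
  then obtain k w t where w: "length w = n" "set w \<subseteq> cells Y k" "set w \<inter> S k \<noteq> {}"
    "t \<in> standard_simplex k" "c = realization_point T k (q k w) t"
    unfolding realization_of_def by blast
  obtain y where y: "y \<in> set w" "y \<in> S k" using w(3) by blast
  let ?ps = "map (\<lambda>y. realization_point Y k y t) w"
  have "realization_point Y k y t \<in> set ?ps \<inter> realization_of Y S"
    using y w(4) by (auto simp: realization_of_def)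
  moreover have "c = realization_quotient ?ps" using realization_quotient_point[OF w(1,2,4)] w(5) by simp
  moreover have "length ?ps = n" "set ?ps \<subseteq> topspace (realization Y)"
    using w by (auto simp: subset_iff intro: realization_point_in)
  ultimately show "c \<in> ?R" by blast
next
  fix c assume "c \<in> ?R"
  then obtain ps where ps: "length ps = n" "set ps \<subseteq> topspace (realization Y)"
    "set ps \<inter> realization_of Y S \<noteq> {}" "c = realization_quotient ps" by blast
  obtain m ys u where *: "u \<in> open_simplex m" "length ys = length ps" "set ys \<subseteq> cells Y m"
    "ps = map (\<lambda>y. realization_point Y m y u) ys"
    using source.common_refinement[OF ps(2)] .
  note us = open_simplex_standard[OF *(1)]
  have "set ys \<inter> S m \<noteq> {}" using set_refinement_meets[OF S *(1,3)] ps(3) *(4) by simp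
  moreover have "c = realization_point T m (q m ys) u"
    unfolding ps(4) *(4) by (rule realization_quotient_point) (use * ps us in auto)
  ultimately show "c \<in> ?L" unfolding realization_of_def using * ps(1) us by fastforce
qed

text \<open>\<open>H\<close> applied to every entry commutes with permutations and respects the
  collapse of \<open>B\<close>, so it descends to \<open>T\<close>; this gives the deformation
  required by \<open>homotopy_equivalence_map_deformation\<close>.\<close>

lemma homotopy_equivalence_subquotient:
  assumes n: "n \<ge> 1" and S: "subcomplex Y S" and BS: "\<And>k. B k \<subseteq> S k"
    and H: "continuous_map (prod_topology (realization Y) unit_interval) (realization Y) H"
      "\<And>p. p \<in> topspace (realization Y) \<Longrightarrow> H (p, 0) = p"
      "\<And>p. p \<in> topspace (realization Y) \<Longrightarrow> H (p, 1) \<in> realization_of Y S"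
      "\<And>p s. p \<in> realization_of Y S \<Longrightarrow> s \<in> {0..1} \<Longrightarrow> H (p, s) = p"
    and j: "simplicial_map \<Sigma> T j" "\<And>k. inj_on (j k) (cells \<Sigma> k)"
      "\<And>k. j k ` cells \<Sigma> k = {q k w | w. length w = n \<and> set w \<subseteq> cells Y k \<and> set w \<inter> S k \<noteq> {}}"
  shows "homotopy_equivalence_map (realization \<Sigma>) (realization T) (realization_map T j)"
proof -
  let ?Y = "realization Y" and ?T = "realization T"
  interpret j: simplicial_map \<Sigma> T j by (rule j(1))
  let ?A = "{realization_quotient ps | ps. length ps = n \<and> set ps \<subseteq> topspace ?Y \<and> set ps \<inter> realization_of Y S \<noteq> {}}"
  have im: "realization_map T j ` topspace (realization \<Sigma>) = ?A"
    unfolding j.realization_map_image j(3) by (rule realization_of_quotient[OF S])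
  have Aintro: "realization_quotient xs \<in> ?A"
    if "length xs = n" "set xs \<subseteq> topspace ?Y" "set xs \<inter> realization_of Y S \<noteq> {}" for xs
    using that by blast
  have Hin: "H (p, s) \<in> topspace ?Y" if "p \<in> topspace ?Y" "s \<in> {0..1}" for p s
    using continuous_map_funspace[OF H(1)] that by auto
  have BSr: "realization_of Y B \<subseteq> realization_of Y S" using BS unfolding realization_of_def by blast
  define rep where "rep = (\<lambda>c. SOME ps. length ps = n \<and> set ps \<subseteq> topspace ?Y \<and> realization_quotient ps = c)"
  define G where "G = (\<lambda>(c, s). realization_quotient (map (\<lambda>p. H (p, s)) (rep c)))"
  have G: "G (realization_quotient ps, s) = realization_quotient (map (\<lambda>p. H (p, s)) ps)"
    if ps: "length ps = n" "set ps \<subseteq> topspace ?Y" and s: "s \<in> {0..1}" for ps s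
  proof -
    let ?qs = "rep (realization_quotient ps)"
    have qs: "length ?qs = n \<and> set ?qs \<subseteq> topspace ?Y \<and> realization_quotient ?qs = realization_quotient ps"
      unfolding rep_def by (rule someI[of _ ps]) (use ps in simp)
    then have alt: "mset ?qs = mset ps \<or> (set ?qs \<inter> realization_of Y B \<noteq> {} \<and> set ps \<inter> realization_of Y B \<noteq> {})"
      using realization_quotient_eq_iff[of ?qs ps] ps by blast
    \<comment> \<open>Entries over \<open>B\<close> do not move, since \<open>B\<close> lies in
      \<open>S\<close>, where \<open>H\<close> is constant.\<close>
    have meets: "set (map (\<lambda>p. H (p, s)) xs) \<inter> realization_of Y B \<noteq> {}"
      if xs: "set xs \<inter> realization_of Y B \<noteq> {}" for xs
    proof -
      obtain p where p: "p \<in> set xs" "p \<in> realization_of Y B" using xs by blast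
      then have "H (p, s) = p" using H(4)[of p s] BSr s by blast
      then show ?thesis using p by force
    qed
    from alt have "mset (map (\<lambda>p. H (p, s)) ?qs) = mset (map (\<lambda>p. H (p, s)) ps) \<or>
       (set (map (\<lambda>p. H (p, s)) ?qs) \<inter> realization_of Y B \<noteq> {} \<and>
        set (map (\<lambda>p. H (p, s)) ps) \<inter> realization_of Y B \<noteq> {})"
    proof
      assume "mset ?qs = mset ps"
      then show ?thesis by (simp only: mset_map simp_thms)
    qed (use meets in blast)
    moreover have "set (map (\<lambda>p. H (p, s)) ?qs) \<subseteq> topspace ?Y" "set (map (\<lambda>p. H (p, s)) ps) \<subseteq> topspace ?Y"
      using qs ps Hin s by auto
    ultimately show ?thesis
      unfolding G_def case_prod_conv using realization_quotient_eq_iff qs ps by simp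
  qed
  show ?thesis
  proof (rule homotopy_equivalence_map_deformation[where G = G])
    show "continuous_map (realization \<Sigma>) ?T (realization_map T j)" by (rule j.continuous_map_realization_map)
    show "closed_map (realization \<Sigma>) ?T (realization_map T j)" by (rule j.closed_map_realization_map[OF j(2)])
    show "inj_on (realization_map T j) (topspace (realization \<Sigma>))" by (rule j.inj_on_realization_map[OF j(2)])
    show "continuous_map (prod_topology ?T unit_interval) ?T G"
    proof (rule continuous_map_from_realization_prod)
      show "locally_compact_space unit_interval" "Hausdorff_space unit_interval"
        using compact_unit_interval Hausdorff_unit_interval by (auto intro: compact_imp_locally_compact_space)
      fix k c assume "c \<in> cells T k"
      then obtain w where w: "length w = n" "set w \<subseteq> cells Y k" "q k w = c" using q_surj by blast
      let ?P = "prod_topology (simplex_space k) unit_interval"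
      \<comment> \<open>A lift \<open>w\<close> of the cell turns \<open>G\<close> on this cell into
        a tuple of \<open>n\<close> maps from the compact prism, where continuity of the quotient is
        known.\<close>
      have "continuous_map ?P ?T
          (\<lambda>a. realization_quotient (map (\<lambda>i. H (realization_point Y k (w ! i) (fst a), snd a)) [0..<n]))"
      proof (rule continuous_map_realization_quotient)
        show "compact_space ?P"
          unfolding compact_space_prod_topology using compact_simplex_space compact_unit_interval by blast
        fix i assume "i < n"
        then have "w ! i \<in> cells Y k" using w nth_mem by blast
        then show "continuous_map ?P ?Y (\<lambda>a. H (realization_point Y k (w ! i) (fst a), snd a))"
          by (intro continuous_map_comp[OF H(1)] continuous_map_pairedI continuous_map_snd
              continuous_map_comp[OF continuous_map_realization_point continuous_map_fst])
      qed
      then show "continuous_map ?P ?T (\<lambda>(t, s). G (realization_point T k c t, s))"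
      proof (rule continuous_map_eq)
        fix a assume a: "a \<in> topspace ?P"
        obtain t s where ts: "a = (t, s)" by fastforce
        then have t: "t \<in> standard_simplex k" "s \<in> {0..1}" using a by auto
        have "map (\<lambda>i. H (realization_point Y k (w ! i) t, s)) [0..<n]
            = map (\<lambda>p. H (p, s)) (map (\<lambda>y. realization_point Y k y t) w)"
          by (rule nth_equalityI) (use w in auto)
        moreover have "realization_quotient (map (\<lambda>y. realization_point Y k y t) w) = realization_point T k c t"
          using realization_quotient_point[OF w(1,2) t(1)] w(3) by simp
        moreover have "set (map (\<lambda>y. realization_point Y k y t) w) \<subseteq> topspace ?Y"
          using w t by (auto simp: subset_iff intro: realization_point_in)
        ultimately show "realization_quotient (map (\<lambda>i. H (realization_point Y k (w ! i) (fst a), snd a)) [0..<n])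
            = (\<lambda>(t, s). G (realization_point T k c t, s)) a"
          using G[of "map (\<lambda>y. realization_point Y k y t) w" s] w(1) t(2) ts by simp
      qed
    qed
    fix c assume "c \<in> topspace ?T"
    then obtain ps where ps: "length ps = n" "set ps \<subseteq> topspace ?Y" "realization_quotient ps = c"
      by (rule realization_quotient_surj)
    have "map (\<lambda>p. H (p, 0)) ps = ps" using H(2) ps(2) by (auto intro!: map_idI)
    then show "G (c, 0) = c" using G[OF ps(1,2), of 0] ps(3) by simp
    have "set (map (\<lambda>p. H (p, 1)) ps) \<inter> realization_of Y S \<noteq> {}"
    proof -
      \<comment> \<open>For \<open>n = 0\<close> the tuple would have no entry that could land in
        \<open>S\<close>.\<close>
      have "hd ps \<in> set ps" using ps(1) n by (cases ps) auto
      then have "H (hd ps, 1) \<in> set (map (\<lambda>p. H (p, 1)) ps)" "H (hd ps, 1) \<in> realization_of Y S"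
        using H(3)[of "hd ps"] ps(2) by (simp, blast)
      then show ?thesis by blast
    qed
    moreover have "set (map (\<lambda>p. H (p, 1)) ps) \<subseteq> topspace ?Y" using Hin ps(2) by auto
    ultimately have "realization_quotient (map (\<lambda>p. H (p, 1)) ps) \<in> ?A" using ps(1) by (intro Aintro) simp_all
    then show "G (c, 1) \<in> realization_map T j ` topspace (realization \<Sigma>)"
      unfolding im using G[OF ps(1,2), of 1] ps(3) by simp
  next
    fix c and s :: real assume "c \<in> realization_map T j ` topspace (realization \<Sigma>)" and s: "s \<in> {0..1}"
    then obtain ps where ps: "length ps = n" "set ps \<subseteq> topspace ?Y" "set ps \<inter> realization_of Y S \<noteq> {}"
      "c = realization_quotient ps" unfolding im by blast
    obtain p where p: "p \<in> set ps" "p \<in> realization_of Y S" using ps(3) by blast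
    then have "p \<in> set (map (\<lambda>p. H (p, s)) ps)" using H(4)[OF p(2) s] by force
    moreover have "set (map (\<lambda>p. H (p, s)) ps) \<subseteq> topspace ?Y" using Hin ps(2) s by auto
    ultimately have "realization_quotient (map (\<lambda>p. H (p, s)) ps) \<in> ?A" using ps(1) p(2) by (intro Aintro) auto
    then show "G (c, s) \<in> realization_map T j ` topspace (realization \<Sigma>)"
      unfolding im using G[OF ps(1,2) s] ps(4) by simp
  qed
qed

end

section \<open>Explicit form of the quotients\<close>

definition quot_class :: "'a sset \<Rightarrow> (nat \<Rightarrow> 'a \<Rightarrow> 'a \<Rightarrow> bool) \<Rightarrow> nat \<Rightarrow> 'a \<Rightarrow> 'a set" where
  "quot_class X R k x = generated_equiv (cells X k) (R k) `` {x}"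

lemma quot_point_class: "quot_point X R x = quot_class X R 0 x"
  by (simp add: quot_point_def quot_class_def)

text \<open>\<open>quot_sset\<close> acts through representatives, so it is a simplicial set only if
  the generated equivalence respects the operators. \<open>K\<close> is an explicit form of that
  equivalence for which this can be checked.\<close>

locale kernel_quotient = simplicial_set X for X :: "'a sset" +
  fixes R K :: "nat \<Rightarrow> 'a \<Rightarrow> 'a \<Rightarrow> bool"
  assumes kernel_iff: "\<lbrakk>u \<in> cells X k; v \<in> cells X k\<rbrakk> \<Longrightarrow>
      (u, v) \<in> generated_equiv (cells X k) (R k) \<longleftrightarrow> K k u v"
    and kernel_natural: "\<lbrakk>\<theta> \<in> simplex_maps m k; u \<in> cells X k; v \<in> cells X k; K k u v\<rbrakk> \<Longrightarrow>
      K m (act X m k \<theta> u) (act X m k \<theta> v)"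
begin

lemma quot_class_eq_iff:
  "\<lbrakk>u \<in> cells X k; v \<in> cells X k\<rbrakk> \<Longrightarrow> quot_class X R k u = quot_class X R k v \<longleftrightarrow> K k u v"
  unfolding quot_class_def by (simp add: generated_equiv_class_eq_iff kernel_iff)

lemma quot_class_mem_iff:
  "u \<in> cells X k \<Longrightarrow> v \<in> quot_class X R k u \<longleftrightarrow> v \<in> cells X k \<and> K k u v"
  using kernel_iff[of u k v] by (auto simp: quot_class_def generated_equiv_def)

lemma quot_class_self: "u \<in> cells X k \<Longrightarrow> u \<in> quot_class X R k u"
  unfolding quot_class_def by (rule equiv_class_self[OF equiv_generated_equiv])

lemma cells_quot: "cells (quot_sset X R) k = quot_class X R k ` cells X k"
  by (auto simp: quot_sset_def quotient_def quot_class_def)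

lemma act_quot:
  assumes \<theta>: "\<theta> \<in> simplex_maps m k" and u: "u \<in> cells X k"
  shows "act (quot_sset X R) m k \<theta> (quot_class X R k u) = quot_class X R m (act X m k \<theta> u)"
proof -
  have "generated_equiv (cells X m) (R m) `` (act X m k \<theta> ` quot_class X R k u) =
      generated_equiv (cells X m) (R m) `` {act X m k \<theta> u}"
  proof (rule equiv_Image_eq[OF equiv_generated_equiv])
    show "act X m k \<theta> u \<in> act X m k \<theta> ` quot_class X R k u" using quot_class_self[OF u] by (rule imageI)
    fix b assume "b \<in> act X m k \<theta> ` quot_class X R k u"
    then obtain v where v: "v \<in> cells X k" "K k u v" "b = act X m k \<theta> v"
      using quot_class_mem_iff[OF u] by blast
    then show "(act X m k \<theta> u, b) \<in> generated_equiv (cells X m) (R m)"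
      using kernel_iff kernel_natural[OF \<theta> u v(1,2)] act_closed[OF \<theta>] u by simp
  qed
  then show ?thesis by (simp add: quot_sset_def quot_class_def)
qed

lemma simplicial_set_quot: "simplicial_set (quot_sset X R)"
proof
  fix \<theta> m n C assume \<theta>: "\<theta> \<in> simplex_maps m n" and "C \<in> cells (quot_sset X R) n"
  then obtain u where u: "u \<in> cells X n" "C = quot_class X R n u" by (auto simp: cells_quot)
  then show "act (quot_sset X R) m n \<theta> C \<in> cells (quot_sset X R) m"
    using act_quot[OF \<theta> u(1)] act_closed[OF \<theta> u(1)] by (simp add: cells_quot)
next
  fix C n assume "C \<in> cells (quot_sset X R) n"
  then obtain u where u: "u \<in> cells X n" "C = quot_class X R n u" by (auto simp: cells_quot)
  then show "act (quot_sset X R) n n (restrict id {..n}) C = C"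
    using act_quot[OF id_simplex_maps u(1)] act_id[OF u(1)] by simp
next
  fix \<theta> l m \<phi> n C assume \<theta>: "\<theta> \<in> simplex_maps l m" and \<phi>: "\<phi> \<in> simplex_maps m n"
    and "C \<in> cells (quot_sset X R) n"
  then obtain u where u: "u \<in> cells X n" "C = quot_class X R n u" by (auto simp: cells_quot)
  then show "act (quot_sset X R) l n (compose {..l} \<phi> \<theta>) C =
      act (quot_sset X R) l m \<theta> (act (quot_sset X R) m n \<phi> C)"
    using act_quot[OF compose_simplex_maps[OF \<theta> \<phi>] u(1)] act_quot[OF \<phi> u(1)]
      act_quot[OF \<theta> act_closed[OF \<phi> u(1)]] act_compose[OF \<theta> \<phi> u(1)] by simp
qed

lemma quot_map_eq_class:
  assumes "C \<noteq> {}" "z \<in> cells X k" "\<And>c. c \<in> C \<Longrightarrow> g k c \<in> cells X k \<and> K k z (g k c)"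
  shows "quot_map X R g k C = quot_class X R k z"
proof -
  obtain c where c: "c \<in> C" using assms(1) by blast
  have same: "quot_class X R k (g k c') = quot_class X R k z" if "c' \<in> C" for c'
    using assms(2,3) that quot_class_eq_iff by metis
  have "generated_equiv (cells X k) (R k) `` (g k ` C) = generated_equiv (cells X k) (R k) `` {g k c}"
  proof (rule equiv_Image_eq[OF equiv_generated_equiv])
    fix b assume "b \<in> g k ` C"
    then obtain c' where c': "c' \<in> C" "b = g k c'" by blast
    have "quot_class X R k (g k c) = quot_class X R k (g k c')" using same c c'(1) by simp
    then show "(g k c, b) \<in> generated_equiv (cells X k) (R k)"
      unfolding quot_class_def c'(2) using generated_equiv_class_eq_iff assms(3) c c'(1) by metis
  qed (use c in simp)
  then show ?thesis using same[OF c] by (simp add: quot_map_def quot_class_def)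
qed

end

lemma permute_list_inverse:
  assumes "\<sigma> permutes {..<length w}"
  shows "permute_list \<sigma> (permute_list (inv_into UNIV \<sigma>) w) = w"
proof -
  have "permute_list \<sigma> (permute_list (inv_into UNIV \<sigma>) w) = permute_list (inv_into UNIV \<sigma> \<circ> \<sigma>) w"
    by (rule permute_list_compose[OF assms, symmetric])
  then show ?thesis using permutes_inv_o(2)[OF assms] by simp
qed

text \<open>
  The source of the symmetrized push-out product, and in the pointed case also its target, consists of
  the orbits of a quotient of a simplicial set \<open>Z\<close> of lists, in which lists with the same image \<open>t w\<close> in \<open>Y\<^sup>n\<close> are identified, as well as all lists whose
  image meets \<open>B\<close>.
\<close>

locale list_orbits = simplicial_set Z + Y: simplicial_set Y for Z :: "'c list sset" and Y :: "'b sset" +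
  fixes n :: nat and t :: "nat \<Rightarrow> 'c list \<Rightarrow> 'b list" and B :: "nat \<Rightarrow> 'b set"
    and R :: "nat \<Rightarrow> 'c list \<Rightarrow> 'c list \<Rightarrow> bool"
  assumes length_cells: "w \<in> cells Z k \<Longrightarrow> length w = n"
    and permute_cells: "\<lbrakk>w \<in> cells Z k; \<sigma> permutes {..<n}\<rbrakk> \<Longrightarrow> permute_list \<sigma> w \<in> cells Z k"
    and t_closed: "w \<in> cells Z k \<Longrightarrow> length (t k w) = n \<and> set (t k w) \<subseteq> cells Y k"
    and t_permute: "\<lbrakk>w \<in> cells Z k; \<sigma> permutes {..<n}\<rbrakk> \<Longrightarrow> t k (permute_list \<sigma> w) = permute_list \<sigma> (t k w)"
    and t_natural: "\<lbrakk>\<theta> \<in> simplex_maps m k; w \<in> cells Z k\<rbrakk> \<Longrightarrow>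
      t m (act Z m k \<theta> w) = map (act Y m k \<theta>) (t k w)"
    and B: "subcomplex Y B"
    and R_kernel: "\<lbrakk>u \<in> cells Z k; v \<in> cells Z k; R k u v\<rbrakk> \<Longrightarrow>
      t k u = t k v \<or> (set (t k u) \<inter> B k \<noteq> {} \<and> set (t k v) \<inter> B k \<noteq> {})"
    and kernel_R: "\<lbrakk>u \<in> cells Z k; v \<in> cells Z k;
      t k u = t k v \<or> (set (t k u) \<inter> B k \<noteq> {} \<and> set (t k v) \<inter> B k \<noteq> {})\<rbrakk> \<Longrightarrow>
      (u, v) \<in> generated_equiv (cells Z k) (R k)"
begin

definition K1 :: "nat \<Rightarrow> 'c list \<Rightarrow> 'c list \<Rightarrow> bool" where
  "K1 k u v \<longleftrightarrow> t k u = t k v \<or> (set (t k u) \<inter> B k \<noteq> {} \<and> set (t k v) \<inter> B k \<noteq> {})"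

text \<open>The kernel after both quotients: lists are permutations of each other exactly if their
  multisets agree, and the collapse of \<open>B\<close> is insensitive to order.\<close>

definition K2 :: "nat \<Rightarrow> 'c list \<Rightarrow> 'c list \<Rightarrow> bool" where
  "K2 k u v \<longleftrightarrow> mset (t k u) = mset (t k v) \<or> (set (t k u) \<inter> B k \<noteq> {} \<and> set (t k v) \<inter> B k \<noteq> {})"

lemma meets_natural:
  assumes "\<theta> \<in> simplex_maps m k" "w \<in> cells Z k" "set (t k w) \<inter> B k \<noteq> {}"
  shows "set (t m (act Z m k \<theta> w)) \<inter> B m \<noteq> {}"
proof -
  obtain y where y: "y \<in> set (t k w)" "y \<in> B k" using assms(3) by blast
  have "act Y m k \<theta> y \<in> B m" by (rule subcomplex_act[OF B assms(1) y(2)])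
  then show ?thesis using y(1) t_natural[OF assms(1,2)] by auto
qed

sublocale Q: kernel_quotient Z R K1
proof
  show "(u, v) \<in> generated_equiv (cells Z k) (R k) \<longleftrightarrow> K1 k u v" if "u \<in> cells Z k" "v \<in> cells Z k" for u v k
  proof
    assume "(u, v) \<in> generated_equiv (cells Z k) (R k)"
    then show "K1 k u v"
      by (induction rule: generated_equiv_induct) (use R_kernel in \<open>auto simp: K1_def\<close>)
  qed (use kernel_R that in \<open>simp add: K1_def\<close>)
  show "K1 m (act Z m k \<theta> u) (act Z m k \<theta> v)"
    if "\<theta> \<in> simplex_maps m k" "u \<in> cells Z k" "v \<in> cells Z k" "K1 k u v" for \<theta> m k u v
    using that(4) meets_natural[OF that(1,2)] meets_natural[OF that(1,3)] t_natural[OF that(1,2)] t_natural[OF that(1,3)]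
    unfolding K1_def by auto
qed

abbreviation Q1 :: "'c list set sset" where "Q1 \<equiv> quot_sset Z R"

abbreviation cl :: "nat \<Rightarrow> 'c list \<Rightarrow> 'c list set" where "cl \<equiv> quot_class Z R"

abbreviation orb :: "nat \<Rightarrow> 'c list set \<Rightarrow> 'c list set \<Rightarrow> bool" where
  "orb \<equiv> orbit_rel n (\<lambda>\<sigma>. image (permute_list \<sigma>))"

lemma K1_K2: "K1 k u v \<Longrightarrow> K2 k u v"
  by (auto simp: K1_def K2_def)

lemma K2_permute:
  assumes "w \<in> cells Z k" "\<sigma> permutes {..<n}"
  shows "K2 k w (permute_list \<sigma> w)"
  using assms t_closed[OF assms(1)] by (simp add: K2_def t_permute)

lemma K2_trans: "K2 k u v \<Longrightarrow> K2 k v w \<Longrightarrow> K2 k u w"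
  unfolding K2_def by (metis set_mset_mset)

lemma K2_sym: "K2 k u v \<Longrightarrow> K2 k v u"
  unfolding K2_def by metis

text \<open>\<open>K1\<close> is invariant under permutations, which gives one inclusion; the
  inverse permutation gives the other.\<close>

lemma image_permute_class:
  assumes w: "w \<in> cells Z k" and \<sigma>: "\<sigma> permutes {..<n}"
  shows "permute_list \<sigma> ` cl k w = cl k (permute_list \<sigma> w)"
proof -
  have K1p: "K1 k (permute_list \<tau> u) (permute_list \<tau> v)"
    if "u \<in> cells Z k" "v \<in> cells Z k" "\<tau> permutes {..<n}" "K1 k u v" for u v \<tau>
  proof -
    have "set (permute_list \<tau> (t k w)) = set (t k w)" if "w \<in> cells Z k" for w
      using t_closed[OF that] \<open>\<tau> permutes {..<n}\<close> by simp
    then show ?thesis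
      using that(4) that(1,2) unfolding K1_def t_permute[OF that(1,3)] t_permute[OF that(2,3)] by metis
  qed
  have inv: "inv_into UNIV \<sigma> permutes {..<n}" by (rule permutes_inv[OF \<sigma>])
  show ?thesis
  proof (intro equalityI subsetI)
    fix v assume "v \<in> permute_list \<sigma> ` cl k w"
    then obtain u where u: "u \<in> cells Z k" "K1 k w u" "v = permute_list \<sigma> u"
      using Q.quot_class_mem_iff[OF w] by blast
    then show "v \<in> cl k (permute_list \<sigma> w)"
      using K1p[OF w u(1) \<sigma> u(2)] Q.quot_class_mem_iff permute_cells w \<sigma> by simp
  next
    fix v assume "v \<in> cl k (permute_list \<sigma> w)"
    then have v: "v \<in> cells Z k" "K1 k (permute_list \<sigma> w) v"
      using Q.quot_class_mem_iff permute_cells[OF w \<sigma>] by blast+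
    define u where "u = permute_list (inv_into UNIV \<sigma>) v"
    have u: "u \<in> cells Z k" unfolding u_def by (rule permute_cells[OF v(1) inv])
    have vu: "v = permute_list \<sigma> u"
      unfolding u_def using permute_list_inverse[of \<sigma> v] length_cells[OF v(1)] \<sigma> by simp
    have "permute_list (inv_into UNIV \<sigma>) (permute_list \<sigma> w) = w"
      using permute_list_inverse[of "inv_into UNIV \<sigma>" w] length_cells[OF w] inv
      by (simp add: inv_inv_eq permutes_bij[OF \<sigma>])
    then have "K1 k w u"
      using K1p[OF permute_cells[OF w \<sigma>] v(1) inv v(2)] by (simp add: u_def)
    then have "u \<in> cl k w" using Q.quot_class_mem_iff[OF w] u by blast
    then show "v \<in> permute_list \<sigma> ` cl k w" using vu by blast
  qed
qed

lemma orbit_generated_iff: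
  assumes u: "u \<in> cells Z k" and v: "v \<in> cells Z k"
  shows "(cl k u, cl k v) \<in> generated_equiv (cells Q1 k) (orb k) \<longleftrightarrow> K2 k u v"
proof
  \<comment> \<open>The invariant quantifies over all representatives of the two classes, since an
    orbit step is known for classes only.\<close>
  let ?P = "\<lambda>C D. C \<in> cells Q1 k \<and> D \<in> cells Q1 k \<and>
    (\<forall>u\<in>cells Z k. \<forall>v\<in>cells Z k. C = cl k u \<longrightarrow> D = cl k v \<longrightarrow> K2 k u v)"
  assume "(cl k u, cl k v) \<in> generated_equiv (cells Q1 k) (orb k)"
  then have "?P (cl k u) (cl k v)"
  proof (induction rule: generated_equiv_induct)
    case (refl C)
    then show ?case using Q.quot_class_eq_iff K1_K2 by blast
  next
    case (base C D)
    have "K2 k u v" if uv: "u \<in> cells Z k" "v \<in> cells Z k" "C = cl k u" "D = cl k v" for u v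
    proof -
      obtain \<sigma> where \<sigma>: "\<sigma> permutes {..<n}" "D = permute_list \<sigma> ` C"
        using base(3) unfolding orbit_rel_def by blast
      have "cl k (permute_list \<sigma> u) = cl k v"
        using \<sigma>(2) uv image_permute_class[OF uv(1) \<sigma>(1)] by simp
      then have "K1 k (permute_list \<sigma> u) v"
        using Q.quot_class_eq_iff permute_cells uv \<sigma>(1) by blast
      then show ?thesis using K2_permute[OF uv(1) \<sigma>(1)] K1_K2 K2_trans by blast
    qed
    then show ?case using base by blast
  next
    case (sym C D)
    then show ?case using K2_sym by blast
  next
    case (trans C D E)
    then obtain w where w: "w \<in> cells Z k" "D = cl k w" by (auto simp: Q.cells_quot)
    then show ?case using trans K2_trans by blast
  qed
  then show "K2 k u v" using u v by blast
next
  assume K: "K2 k u v"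
  have c: "cl k u \<in> cells Q1 k" "cl k v \<in> cells Q1 k" using u v by (auto simp: Q.cells_quot)
  show "(cl k u, cl k v) \<in> generated_equiv (cells Q1 k) (orb k)"
  proof (cases "mset (t k u) = mset (t k v)")
    case True
    obtain \<sigma> where \<sigma>: "\<sigma> permutes {..<length (t k u)}" "permute_list \<sigma> (t k u) = t k v"
      using mset_eq_permutation[OF True[symmetric]] by blast
    then have \<sigma>n: "\<sigma> permutes {..<n}" using t_closed[OF u] by simp
    have "K1 k (permute_list \<sigma> u) v" using \<sigma>(2) t_permute[OF u \<sigma>n] by (simp add: K1_def)
    then have "cl k (permute_list \<sigma> u) = cl k v"
      using Q.quot_class_eq_iff[OF permute_cells[OF u \<sigma>n] v] by blast
    then have "cl k v = permute_list \<sigma> ` cl k u"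
      using image_permute_class[OF u \<sigma>n] by simp
    then have "orb k (cl k u) (cl k v)" using \<sigma>n unfolding orbit_rel_def by blast
    then show ?thesis using c by (intro generated_equivI)
  next
    case False
    then have "K1 k u v" using K by (auto simp: K1_def K2_def)
    then have "cl k u = cl k v" using Q.quot_class_eq_iff u v by simp
    then show ?thesis
      using c equiv_generated_equiv[of "cells Q1 k" "orb k"] by (auto simp: equiv_def refl_on_def)
  qed
qed

text \<open>A cell of \<open>Q1\<close> has no canonical representative, so the kernel is stated
  through some pair of representatives; \<open>orbit_generated_iff\<close> shows that any pair would
  do.\<close>

sublocale O: kernel_quotient Q1 orb "\<lambda>k C D. \<exists>u\<in>cells Z k. \<exists>v\<in>cells Z k. C = cl k u \<and> D = cl k v \<and> K2 k u v"
proof (intro kernel_quotient.intro Q.simplicial_set_quot kernel_quotient_axioms.intro)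
  fix C D k assume "C \<in> cells Q1 k" "D \<in> cells Q1 k"
  then obtain u v where uv: "u \<in> cells Z k" "v \<in> cells Z k" "C = cl k u" "D = cl k v"
    by (auto simp: Q.cells_quot)
  show "(C, D) \<in> generated_equiv (cells Q1 k) (orb k) \<longleftrightarrow>
      (\<exists>u\<in>cells Z k. \<exists>v\<in>cells Z k. C = cl k u \<and> D = cl k v \<and> K2 k u v)"
    using orbit_generated_iff uv by metis
next
  fix \<theta> m k C D assume \<theta>: "\<theta> \<in> simplex_maps m k"
    and "\<exists>u\<in>cells Z k. \<exists>v\<in>cells Z k. C = cl k u \<and> D = cl k v \<and> K2 k u v"
  then obtain u v where uv: "u \<in> cells Z k" "v \<in> cells Z k" "C = cl k u" "D = cl k v" "K2 k u v" by blast
  have "mset (t m (act Z m k \<theta> u)) = mset (t m (act Z m k \<theta> v))" if "mset (t k u) = mset (t k v)"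
    using t_natural[OF \<theta> uv(1)] t_natural[OF \<theta> uv(2)] that by simp
  then have "K2 m (act Z m k \<theta> u) (act Z m k \<theta> v)"
    using uv(5) meets_natural[OF \<theta> uv(1)] meets_natural[OF \<theta> uv(2)] unfolding K2_def by blast
  then show "\<exists>u\<in>cells Z m. \<exists>v\<in>cells Z m. act Q1 m k \<theta> C = cl m u \<and> act Q1 m k \<theta> D = cl m v \<and> K2 m u v"
    using Q.act_quot[OF \<theta>] act_closed[OF \<theta>] uv by blast
qed

abbreviation total :: "'c list set set sset" where "total \<equiv> quot_sset Q1 orb"

definition proj :: "nat \<Rightarrow> 'c list \<Rightarrow> 'c list set set" where
  "proj k w = quot_class Q1 orb k (cl k w)"

lemma cells_total: "cells total k = proj k ` cells Z k"
  unfolding O.cells_quot Q.cells_quot proj_def by auto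

lemma act_total:
  assumes "\<theta> \<in> simplex_maps m k" "w \<in> cells Z k"
  shows "act total m k \<theta> (proj k w) = proj m (act Z m k \<theta> w)"
  unfolding proj_def using O.act_quot[OF assms(1)] Q.act_quot[OF assms] assms(2) by (simp add: Q.cells_quot)

lemma proj_eq_iff:
  assumes "u \<in> cells Z k" "v \<in> cells Z k"
  shows "proj k u = proj k v \<longleftrightarrow> K2 k u v"
  unfolding proj_def quot_class_def[of Q1]
  using generated_equiv_class_eq_iff[of "cl k u" "cells Q1 k" "cl k v"] orbit_generated_iff[OF assms] assms
  by (simp add: Q.cells_quot)

lemma proj_elem:
  assumes "w \<in> cells Z k" "C \<in> proj k w"
  obtains v where "v \<in> cells Z k" "C = cl k v" "K2 k w v"
proof -
  have "C \<in> cells Q1 k" "(cl k w, C) \<in> generated_equiv (cells Q1 k) (orb k)"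
    using assms(2) unfolding proj_def quot_class_def[of Q1] by (auto simp: generated_equiv_def)
  then show ?thesis using that orbit_generated_iff[OF assms(1)] by (auto simp: Q.cells_quot)
qed

lemma proj_nonempty: "w \<in> cells Z k \<Longrightarrow> proj k w \<noteq> {}"
  using O.quot_class_self[of "cl k w" k] unfolding proj_def by (auto simp: Q.cells_quot)

end

section \<open>Cells of powers and of the punctured cube\<close>

context simplicial_set
begin

lemma cells_power: "cells (power_sset X n) k = {w. length w = n \<and> set w \<subseteq> cells X k}"
  by (simp add: power_sset_def)

lemma act_power: "act (power_sset X n) m k \<theta> w = map (act X m k \<theta>) w"
  by (simp add: power_sset_def)

lemma simplicial_set_power: "simplicial_set (power_sset X n)"
  by standard (auto simp: cells_power act_power act_closed act_id act_compose subset_iff intro!: map_idI)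

end

context simplicial_map
begin

abbreviation image_cells :: "nat \<Rightarrow> 'b set" where "image_cells k \<equiv> f k ` cells X k"

lemma cells_cube:
  "cells (punctured_cube X Y n) k =
    {w. length w = n \<and> set w \<subseteq> cells X k <+> cells Y k \<and> (\<exists>z\<in>set w. isl z)}"
  by (simp add: punctured_cube_def)

lemma act_cube: "act (punctured_cube X Y n) m k \<theta> w = map (map_sum (act X m k \<theta>) (act Y m k \<theta>)) w"
  by (simp add: punctured_cube_def)

lemma simplicial_set_cube: "simplicial_set (punctured_cube X Y n)"
proof
  fix \<theta> m k w assume \<theta>: "\<theta> \<in> simplex_maps m k" and w: "w \<in> cells (punctured_cube X Y n) k"
  have "map_sum (act X m k \<theta>) (act Y m k \<theta>) z \<in> cells X m <+> cells Y m" if "z \<in> set w" for z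
  proof -
    have "z \<in> cells X k <+> cells Y k" using that w by (auto simp: cells_cube)
    then show ?thesis using source.act_closed[OF \<theta>] target.act_closed[OF \<theta>] by auto
  qed
  moreover have "isl (map_sum (act X m k \<theta>) (act Y m k \<theta>) z) = isl z" for z
    by (cases z) auto
  ultimately show "act (punctured_cube X Y n) m k \<theta> w \<in> cells (punctured_cube X Y n) m"
    using w unfolding act_cube cells_cube by auto
next
  fix w k assume w: "w \<in> cells (punctured_cube X Y n) k"
  have "map_sum (act X k k (restrict id {..k})) (act Y k k (restrict id {..k})) z = z" if "z \<in> set w" for z
    using that w source.act_id target.act_id by (auto simp: cells_cube subset_iff)
  then show "act (punctured_cube X Y n) k k (restrict id {..k}) w = w"
    unfolding act_cube by (intro map_idI)
next
  fix \<theta> l m \<phi> k w assume \<theta>: "\<theta> \<in> simplex_maps l m" and \<phi>: "\<phi> \<in> simplex_maps m k"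
    and w: "w \<in> cells (punctured_cube X Y n) k"
  have "map_sum (act X l k (compose {..l} \<phi> \<theta>)) (act Y l k (compose {..l} \<phi> \<theta>)) z =
      map_sum (act X l m \<theta>) (act Y l m \<theta>) (map_sum (act X m k \<phi>) (act Y m k \<phi>) z)" if "z \<in> set w" for z
    using that w source.act_compose[OF \<theta> \<phi>] target.act_compose[OF \<theta> \<phi>] by (auto simp: cells_cube subset_iff)
  then show "act (punctured_cube X Y n) l k (compose {..l} \<phi> \<theta>) w =
      act (punctured_cube X Y n) l m \<theta> (act (punctured_cube X Y n) m k \<phi> w)"
    unfolding act_cube by simp
qed

lemma terminal_vertex_closed:
  assumes "w \<in> cells (punctured_cube X Y n) k"
  shows "length (terminal_vertex_map f k w) = n" "set (terminal_vertex_map f k w) \<subseteq> cells Y k"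
    "set (terminal_vertex_map f k w) \<inter> image_cells k \<noteq> {}"
proof -
  show "length (terminal_vertex_map f k w) = n" using assms by (simp add: cells_cube terminal_vertex_map_def)
  have "case_sum (f k) id z \<in> cells Y k" if "z \<in> set w" for z
    using that assms map_closed by (auto simp: cells_cube subset_iff)
  then show "set (terminal_vertex_map f k w) \<subseteq> cells Y k" by (auto simp: terminal_vertex_map_def)
  obtain z where z: "z \<in> set w" "isl z" using assms by (auto simp: cells_cube)
  then obtain x where x: "z = Inl x" by (auto simp: isl_def)
  then have "x \<in> cells X k" using z assms by (auto simp: cells_cube)
  moreover have "f k x \<in> set (terminal_vertex_map f k w)"
    using z x by (force simp: terminal_vertex_map_def)
  ultimately show "set (terminal_vertex_map f k w) \<inter> image_cells k \<noteq> {}" by blast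
qed

lemma terminal_vertex_natural:
  assumes \<theta>: "\<theta> \<in> simplex_maps m k" and w: "w \<in> cells (punctured_cube X Y n) k"
  shows "terminal_vertex_map f m (act (punctured_cube X Y n) m k \<theta> w) =
    map (act Y m k \<theta>) (terminal_vertex_map f k w)"
proof -
  have "case_sum (f m) id (map_sum (act X m k \<theta>) (act Y m k \<theta>) z) = act Y m k \<theta> (case_sum (f k) id z)"
    if "z \<in> set w" for z
    using that w map_natural[OF \<theta>] by (auto simp: cells_cube subset_iff)
  then show ?thesis by (simp add: act_cube terminal_vertex_map_def)
qed

text \<open>The representative of \<open>v\<close> at the lowest possible vertex of the cube: every
  entry that comes from \<open>X\<close> is taken from \<open>X\<close>.\<close>

definition cube_lift :: "nat \<Rightarrow> 'b list \<Rightarrow> ('a + 'b) list" where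
  "cube_lift k = map (\<lambda>y. if y \<in> image_cells k then Inl (inv_into (cells X k) (f k) y) else Inr y)"

lemma cube_lift_closed:
  assumes "length v = n" "set v \<subseteq> cells Y k" "set v \<inter> image_cells k \<noteq> {}"
  shows "cube_lift k v \<in> cells (punctured_cube X Y n) k" "terminal_vertex_map f k (cube_lift k v) = v"
proof -
  have "inv_into (cells X k) (f k) y \<in> cells X k" if "y \<in> image_cells k" for y
    using that by (rule inv_into_into)
  then have "set (cube_lift k v) \<subseteq> cells X k <+> cells Y k"
    using assms(2) by (auto simp: cube_lift_def)
  moreover have "\<exists>z\<in>set (cube_lift k v). isl z"
  proof -
    obtain y where y: "y \<in> set v" "y \<in> image_cells k" using assms(3) by blast
    then have "Inl (inv_into (cells X k) (f k) y) \<in> set (cube_lift k v)"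
      unfolding cube_lift_def set_map by (intro image_eqI[of _ _ y]) simp_all
    then show ?thesis by (rule bexI[rotated]) simp
  qed
  ultimately show "cube_lift k v \<in> cells (punctured_cube X Y n) k"
    using assms(1) by (simp add: cells_cube cube_lift_def)
  show "terminal_vertex_map f k (cube_lift k v) = v"
    unfolding terminal_vertex_map_def cube_lift_def map_map
    by (intro map_idI) (auto simp: f_inv_into_f)
qed

text \<open>By injectivity an entry \<open>Inl x\<close> is recovered by the lift, and an entry
  \<open>Inr y\<close> is either kept or reached from a preimage. So all cells with one image in the
  power are one step from a common cell, which makes the push-out product injective.\<close>

lemma cube_step_lift:
  assumes inj: "inj_on (f k) (cells X k)" and w: "w \<in> cells (punctured_cube X Y n) k"
  shows "cube_step f k (cube_lift k (terminal_vertex_map f k w)) w"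
proof -
  have "list_all2 (\<lambda>u v. v = u \<or> (\<exists>x. u = Inl x \<and> v = Inr (f k x)))
      (cube_lift k (terminal_vertex_map f k w)) w"
    unfolding list_all2_conv_all_nth
  proof (intro conjI allI impI)
    show "length (cube_lift k (terminal_vertex_map f k w)) = length w"
      by (simp add: cube_lift_def terminal_vertex_map_def)
    fix i assume "i < length (cube_lift k (terminal_vertex_map f k w))"
    then have i: "i < length w" by (simp add: cube_lift_def terminal_vertex_map_def)
    have wi: "w ! i \<in> cells X k <+> cells Y k" using w i nth_mem by (fastforce simp: cells_cube)
    let ?u = "cube_lift k (terminal_vertex_map f k w) ! i"
    show "w ! i = ?u \<or> (\<exists>x. ?u = Inl x \<and> w ! i = Inr (f k x))"
    proof (cases "w ! i")
      case (Inl x)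
      then have "x \<in> cells X k" using wi by auto
      then have "?u = Inl x"
        using i Inl inv_into_f_f[OF inj] by (simp add: cube_lift_def terminal_vertex_map_def)
      then show ?thesis using Inl by simp
    next
      case (Inr y)
      then show ?thesis
        using i f_inv_into_f[of y "f k" "cells X k"] by (auto simp: cube_lift_def terminal_vertex_map_def)
    qed
  qed
  then show ?thesis by (simp add: cube_step_def)
qed

lemma cube_step_terminal: "cube_step f k u v \<Longrightarrow> terminal_vertex_map f k u = terminal_vertex_map f k v"
  unfolding cube_step_def terminal_vertex_map_def
  by (induction rule: list_all2_induct) auto

text \<open>Stated for a general \<open>B\<close> to cover both cases: empty for the Cartesian
  product, the base point for the smash product. Equal images are connected through their common
  \<open>cube_lift\<close>.\<close>

lemma list_orbits_cube:
  assumes inj: "\<And>k. inj_on (f k) (cells X k)" and B: "subcomplex Y B"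
    and R1: "\<And>k u v. u \<in> cells (punctured_cube X Y n) k \<Longrightarrow> v \<in> cells (punctured_cube X Y n) k \<Longrightarrow>
      R k u v \<longleftrightarrow> cube_step f k u v \<or>
        (set (terminal_vertex_map f k u) \<inter> B k \<noteq> {} \<and> set (terminal_vertex_map f k v) \<inter> B k \<noteq> {})"
  shows "list_orbits (punctured_cube X Y n) Y n (terminal_vertex_map f) B R"
proof (intro list_orbits.intro simplicial_set_cube target.simplicial_set_axioms list_orbits_axioms.intro B)
  let ?Z = "punctured_cube X Y n"
  fix k w assume w: "w \<in> cells ?Z k"
  show len: "length w = n" using w by (simp add: cells_cube)
  show "length (terminal_vertex_map f k w) = n \<and> set (terminal_vertex_map f k w) \<subseteq> cells Y k"
    using terminal_vertex_closed[OF w] by simp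
  fix \<sigma> assume \<sigma>: "\<sigma> permutes {..<n}"
  then show "permute_list \<sigma> w \<in> cells ?Z k" using w len by (simp add: cells_cube)
  show "terminal_vertex_map f k (permute_list \<sigma> w) = permute_list \<sigma> (terminal_vertex_map f k w)"
    unfolding terminal_vertex_map_def using permute_list_map \<sigma> len by metis
next
  let ?Z = "punctured_cube X Y n"
  show "terminal_vertex_map f m (act ?Z m k \<theta> w) = map (act Y m k \<theta>) (terminal_vertex_map f k w)"
    if "\<theta> \<in> simplex_maps m k" "w \<in> cells ?Z k" for \<theta> m k w
    by (rule terminal_vertex_natural[OF that])
  fix u v k assume u: "u \<in> cells ?Z k" and v: "v \<in> cells ?Z k"
  show "terminal_vertex_map f k u = terminal_vertex_map f k v \<or>
      (set (terminal_vertex_map f k u) \<inter> B k \<noteq> {} \<and> set (terminal_vertex_map f k v) \<inter> B k \<noteq> {})"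
    if "R k u v"
    using that R1[OF u v] cube_step_terminal by blast
  let ?E = "generated_equiv (cells ?Z k) (R k)"
  assume K: "terminal_vertex_map f k u = terminal_vertex_map f k v \<or>
      (set (terminal_vertex_map f k u) \<inter> B k \<noteq> {} \<and> set (terminal_vertex_map f k v) \<inter> B k \<noteq> {})"
  show "(u, v) \<in> ?E"
  proof (cases "terminal_vertex_map f k u = terminal_vertex_map f k v")
    case True
    have lift: "(cube_lift k (terminal_vertex_map f k w), w) \<in> ?E" if w: "w \<in> cells ?Z k" for w
    proof (rule generated_equivI[OF _ w])
      show c: "cube_lift k (terminal_vertex_map f k w) \<in> cells ?Z k"
        by (rule cube_lift_closed(1)[OF terminal_vertex_closed[OF w]])
      show "R k (cube_lift k (terminal_vertex_map f k w)) w"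
        using R1[OF c w] cube_step_lift[OF inj w] by blast
    qed
    from lift[OF u] lift[OF v] True show ?thesis
      using equiv_generated_equiv[of "cells ?Z k" "R k"] by (metis equiv_def symD transD)
  next
    case False
    then have "R k u v" using K R1[OF u v] by blast
    then show ?thesis using u v by (intro generated_equivI)
  qed
qed

end

section \<open>Symmetrized push-out products\<close>

context simplicial_map
begin

text \<open>\<open>j\<close> is known on representatives, where it is \<open>q\<close> after the
  terminal vertex map. Source and target have the same kernel on tuples, hence injectivity; the
  image consists of the tuples meeting \<open>X\<close>, the subcomplex that the deformation
  preserves.\<close>

lemma subquotient_map:
  assumes inj: "\<And>k. inj_on (f k) (cells X k)"
    and T: "power_quotient Y T n q B"
    and C: "list_orbits (punctured_cube X Y n) Y n (terminal_vertex_map f) B R"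
    and \<Sigma>: "\<Sigma> = quot_sset (quot_sset (punctured_cube X Y n) R) (orbit_rel n (\<lambda>\<sigma>. image (permute_list \<sigma>)))"
    and j: "\<And>k w. w \<in> cells (punctured_cube X Y n) k \<Longrightarrow>
      j k (list_orbits.proj (punctured_cube X Y n) n R k w) = q k (terminal_vertex_map f k w)"
  shows "cofibration \<Sigma> T j"
    and "n \<ge> 1 \<Longrightarrow> (\<And>k. B k \<subseteq> image_cells k) \<Longrightarrow>
      homotopy_equivalence_map (realization X) (realization Y) (realization_map Y f) \<Longrightarrow>
      trivial_cofibration \<Sigma> T j"
proof -
  interpret T: power_quotient Y T n q B by (rule T)
  interpret C: list_orbits "punctured_cube X Y n" Y n "terminal_vertex_map f" B R by (rule C)
  let ?Z = "punctured_cube X Y n" and ?t = "terminal_vertex_map f"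
  have cells: "cells \<Sigma> k = C.proj k ` cells ?Z k" for k unfolding \<Sigma> by (rule C.cells_total)
  have map: "simplicial_map \<Sigma> T j"
  proof (intro simplicial_map.intro simplicial_map_axioms.intro T.target.simplicial_set_axioms)
    show "simplicial_set \<Sigma>" unfolding \<Sigma> by (rule C.O.simplicial_set_quot)
    show "j k c \<in> cells T k" if c: "c \<in> cells \<Sigma> k" for c k
    proof -
      obtain w where w: "w \<in> cells ?Z k" "c = C.proj k w" using c cells by blast
      then show ?thesis using j[OF w(1)] T.q_closed terminal_vertex_closed[OF w(1)] by simp
    qed
    show "j m (act \<Sigma> m k \<theta> c) = act T m k \<theta> (j k c)" if \<theta>: "\<theta> \<in> simplex_maps m k" and c: "c \<in> cells \<Sigma> k" for \<theta> m k c
    proof -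
      obtain w where w: "w \<in> cells ?Z k" "c = C.proj k w" using c cells by blast
      have "act \<Sigma> m k \<theta> c = C.proj m (act ?Z m k \<theta> w)"
        unfolding \<Sigma> w(2) by (rule C.act_total[OF \<theta> w(1)])
      then have "j m (act \<Sigma> m k \<theta> c) = q m (?t m (act ?Z m k \<theta> w))"
        using j C.act_closed[OF \<theta> w(1)] by simp
      then show ?thesis
        using terminal_vertex_natural[OF \<theta> w(1)] T.q_natural[OF \<theta>] terminal_vertex_closed[OF w(1)]
          j[OF w(1)] w(2) by simp
    qed
  qed
  have injj: "inj_on (j k) (cells \<Sigma> k)" for k
  proof (rule inj_onI)
    fix c d assume cd: "c \<in> cells \<Sigma> k" "d \<in> cells \<Sigma> k" and e: "j k c = j k d"
    obtain u where u: "u \<in> cells ?Z k" "c = C.proj k u" using cd(1) unfolding cells by (rule imageE)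
    obtain v where v: "v \<in> cells ?Z k" "d = C.proj k v" using cd(2) unfolding cells by (rule imageE)
    have "q k (?t k u) = q k (?t k v)" using e j[OF u(1)] j[OF v(1)] u(2) v(2) by simp
    then have "C.K2 k u v"
      unfolding C.K2_def
      using T.q_eq_iff[OF terminal_vertex_closed(1,2)[OF u(1)] terminal_vertex_closed(1,2)[OF v(1)]] by blast
    then show "c = d" using C.proj_eq_iff[OF u(1) v(1)] u(2) v(2) by simp
  qed
  show cof: "cofibration \<Sigma> T j" unfolding cofibration_def using map injj by blast
  have im: "j k ` cells \<Sigma> k = {q k v | v. length v = n \<and> set v \<subseteq> cells Y k \<and> set v \<inter> image_cells k \<noteq> {}}" for k
  proof (intro equalityI subsetI)
    fix c assume "c \<in> j k ` cells \<Sigma> k"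
    then obtain w where w: "w \<in> cells ?Z k" "c = q k (?t k w)" using cells j by auto
    then show "c \<in> {q k v | v. length v = n \<and> set v \<subseteq> cells Y k \<and> set v \<inter> image_cells k \<noteq> {}}"
      using terminal_vertex_closed[OF w(1)] by blast
  next
    fix c assume "c \<in> {q k v | v. length v = n \<and> set v \<subseteq> cells Y k \<and> set v \<inter> image_cells k \<noteq> {}}"
    then obtain v where v: "length v = n" "set v \<subseteq> cells Y k" "set v \<inter> image_cells k \<noteq> {}" "c = q k v" by blast
    \<comment> \<open>The lift provides a preimage of each tuple that has some entry in the image of
      \<open>f\<close>.\<close>
    note l = cube_lift_closed[OF v(1-3)]
    have "c = j k (C.proj k (cube_lift k v))" using j[OF l(1)] l(2) v(4) by simp
    then show "c \<in> j k ` cells \<Sigma> k" using l(1) cells by blast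
  qed
  assume n: "n \<ge> 1" and BX: "\<And>k. B k \<subseteq> image_cells k"
    and eq: "homotopy_equivalence_map (realization X) (realization Y) (realization_map Y f)"
  obtain H where H: "continuous_map (prod_topology (realization Y) unit_interval) (realization Y) H"
    "\<And>p. p \<in> topspace (realization Y) \<Longrightarrow> H (p, 0) = p"
    "\<And>p. p \<in> topspace (realization Y) \<Longrightarrow> H (p, 1) \<in> realization_of Y image_cells"
    "\<And>p s. p \<in> realization_of Y image_cells \<Longrightarrow> s \<in> {0..1} \<Longrightarrow> H (p, s) = p"
    using strong_deformation[OF inj eq] by blast
  have "homotopy_equivalence_map (realization \<Sigma>) (realization T) (realization_map T j)"
    by (rule T.homotopy_equivalence_subquotient[OF n subcomplex_image BX H map injj im])
  then show "trivial_cofibration \<Sigma> T j"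
    unfolding trivial_cofibration_def weak_equivalence_def using cof map by blast
qed

end

section \<open>The symmetric power and the symmetric smash power as targets\<close>

context simplicial_set
begin

lemma kernel_quotient_sym_power:
  "kernel_quotient (power_sset X n) (orbit_rel n permute_list) (\<lambda>k u v. mset u = mset v)"
proof (intro kernel_quotient.intro simplicial_set_power kernel_quotient_axioms.intro)
  fix u v k assume u: "u \<in> cells (power_sset X n) k" and v: "v \<in> cells (power_sset X n) k"
  show "(u, v) \<in> generated_equiv (cells (power_sset X n) k) (orbit_rel n permute_list k) \<longleftrightarrow> mset u = mset v"
  proof
    assume "(u, v) \<in> generated_equiv (cells (power_sset X n) k) (orbit_rel n permute_list k)"
    then show "mset u = mset v"
      by (induction rule: generated_equiv_induct) (auto simp: orbit_rel_def cells_power)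
  next
    assume "mset u = mset v"
    then obtain \<sigma> where \<sigma>: "\<sigma> permutes {..<length u}" "permute_list \<sigma> u = v"
      using mset_eq_permutation[of v u] by metis
    then have "orbit_rel n permute_list k u v" using u unfolding orbit_rel_def cells_power by auto
    then show "(u, v) \<in> generated_equiv (cells (power_sset X n) k) (orbit_rel n permute_list k)"
      using u v by (intro generated_equivI)
  qed
qed (simp add: act_power)

lemma power_quotient_sym_power:
  "power_quotient X (sym_power X n) n (quot_class (power_sset X n) (orbit_rel n permute_list)) (\<lambda>_. {})"
proof -
  interpret Q: kernel_quotient "power_sset X n" "orbit_rel n permute_list" "\<lambda>k u v. mset u = mset v"
    by (rule kernel_quotient_sym_power)
  have sp: "sym_power X n = quot_sset (power_sset X n) (orbit_rel n permute_list)"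
    by (simp add: sym_power_def orbits_def)
  show ?thesis
    unfolding sp
  proof (intro power_quotient.intro simplicial_set_axioms Q.simplicial_set_quot power_quotient_axioms.intro)
    show "subcomplex X (\<lambda>_. {})" by (simp add: subcomplex_def)
  qed (auto simp: Q.cells_quot Q.act_quot Q.quot_class_eq_iff cells_power act_power)
qed

text \<open>With the identity for \<open>t\<close>, the smash power becomes an instance of the
  locale that also describes the source.\<close>

lemma list_orbits_smash_power:
  assumes B: "subcomplex X (\<lambda>k. {base_cell X x0 k})"
  shows "list_orbits (power_sset X n) X n (\<lambda>k w. w) (\<lambda>k. {base_cell X x0 k}) (smash_rel X x0)"
proof (intro list_orbits.intro simplicial_set_power simplicial_set_axioms list_orbits_axioms.intro B)
  fix u v k assume u: "u \<in> cells (power_sset X n) k" and v: "v \<in> cells (power_sset X n) k"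
    and K: "u = v \<or> (set u \<inter> {base_cell X x0 k} \<noteq> {} \<and> set v \<inter> {base_cell X x0 k} \<noteq> {})"
  show "(u, v) \<in> generated_equiv (cells (power_sset X n) k) (smash_rel X x0 k)"
  proof (cases "u = v")
    case True
    then show ?thesis
      using u equiv_generated_equiv[of "cells (power_sset X n) k" "smash_rel X x0 k"]
      by (simp add: equiv_def refl_on_def)
  next
    case False
    then have "smash_rel X x0 k u v" using K by (auto simp: smash_rel_def)
    then show ?thesis using u v by (intro generated_equivI)
  qed
qed (auto simp: cells_power act_power smash_rel_def)

lemma power_quotient_sym_smash_power:
  assumes B: "subcomplex X (\<lambda>k. {base_cell X x0 k})"
  shows "power_quotient X (sym_smash_power X x0 n) n
    (list_orbits.proj (power_sset X n) n (smash_rel X x0)) (\<lambda>k. {base_cell X x0 k})"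
proof -
  interpret P: list_orbits "power_sset X n" X n "\<lambda>k w. w" "\<lambda>k. {base_cell X x0 k}" "smash_rel X x0"
    by (rule list_orbits_smash_power[OF B])
  have sp: "sym_smash_power X x0 n = P.total"
    by (simp add: sym_smash_power_def orbits_def smash_power_def)
  show ?thesis
    unfolding sp
  proof (intro power_quotient.intro simplicial_set_axioms P.O.simplicial_set_quot power_quotient_axioms.intro B)
    fix w k assume w: "length w = n" "set w \<subseteq> cells X k"
    then have wc: "w \<in> cells (power_sset X n) k" by (simp add: cells_power)
    show "P.proj k w \<in> cells P.total k" using wc P.cells_total by blast
    show "P.proj m (map (act X m k \<theta>) w) = act P.total m k \<theta> (P.proj k w)" if "\<theta> \<in> simplex_maps m k" for \<theta> m
      using P.act_total[OF that wc] by (simp add: act_power)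
    fix w' assume "length w' = n" "set w' \<subseteq> cells X k"
    then have "w' \<in> cells (power_sset X n) k" by (simp add: cells_power)
    then show "P.proj k w = P.proj k w' \<longleftrightarrow> mset w = mset w' \<or>
        (set w \<inter> {base_cell X x0 k} \<noteq> {} \<and> set w' \<inter> {base_cell X x0 k} \<noteq> {})"
      using P.proj_eq_iff[OF wc] by (simp add: P.K2_def)
  next
    fix c k assume "c \<in> cells P.total k"
    then show "\<exists>w. length w = n \<and> set w \<subseteq> cells X k \<and> P.proj k w = c"
      unfolding P.cells_total by (auto simp: cells_power)
  qed
qed

text \<open>There is only one operator from each \<open>[m]\<close> to \<open>[0]\<close>, so the
  degeneracies of a vertex are permuted among themselves by all operators.\<close>

lemma subcomplex_base:
  assumes "x0 \<in> cells X 0"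
  shows "subcomplex X (\<lambda>k. {base_cell X x0 k})"
proof -
  have z: "restrict (\<lambda>_. 0) {..k} \<in> simplex_maps k 0" for k by (rule restrict_simplex_maps) auto
  have "act X m k \<theta> (base_cell X x0 k) = base_cell X x0 m" if \<theta>: "\<theta> \<in> simplex_maps m k" for \<theta> m k
  proof -
    have "compose {..m} (restrict (\<lambda>_. 0) {..k}) \<theta> = restrict (\<lambda>_. 0 :: nat) {..m}"
      by (rule simplex_maps_eqI[OF compose_simplex_maps[OF \<theta> z] z])
        (use simplex_maps_le[OF \<theta>] in \<open>simp add: compose_def\<close>)
    then show ?thesis using act_compose[OF \<theta> z assms] by (simp add: base_cell_def)
  qed
  then show ?thesis
    unfolding subcomplex_def using act_closed[OF z assms] by (simp add: base_cell_def)
qed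

end

context simplicial_map
begin

lemma sym_box_map_cofibration:
  assumes inj: "\<And>k. inj_on (f k) (cells X k)"
  shows "cofibration (sym_box_source X Y f n) (sym_power Y n) (sym_box_map Y f n)"
    and "n \<ge> 1 \<Longrightarrow> homotopy_equivalence_map (realization X) (realization Y) (realization_map Y f) \<Longrightarrow>
      trivial_cofibration (sym_box_source X Y f n) (sym_power Y n) (sym_box_map Y f n)"
proof -
  let ?Z = "punctured_cube X Y n" and ?t = "terminal_vertex_map f"
  have C: "list_orbits ?Z Y n ?t (\<lambda>_. {}) (cube_step f)"
    by (rule list_orbits_cube[OF inj]) (auto simp: subcomplex_def)
  interpret C: list_orbits ?Z Y n ?t "\<lambda>_. {}" "cube_step f" by (rule C)
  interpret P: kernel_quotient "power_sset Y n" "orbit_rel n permute_list" "\<lambda>k u v. mset u = mset v"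
    by (rule target.kernel_quotient_sym_power)
  have \<Sigma>: "sym_box_source X Y f n = C.total"
    by (simp add: sym_box_source_def orbits_def box_source_def)
  \<comment> \<open>With nothing collapsed, a class is a full fibre of the terminal vertex map, so
    \<open>the_elem\<close> is applied to a singleton.\<close>
  have box: "box_map f k (C.cl k v) = ?t k v" if v: "v \<in> cells ?Z k" for k v
  proof -
    have "?t k ` C.cl k v = {?t k v}"
      using C.Q.quot_class_mem_iff[OF v] C.Q.quot_class_self[OF v] by (auto simp: C.K1_def)
    then show ?thesis by (simp add: box_map_def)
  qed
  have j: "sym_box_map Y f n k (C.proj k w) = quot_class (power_sset Y n) (orbit_rel n permute_list) k (?t k w)"
    if w: "w \<in> cells ?Z k" for k w
    unfolding sym_box_map_def
  proof (rule P.quot_map_eq_class[OF C.proj_nonempty[OF w]])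
    show "?t k w \<in> cells (power_sset Y n) k"
      using terminal_vertex_closed[OF w] by (simp add: target.cells_power)
    fix D assume "D \<in> C.proj k w"
    then obtain v where v: "v \<in> cells ?Z k" "D = C.cl k v" "C.K2 k w v" by (rule C.proj_elem[OF w])
    then show "box_map f k D \<in> cells (power_sset Y n) k \<and> mset (?t k w) = mset (box_map f k D)"
      using box[OF v(1)] terminal_vertex_closed[OF v(1)] by (simp add: target.cells_power C.K2_def)
  qed
  note S = subquotient_map[OF inj target.power_quotient_sym_power C \<Sigma>]
  show "cofibration (sym_box_source X Y f n) (sym_power Y n) (sym_box_map Y f n)"
    by (rule S(1)) (rule j)
  show "trivial_cofibration (sym_box_source X Y f n) (sym_power Y n) (sym_box_map Y f n)"
    if "n \<ge> 1" "homotopy_equivalence_map (realization X) (realization Y) (realization_map Y f)"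
    by (rule S(2)[OF _ that(1) _ that(2)]) (rule j, assumption, simp)
qed

lemma sym_smash_box_map_cofibration:
  assumes inj: "\<And>k. inj_on (f k) (cells X k)"
    and x0: "x0 \<in> cells X 0" and y0: "f 0 x0 = y0" and n: "n \<ge> 1"
  shows "pointed_cofibration (sym_smash_box_source X x0 Y y0 f n) (sym_smash_box_point X x0 Y y0 f n)
      (sym_smash_power Y y0 n) (sym_smash_power_point Y y0 n) (sym_smash_box_map Y y0 f n)"
    and "homotopy_equivalence_map (realization X) (realization Y) (realization_map Y f) \<Longrightarrow>
      trivial_cofibration (sym_smash_box_source X x0 Y y0 f n) (sym_smash_power Y y0 n) (sym_smash_box_map Y y0 f n)"
proof -
  let ?Z = "punctured_cube X Y n" and ?t = "terminal_vertex_map f" and ?B = "\<lambda>k. {base_cell Y y0 k}"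
  let ?R = "smash_cube_rel X x0 Y y0 f"
  have y0c: "y0 \<in> cells Y 0" using map_closed[OF x0] y0 by simp
  have B: "subcomplex Y ?B" by (rule target.subcomplex_base[OF y0c])
  have z: "restrict (\<lambda>_. 0) {..k} \<in> simplex_maps k 0" for k by (rule restrict_simplex_maps) auto
  have base: "base_cell X x0 k \<in> cells X k" "f k (base_cell X x0 k) = base_cell Y y0 k" for k
    using source.act_closed[OF z x0] map_natural[OF z x0] y0 by (auto simp: base_cell_def)
  \<comment> \<open>The converse uses injectivity: an entry from \<open>X\<close> whose image is the
    base cell of \<open>Y\<close> is the base cell of \<open>X\<close>. So the collapse in the
    source is exactly the one seen in the target.\<close>
  have at_base: "at_base X x0 Y y0 k w \<longleftrightarrow> set (?t k w) \<inter> ?B k \<noteq> {}" if w: "w \<in> cells ?Z k" for w k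
  proof
    assume "at_base X x0 Y y0 k w"
    then show "set (?t k w) \<inter> ?B k \<noteq> {}"
      unfolding at_base_def terminal_vertex_map_def using base(2)[of k] by force
  next
    assume "set (?t k w) \<inter> ?B k \<noteq> {}"
    then obtain a where a: "a \<in> set w" "case_sum (f k) id a = base_cell Y y0 k"
      by (auto simp: terminal_vertex_map_def)
    show "at_base X x0 Y y0 k w"
    proof (cases a)
      case (Inl x)
      then have "x \<in> cells X k" using a(1) w by (auto simp: cells_cube)
      moreover have "f k x = f k (base_cell X x0 k)" using a(2) Inl base(2) by simp
      ultimately have "x = base_cell X x0 k" using inj_onD[OF inj] base(1) by blast
      then show ?thesis using a(1) Inl by (simp add: at_base_def)
    next
      case (Inr y)
      then show ?thesis using a by (simp add: at_base_def)
    qed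
  qed
  have C: "list_orbits ?Z Y n ?t ?B ?R"
    by (rule list_orbits_cube[OF inj B]) (simp add: smash_cube_rel_def at_base)
  interpret C: list_orbits ?Z Y n ?t ?B ?R by (rule C)
  interpret P: list_orbits "power_sset Y n" Y n "\<lambda>k w. w" ?B "smash_rel Y y0"
    by (rule target.list_orbits_smash_power[OF B])
  have \<Sigma>: "sym_smash_box_source X x0 Y y0 f n = C.total"
    by (simp add: sym_smash_box_source_def orbits_def smash_box_source_def)
  have tc: "?t k w \<in> cells (power_sset Y n) k" if "w \<in> cells ?Z k" for k w
    using terminal_vertex_closed[OF that] by (simp add: target.cells_power)
  have box: "smash_box_map Y y0 f n k (C.cl k v) = P.cl k (?t k v)" if v: "v \<in> cells ?Z k" for k v
    unfolding smash_box_map_def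
  proof (rule P.Q.quot_map_eq_class)
    show "C.cl k v \<noteq> {}" using C.Q.quot_class_self[OF v] by blast
    show "?t k v \<in> cells (power_sset Y n) k" by (rule tc[OF v])
    fix u assume "u \<in> C.cl k v"
    then have "u \<in> cells ?Z k" "C.K1 k v u" using C.Q.quot_class_mem_iff[OF v] by blast+
    then show "?t k u \<in> cells (power_sset Y n) k \<and> P.K1 k (?t k v) (?t k u)"
      using tc unfolding C.K1_def P.K1_def by simp
  qed
  have j: "sym_smash_box_map Y y0 f n k (C.proj k w) = P.proj k (?t k w)" if w: "w \<in> cells ?Z k" for k w
    unfolding sym_smash_box_map_def P.proj_def smash_power_def
  proof (rule P.O.quot_map_eq_class[OF C.proj_nonempty[OF w]])
    show "P.cl k (?t k w) \<in> cells P.Q1 k" using tc[OF w] by (simp add: P.Q.cells_quot)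
    fix D assume "D \<in> C.proj k w"
    then obtain v where v: "v \<in> cells ?Z k" "D = C.cl k v" "C.K2 k w v" by (rule C.proj_elem[OF w])
    have "P.K2 k (?t k w) (?t k v)" using v(3) unfolding C.K2_def P.K2_def .
    then show "smash_box_map Y y0 f n k D \<in> cells P.Q1 k \<and>
        (\<exists>u\<in>cells (power_sset Y n) k. \<exists>u'\<in>cells (power_sset Y n) k.
          P.cl k (?t k w) = P.cl k u \<and> smash_box_map Y y0 f n k D = P.cl k u' \<and> P.K2 k u u')"
      using box[OF v(1)] v(2) tc[OF w] tc[OF v(1)] by (auto simp: P.Q.cells_quot)
  qed
  note S = subquotient_map[OF inj target.power_quotient_sym_smash_power[OF B] C \<Sigma>]
  have cof: "cofibration (sym_smash_box_source X x0 Y y0 f n) (sym_smash_power Y y0 n) (sym_smash_box_map Y y0 f n)"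
    by (rule S(1)) (rule j)
  let ?w = "replicate n (Inl x0)"
  \<comment> \<open>For \<open>n = 0\<close> the punctured cube would be empty and the source would
    have no base point.\<close>
  have wc: "?w \<in> cells ?Z 0" using n x0 by (auto simp: cells_cube)
  have tw: "?t 0 ?w = replicate n y0" using y0 by (simp add: terminal_vertex_map_def)
  have p1: "sym_smash_box_point X x0 Y y0 f n = C.proj 0 ?w"
    by (simp add: sym_smash_box_point_def smash_box_point_def smash_box_source_def quot_point_class C.proj_def)
  have p2: "sym_smash_power_point Y y0 n = P.proj 0 (replicate n y0)"
    by (simp add: sym_smash_power_point_def smash_power_point_def smash_power_def quot_point_class P.proj_def)
  have "C.proj 0 ?w \<in> cells C.total 0" using wc C.cells_total by blast
  moreover have "P.proj 0 (replicate n y0) \<in> cells P.total 0"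
    using tc[OF wc] tw P.cells_total by (metis imageI)
  moreover have "sym_smash_power Y y0 n = P.total"
    by (simp add: sym_smash_power_def orbits_def smash_power_def)
  ultimately show "pointed_cofibration (sym_smash_box_source X x0 Y y0 f n) (sym_smash_box_point X x0 Y y0 f n)
      (sym_smash_power Y y0 n) (sym_smash_power_point Y y0 n) (sym_smash_box_map Y y0 f n)"
    using cof j[OF wc] unfolding pointed_cofibration_def pointed_map_def cofibration_def p1 p2 \<Sigma> tw by simp
  show "trivial_cofibration (sym_smash_box_source X x0 Y y0 f n) (sym_smash_power Y y0 n) (sym_smash_box_map Y y0 f n)"
    if "homotopy_equivalence_map (realization X) (realization Y) (realization_map Y f)"
  proof (rule S(2)[OF _ n _ that])
    show "sym_smash_box_map Y y0 f n k (C.proj k w) = P.proj k (?t k w)" if "w \<in> cells ?Z k" for k w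
      by (rule j[OF that])
    \<comment> \<open>Because \<open>f\<close> is pointed, the collapsed part lies in the image,
      where the deformation is constant.\<close>
    show "{base_cell Y y0 k} \<subseteq> image_cells k" for k using base[of k] by (metis imageI singletonD subsetI)
  qed
qed

end

theorem proposition55:
  fixes X :: "'a sset" and Y :: "'b sset" and f :: "nat \<Rightarrow> 'a \<Rightarrow> 'b" and x0 :: 'a and y0 :: 'b
  shows "(cofibration X Y f \<longrightarrow> symmetrizable_cofibration X Y f) \<and>
         (trivial_cofibration X Y f \<longrightarrow> symmetrizable_trivial_cofibration X Y f) \<and>
         (pointed_cofibration X x0 Y y0 f \<longrightarrow>
            symmetrizable_pointed_cofibration X x0 Y y0 f) \<and>
         (pointed_trivial_cofibration X x0 Y y0 f \<longrightarrow>
            symmetrizable_pointed_trivial_cofibration X x0 Y y0 f)"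
proof (cases "cofibration X Y f")
  case True
  then interpret simplicial_map X Y f by (simp add: cofibration_def)
  have inj: "inj_on (f k) (cells X k)" for k using True by (simp add: cofibration_def)
  have pt: "x0 \<in> cells X 0" "f 0 x0 = y0" if "pointed_map X x0 Y y0 f"
    using that by (auto simp: pointed_map_def)
  have map: "simplicial_map X Y f" by (rule simplicial_map_axioms)
  show ?thesis
  proof (intro conjI impI)
    show "symmetrizable_cofibration X Y f"
      unfolding symmetrizable_cofibration_def using map sym_box_map_cofibration(1)[OF inj] by blast
    show "symmetrizable_trivial_cofibration X Y f" if "trivial_cofibration X Y f"
      unfolding symmetrizable_trivial_cofibration_def
      using that map sym_box_map_cofibration(2)[OF inj]
      by (simp add: trivial_cofibration_def[of X] weak_equivalence_def[of X])
    show "symmetrizable_pointed_cofibration X x0 Y y0 f" if "pointed_cofibration X x0 Y y0 f"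
    proof -
      have pm: "pointed_map X x0 Y y0 f" using that by (simp add: pointed_cofibration_def)
      show ?thesis
        unfolding symmetrizable_pointed_cofibration_def
        using pm sym_smash_box_map_cofibration(1)[OF inj pt[OF pm]] by blast
    qed
    show "symmetrizable_pointed_trivial_cofibration X x0 Y y0 f" if "pointed_trivial_cofibration X x0 Y y0 f"
    proof -
      have pm: "pointed_map X x0 Y y0 f"
        and eq: "homotopy_equivalence_map (realization X) (realization Y) (realization_map Y f)"
        using that by (auto simp: pointed_trivial_cofibration_def trivial_cofibration_def weak_equivalence_def)
      show ?thesis
        unfolding symmetrizable_pointed_trivial_cofibration_def
        using pm sym_smash_box_map_cofibration[OF inj pt[OF pm]] eq
        by (simp add: pointed_trivial_cofibration_def pointed_cofibration_def)
    qed
  qed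
next
  case False
  \<comment> \<open>Each of the four premises contains that \<open>f\<close> is a
    cofibration.\<close>
  then show ?thesis
    by (auto simp: trivial_cofibration_def pointed_cofibration_def pointed_trivial_cofibration_def)
qed

end
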